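(* Let $\mathcal{T}$ be a Turing machine and let $\mathbf{B}(\mathcal{T})$ be the finite algebra associated with $\mathcal{T}$ (both as defined in the context). If $\mathcal{T}$ halts, then $\mathbf{4} \in \mathrm{typ}\{V(\mathbf{B}(\mathcal{T}))\}$.
   Context: **Types.** $V(\mathbf{A})$ is the variety generated by $\mathbf{A}$. Types are those of tame congruence theory (Hobby–McKenzie): each prime quotient (covering pair) in the congruence lattice of a finite algebra has a type in $\{\mathbf{1},\mathbf{2},\mathbf{3},\mathbf{4},\mathbf{5}\}$; type $\mathbf{4}$ is the lattice type. For a locally finite variety $\mathcal{V}$, $\mathrm{typ}\{\mathcal{V}\}$ is the set of all types of prime quotients of congruence lattices of finite algebras in $\mathcal{V}$. **Turing machines.** A Turing machine $\mathcal{T}$ has internal states $\mu_1,\dots,\mu_k$ ($k\ge 1$), a halting state $\mu_0$, tape symbols $0,1$ and a two-way infinite tape (a function $\mathbb{Z}\to\{0,1\}$). For every $1\le i\le k$ and $r\in\{0,1\}$ it has exactly one instruction $\mu_i r s T\mu_m$, with $s\in\{0,1\}$, $T\in\{L,R\}$, $0\le m\le k$; it means: in state $\mu_i$ reading $r$, replace $r$ by $s$, move one square left (if $T=L$) or right (if $T=R$), and go to state $\mu_m$. There is no instruction beginning with $\mu_0$. $\mathcal{T}$ halts if, started in state $\mu_1$ with the head on square $0$ of the all-zero tape, it reaches state $\mu_0$ after finitely many steps. **Universe of $\mathbf{B}(\mathcal{T})$.** It is the disjoint union $B(\mathcal{T})=\{0\}\cup P\cup U\cup V\cup\overline{V}$,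 where $P=\{P_0,P_1,P_2\}$, $U=\{1,2,H\}$, and $V$ consists of pairwise distinct symbols $C_{ir}^s$, $D_{ir}^s$, $M_i^r$ for $0\le i\le k$ and $r,s\in\{0,1\}$. The set $\overline{V}=\{\overline{v}:v\in V\}$ is a disjoint copy of $V$, and bar is extended to an involution of $V\cup\overline{V}$ by $\overline{\overline{v}}=v$. (Here $0$ is a bottom element and $1,2,H$ are formal symbols.) Put $V_{ir}^s=\{C_{ir}^s,D_{ir}^s,M_i^r\}$ and $V_i=\bigcup_{r,s}V_{ir}^s$. In particular $V_{10}^0=\{C_{10}^0,D_{10}^0,M_1^0\}$ and $V_0$ is the set of elements of $V$ with state index $0$. The algebra has $20k+27$ elements. **Basic operations of $\mathbf{B}(\mathcal{T})$.** They are the following. (1) The constant $0$. (2) $x\wedge y$: the greatest lower bound for the partial order in which $x\le y$ iff $x=0$, or $x=y$, or ($x=P_2$ and $y\in\{P_0,P_1\}$). (3) For $i\in\{0,1,2\}$, with $s_0=C_{10}^0$, $s_1=M_1^0$, $s_2=D_{10}^0$: $x\wedge^i y=x$ if $x=y\in (P\cup V_{10}^0)-\{s_i\}$, and $0$ otherwise. (4) $T_0(x)=P_2$ if $x\in\{P_0,P_2\}$; $T_0(x)=P_0$ if $x=P_1$; $T_0(x)=x$ if $x\in V_0$; $T_0(x)=0$ otherwise. (5) $T_1(x,y)=P_1$ if $x=y=P_0$ or $\{x,y\}=\{P_0,P_1\}$ or $\{x,y\}=\{P_0,P_2\}$; $T_1(x,y)=P_2$ if $\{x,y\}\subseteq\{P_1,P_2\}$;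 $T_1(x,y)=x$ if $x=y\in V_{10}^0$; $T_1(x,y)=0$ otherwise. (6) $J'(x,y,z)=x\wedge z$ if $x=y$ or $\{x,y\}\subseteq P$; $J'(x,y,z)=x$ if $x=\overline{y}\in V\cup\overline{V}$; $J'(x,y,z)=0$ otherwise. (7) Let $t(x,y,z)=z$ if $x=y$ and $t(x,y,z)=x$ otherwise. Then $S_1(u,x,y,z)=x$ if $u\in\{1,2\}$ and $x=y=z\in U\cup V\cup\overline{V}$; $S_1(u,x,y,z)=t(x,y,z)$ if $\{x,y,z\}\subseteq P$; $S_1(u,x,y,z)=0$ otherwise. (8) $S_2(u,v,x,y,z)=x$ if $u=\overline{v}\in V\cup\overline{V}$ and $x=y=z\in U\cup V\cup\overline{V}$; $S_2(u,v,x,y,z)=t(x,y,z)$ if $\{x,y,z\}\subseteq P$; $S_2(u,v,x,y,z)=0$ otherwise. (9) For each instruction $\mu_i r s L\mu_m$ of $\mathcal{T}$ and each $t\in\{0,1\}$, the ternary operation $L_{irt}(x,y,u)$ given by: - $u$ if $x=y=1$ and $u\in P$; - $C_{mt}^{s'}$ if $x=y=1$ and $u=C_{ir}^{s'}$ for some $s'$; - $M_m^t$ if $x=H$, $y=1$, $u=C_{ir}^t$; - $D_{mt}^s$ if $x=2$, $y=H$, $u=M_i^r$; - $D_{mt}^{s'}$ if $x=y=2$ and $u=D_{ir}^{s'}$ for some $s'$; - $\overline{v}$ if $u\in\overline{V}$ and $L_{irt}(x,y,\overline{u})=v\in V$ by the preceding clauses; - $0$ otherwise. (10) For each instruction $\mu_i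 r s R\mu_m$ of $\mathcal{T}$ and each $t\in\{0,1\}$, the ternary operation $R_{irt}(x,y,u)$ given by: - $u$ if $x=y=1$ and $u\in P$; - $C_{mt}^{s'}$ if $x=y=1$ and $u=C_{ir}^{s'}$ for some $s'$; - $C_{mt}^s$ if $x=H$, $y=1$, $u=M_i^r$; - $M_m^t$ if $x=2$, $y=H$, $u=D_{ir}^t$; - $D_{mt}^{s'}$ if $x=y=2$ and $u=D_{ir}^{s'}$ for some $s'$; - $\overline{v}$ if $u\in\overline{V}$ and $R_{irt}(x,y,\overline{u})=v\in V$ by the preceding clauses; - $0$ otherwise. (11) For each operation $F$ in (9) or (10), its reverse $F^o$: $F^o(x,y,u)=v$ when $F(x,y,v)=u\ne 0$ (such $v$ is unique), and $F^o(x,y,u)=0$ if there is no such $v$. Let $\mathcal{M}$ be the set of all operations in (9), (10), (11). (12) Let $\prec$ be the relation on $U$ holding exactly for $2\prec 2$, $2\prec H$, $H\prec 1$, $1\prec 1$. For each $F\in\mathcal{M}$ there are two $4$-ary operations: - $U_F^1(x,y,z,u)=\overline{F(x,y,u)}$ if $x\prec y$, $x\prec z$, $y\ne z$ and $F(x,y,u)\in V\cup\overline{V}$; it equals $F(x,y,u)$ if $x\prec y$ and $y=z$; it equals $0$ otherwise. - $U_F^2(x,y,z,u)=\overline{F(y,z,u)}$ if $x\prec z$, $y\prec z$, $x\ne y$ and $F(y,z,u)\in V\cup\overline{V}$; it equals $F(y,z,u)$ if $x=y$ and $y\prec z$; it equals $0$ otherwise. *)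

theory Defs
  imports "HOL-Algebra.Module" "HOL-Algebra.Bij"
begin

section \<open>Universal algebra\<close>

text \<open>The value of \<^term>\<open>oper\<close> matters only on argument lists over the universe whose
  length is the arity of the symbol.\<close>

record ('f, 'a) ualg =
  univ :: "'a set"
  syms :: "'f set"
  arity :: "'f \<Rightarrow> nat"
  oper :: "'f \<Rightarrow> 'a list \<Rightarrow> 'a"

definition tuples :: "nat \<Rightarrow> 'a set \<Rightarrow> 'a list set" where
  "tuples n X = {xs. length xs = n \<and> set xs \<subseteq> X}"

definition is_ualg :: "('f, 'a) ualg \<Rightarrow> bool" where
  "is_ualg A \<longleftrightarrow> univ A \<noteq> {} \<and>
     (\<forall>f\<in>syms A. \<forall>xs\<in>tuples (arity A f) (univ A). oper A f xs \<in> univ A)"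

definition similar :: "('f, 'a) ualg \<Rightarrow> ('f, 'b) ualg \<Rightarrow> bool" where
  "similar A B \<longleftrightarrow> syms A = syms B \<and> (\<forall>f\<in>syms A. arity A f = arity B f)"

datatype ('f, vars: 'v) uterm = Var 'v | App 'f "('f, 'v) uterm list"

fun wf_term :: "('f, 'a) ualg \<Rightarrow> ('f, 'v) uterm \<Rightarrow> bool" where
  "wf_term A (Var v) \<longleftrightarrow> True"
| "wf_term A (App f ts) \<longleftrightarrow>
     f \<in> syms A \<and> length ts = arity A f \<and> (\<forall>t\<in>set ts. wf_term A t)"

primrec eval_term :: "('f, 'a) ualg \<Rightarrow> ('v \<Rightarrow> 'a) \<Rightarrow> ('f, 'v) uterm \<Rightarrow> 'a" where
  "eval_term A \<rho> (Var v) = \<rho> v"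
| "eval_term A \<rho> (App f ts) = oper A f (map (eval_term A \<rho>) ts)"

definition satisfies_id ::
    "('f, 'a) ualg \<Rightarrow> ('f, nat) uterm \<Rightarrow> ('f, nat) uterm \<Rightarrow> bool" where
  "satisfies_id A s t \<longleftrightarrow>
     (\<forall>\<rho>. range \<rho> \<subseteq> univ A \<longrightarrow> eval_term A \<rho> s = eval_term A \<rho> t)"

text \<open>The equational class of all identities of \<open>A\<close>. By
  \<open>variety_generated_if_HSP\<close> and \<open>HSP_if_variety_generated\<close> below it coincides
  with the closure of \<open>A\<close> under powers, subalgebras and homomorphic images.
  The type of the universes of the members is a parameter.\<close>

definition variety_generated :: "('f, 'a) ualg \<Rightarrow> ('f, 'b) ualg set" where
  "variety_generated A = {D. is_ualg D \<and> similar A D \<and>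
     (\<forall>s t. wf_term A s \<and> wf_term A t \<and> satisfies_id A s t \<longrightarrow> satisfies_id D s t)}"

definition power_ualg :: "'i set \<Rightarrow> ('f, 'a) ualg \<Rightarrow> ('f, 'i \<Rightarrow> 'a) ualg" where
  "power_ualg I A = \<lparr>univ = I \<rightarrow>\<^sub>E univ A, syms = syms A, arity = arity A,
     oper = (\<lambda>f gs. \<lambda>i\<in>I. oper A f (map (\<lambda>g. g i) gs))\<rparr>"

definition subuniverse :: "'a set \<Rightarrow> ('f, 'a) ualg \<Rightarrow> bool" where
  "subuniverse S A \<longleftrightarrow> S \<subseteq> univ A \<and> S \<noteq> {} \<and>
     (\<forall>f\<in>syms A. \<forall>xs\<in>tuples (arity A f) S. oper A f xs \<in> S)"

definition hom_onto :: "('a \<Rightarrow> 'b) \<Rightarrow> ('f, 'a) ualg \<Rightarrow> ('f, 'b) ualg \<Rightarrow> bool" where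
  "hom_onto h A B \<longleftrightarrow> similar A B \<and> h ` univ A = univ B \<and>
     (\<forall>f\<in>syms A. \<forall>xs\<in>tuples (arity A f) (univ A).
        h (oper A f xs) = oper B f (map h xs))"

lemma eval_closed:
  assumes "is_ualg A" "wf_term A t" "\<rho> ` vars t \<subseteq> univ A"
  shows "eval_term A \<rho> t \<in> univ A"
  using assms(2,3)
proof (induction t)
  case (App f ts)
  have "map (eval_term A \<rho>) ts \<in> tuples (arity A f) (univ A)"
    using App by (fastforce simp: tuples_def)
  then show ?case using App.prems assms(1) by (auto simp: is_ualg_def)
qed auto

lemma eval_cong:
  "(\<And>v. v \<in> vars t \<Longrightarrow> \<rho> v = \<sigma> v) \<Longrightarrow> eval_term A \<rho> t = eval_term A \<sigma> t"
proof (induction t)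
  case (App f ts)
  have "map (eval_term A \<rho>) ts = map (eval_term A \<sigma>) ts"
    by (rule map_cong[OF refl]) (use App in auto)
  then show ?case by (simp only: eval_term.simps)
qed auto

lemma eval_rename: "eval_term A \<rho> (map_uterm id r t) = eval_term A (\<rho> \<circ> r) t"
proof (induction t)
  case (App f ts)
  have "map (eval_term A \<rho>) (map (map_uterm id r) ts) = map (eval_term A (\<rho> \<circ> r)) ts"
    unfolding map_map by (rule map_cong[OF refl]) (use App in \<open>simp add: id_def comp_def\<close>)
  then show ?case by (simp only: eval_term.simps uterm.map id_def)
qed auto

lemma wf_rename: "wf_term A (map_uterm id r t) = wf_term A t"
  by (induction t) auto

lemma wf_similar: "similar A B \<Longrightarrow> wf_term A t = wf_term B t"
  by (induction t) (auto simp: similar_def)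

lemma finite_vars: "finite (vars t)"
  by (induction t) auto

lemma eval_power:
  assumes "i \<in> I"
  shows "eval_term (power_ualg I A) \<rho> t i = eval_term A (\<lambda>v. \<rho> v i) t"
proof (induction t)
  case (App f ts)
  then have "map (\<lambda>x. eval_term (power_ualg I A) \<rho> x i) ts
      = map (eval_term A (\<lambda>v. \<rho> v i)) ts"
    by (simp add: map_eq_conv)
  moreover have "eval_term (power_ualg I A) \<rho> (App f ts) i
      = oper A f (map (\<lambda>x. eval_term (power_ualg I A) \<rho> x i) ts)"
    using assms by (simp add: power_ualg_def comp_def)
  ultimately show ?case by (simp only: eval_term.simps)
qed auto

lemma variety_generated_if_HSP:
  fixes A :: "('f, 'a) ualg" and D :: "('f, 'd) ualg" and I :: "'i set"
  assumes A: "is_ualg A" and S: "subuniverse S (power_ualg I A)"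
    and h: "hom_onto h ((power_ualg I A)\<lparr>univ := S\<rparr>) D"
  shows "D \<in> variety_generated A"
proof -
  let ?P = "power_ualg I A"
  have sim: "similar A D" using h by (simp add: hom_onto_def similar_def power_ualg_def)
  have img: "h ` S = univ D" using h by (simp add: hom_onto_def)
  have hop: "h (oper ?P f xs) = oper D f (map h xs)"
    if "f \<in> syms A" "xs \<in> tuples (arity A f) S" for f xs
    using h that by (simp add: hom_onto_def power_ualg_def)
  have Sop: "oper ?P f xs \<in> S" if "f \<in> syms A" "xs \<in> tuples (arity A f) S" for f xs
    using S that by (simp add: subuniverse_def power_ualg_def)
  have D: "is_ualg D"
    unfolding is_ualg_def
  proof (intro conjI ballI)
    show "univ D \<noteq> {}" using S img by (auto simp: subuniverse_def)
    fix f ys assume f: "f \<in> syms D" and ys: "ys \<in> tuples (arity D f) (univ D)"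
    have fA: "f \<in> syms A" "arity D f = arity A f" using f sim by (auto simp: similar_def)
    have "ys \<in> map h ` lists S"
      unfolding lists_image[symmetric] img using ys by (simp add: tuples_def in_lists_conv_set subset_iff)
    then obtain xs where xs: "set xs \<subseteq> S" "ys = map h xs" by auto
    then have "xs \<in> tuples (arity A f) S" using ys fA by (auto simp: tuples_def)
    then show "oper D f ys \<in> univ D" using hop Sop fA xs img by (metis image_eqI)
  qed
  have ev: "eval_term ?P \<rho> t \<in> S \<and> h (eval_term ?P \<rho> t) = eval_term D (h \<circ> \<rho>) t"
    if "wf_term A t" "range \<rho> \<subseteq> S" for t and \<rho> :: "nat \<Rightarrow> 'i \<Rightarrow> 'a"
    using that
  proof (induction t)
    case (App f ts)
    have 1: "map (eval_term ?P \<rho>) ts \<in> tuples (arity A f) S"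
      using App by (auto simp: tuples_def)
    have 2: "map h (map (eval_term ?P \<rho>) ts) = map (eval_term D (h \<circ> \<rho>)) ts"
      using App by (auto simp: comp_def)
    have f: "f \<in> syms A" using App.prems by simp
    show ?case unfolding eval_term.simps using hop[OF f 1] Sop[OF f 1] 2 by (simp only:)
  qed auto
  have "satisfies_id D s t" if st: "wf_term A s" "wf_term A t" "satisfies_id A s t" for s t
    unfolding satisfies_id_def
  proof (intro allI impI)
    fix \<sigma> :: "nat \<Rightarrow> 'd" assume "range \<sigma> \<subseteq> univ D"
    then have "\<forall>n. \<exists>x\<in>S. h x = \<sigma> n" using img by (metis imageE rangeI subsetD)
    then obtain \<rho> where \<rho>: "\<And>n. \<rho> n \<in> S" "\<And>n. h (\<rho> n) = \<sigma> n" by metis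
    then have r: "range \<rho> \<subseteq> S" and hr: "h \<circ> \<rho> = \<sigma>" by auto
    have SP: "S \<subseteq> I \<rightarrow>\<^sub>E univ A" using S by (simp add: subuniverse_def power_ualg_def)
    have "eval_term ?P \<rho> s = eval_term ?P \<rho> t"
    proof (rule extensionalityI[of _ I])
      show "eval_term ?P \<rho> s \<in> extensional I" "eval_term ?P \<rho> t \<in> extensional I"
        using ev[OF _ r] st SP by (auto simp: PiE_def)
      fix i assume i: "i \<in> I"
      have "\<rho> n i \<in> univ A" for n using \<rho>(1)[of n] SP i by auto
      then have "range (\<lambda>n. \<rho> n i) \<subseteq> univ A" by auto
      then show "eval_term ?P \<rho> s i = eval_term ?P \<rho> t i"
        using st(3) i by (simp add: eval_power satisfies_id_def)
    qed
    then show "eval_term D \<sigma> s = eval_term D \<sigma> t" using ev[OF _ r] st hr by metis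
  qed
  then show ?thesis using D sim by (simp add: variety_generated_def)
qed

lemma HSP_if_variety_generated:
  fixes A :: "('f, 'a) ualg" and D :: "('f, 'd) ualg"
  assumes A: "is_ualg A" and D: "D \<in> variety_generated A"
  shows "\<exists>(I :: ('d \<Rightarrow> 'a) set) S h.
    subuniverse S (power_ualg I A) \<and> hom_onto h ((power_ualg I A)\<lparr>univ := S\<rparr>) D"
proof -
  define I where "I = {\<rho> :: 'd \<Rightarrow> 'a. range \<rho> \<subseteq> univ A}"
  let ?P = "power_ualg I A"
  define T where "T = {t :: ('f, 'd) uterm. wf_term A t \<and> vars t \<subseteq> univ D}"
  define e where "e t = (\<lambda>\<rho>\<in>I. eval_term A \<rho> t)" for t :: "('f, 'd) uterm"
  define h where "h x = eval_term D id (inv_into T e x)" for x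
  have Dalg: "is_ualg D" and sim: "similar A D"
    and ids: "\<And>s t. wf_term A s \<Longrightarrow> wf_term A t \<Longrightarrow> satisfies_id A s t \<Longrightarrow> satisfies_id D s t"
    using D by (auto simp: variety_generated_def)
  have key: "eval_term D id s = eval_term D id t" if s: "s \<in> T" and t: "t \<in> T" and est: "e s = e t" for s t
  proof -
    let ?X = "vars s \<union> vars t"
    obtain r :: "'d \<Rightarrow> nat" where r: "inj_on r ?X"
      using finite_imp_inj_to_nat_seg[of ?X] by (auto simp: finite_vars)
    obtain d where d: "d \<in> univ D" using Dalg by (auto simp: is_ualg_def)
    define \<sigma> where "\<sigma> n = (if n \<in> r ` ?X then inv_into ?X r n else d)" for n
    have sX: "\<sigma> (r v) = v" if "v \<in> ?X" for v
      using that r by (auto simp: \<sigma>_def)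
    have "\<sigma> n \<in> univ D" for n
      using s t d inv_into_into[of n r ?X] by (auto simp: \<sigma>_def T_def)
    then have rs: "range \<sigma> \<subseteq> univ D" by auto
    have "satisfies_id A (map_uterm id r s) (map_uterm id r t)"
      unfolding satisfies_id_def
    proof (intro allI impI)
      fix \<rho> :: "nat \<Rightarrow> 'a" assume "range \<rho> \<subseteq> univ A"
      then have "\<rho> \<circ> r \<in> I" by (auto simp: I_def)
      then show "eval_term A \<rho> (map_uterm id r s) = eval_term A \<rho> (map_uterm id r t)"
        using fun_cong[OF est, of "\<rho> \<circ> r"] by (simp add: e_def eval_rename)
    qed
    then have "satisfies_id D (map_uterm id r s) (map_uterm id r t)"
      using ids s t by (simp add: wf_rename T_def)
    then have "eval_term D (\<sigma> \<circ> r) s = eval_term D (\<sigma> \<circ> r) t"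
      using rs by (simp add: satisfies_id_def eval_rename)
    moreover have "eval_term D (\<sigma> \<circ> r) s = eval_term D id s"
      by (rule eval_cong) (use sX in auto)
    moreover have "eval_term D (\<sigma> \<circ> r) t = eval_term D id t"
      by (rule eval_cong) (use sX in auto)
    ultimately show ?thesis by simp
  qed
  have he: "h (e t) = eval_term D id t" if "t \<in> T" for t
    unfolding h_def using that key inv_into_into[of "e t" e T] f_inv_into_f[of "e t" e T] by blast
  have eop: "\<exists>t\<in>T. oper ?P f (map e ts) = e t \<and> eval_term D id t = oper D f (map (eval_term D id) ts)"
    if "f \<in> syms A" "ts \<in> tuples (arity A f) T" for f ts
  proof (intro bexI conjI)
    show "App f ts \<in> T" using that by (auto simp: T_def tuples_def)
    show "oper ?P f (map e ts) = e (App f ts)"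
      by (auto simp: power_ualg_def e_def comp_def fun_eq_iff restrict_def intro!: arg_cong[of _ _ "oper A f"])
  qed auto
  have lift: "\<exists>ts. ts \<in> tuples n T \<and> xs = map e ts" if "xs \<in> tuples n (e ` T)" for n xs
  proof -
    have "xs \<in> map e ` lists T"
      unfolding lists_image[symmetric] using that by (simp add: tuples_def in_lists_conv_set subset_iff)
    then show ?thesis using that by (auto simp: tuples_def)
  qed
  have sub: "subuniverse (e ` T) ?P"
    unfolding subuniverse_def
  proof (intro conjI ballI)
    have "e t \<in> univ ?P" if "t \<in> T" for t
    proof -
      have "eval_term A \<rho> t \<in> univ A" if "\<rho> \<in> I" for \<rho>
        by (rule eval_closed[OF A]) (use that \<open>t \<in> T\<close> in \<open>auto simp: T_def I_def\<close>)
      then show ?thesis by (simp add: power_ualg_def e_def)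
    qed
    then show "e ` T \<subseteq> univ ?P" by auto
    obtain d where "d \<in> univ D" using Dalg by (auto simp: is_ualg_def)
    then have "Var d \<in> T" by (simp add: T_def)
    then show "e ` T \<noteq> {}" by auto
    fix f xs assume f: "f \<in> syms ?P" and "xs \<in> tuples (arity ?P f) (e ` T)"
    then have f': "f \<in> syms A" and "xs \<in> tuples (arity A f) (e ` T)" by (auto simp: power_ualg_def)
    then obtain ts where "ts \<in> tuples (arity A f) T" "xs = map e ts" using lift by blast
    then show "oper ?P f xs \<in> e ` T" using eop[OF f'] by auto
  qed
  have "hom_onto h (?P\<lparr>univ := e ` T\<rparr>) D"
    unfolding hom_onto_def
  proof (intro conjI ballI)
    show "similar (?P\<lparr>univ := e ` T\<rparr>) D" using sim by (simp add: similar_def power_ualg_def)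
    have "h (e t) \<in> univ D" if "t \<in> T" for t
      unfolding he[OF that]
      by (rule eval_closed[OF Dalg]) (use that sim in \<open>auto simp: T_def wf_similar\<close>)
    moreover have "d \<in> h ` e ` T" if "d \<in> univ D" for d
    proof -
      have "Var d \<in> T" using that by (simp add: T_def)
      then show ?thesis using he[of "Var d"] by (metis eval_term.simps(1) id_apply image_eqI)
    qed
    ultimately show "h ` univ (?P\<lparr>univ := e ` T\<rparr>) = univ D" by auto
    fix f xs assume "f \<in> syms (?P\<lparr>univ := e ` T\<rparr>)"
      and "xs \<in> tuples (arity (?P\<lparr>univ := e ` T\<rparr>) f) (univ (?P\<lparr>univ := e ` T\<rparr>))"
    then have f': "f \<in> syms A" and "xs \<in> tuples (arity A f) (e ` T)" by (auto simp: power_ualg_def)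
    then obtain ts where ts: "ts \<in> tuples (arity A f) T" "xs = map e ts" using lift by blast
    obtain t where t: "t \<in> T" "oper ?P f (map e ts) = e t"
      "eval_term D id t = oper D f (map (eval_term D id) ts)" using eop[OF f' ts(1)] by blast
    have m: "map h xs = map (eval_term D id) ts"
      using ts he by (auto simp: tuples_def)
    have "h (oper ?P f xs) = oper D f (map h xs)"
      using t(2,3) he[OF t(1)] unfolding m by (simp only: ts(2))
    then show "h (oper (?P\<lparr>univ := e ` T\<rparr>) f xs) = oper D f (map h xs)"
      by simp
  qed
  then show ?thesis using sub by blast
qed


section \<open>Tame congruence theory\<close>

text \<open>In a polynomial term, \<^term>\<open>Var (Inl c)\<close> is the constant \<open>c\<close> and
  \<^term>\<open>Var (Inr i)\<close> is the argument at position \<open>i\<close>, counted from 0.\<close>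

definition poly_terms :: "('f, 'a) ualg \<Rightarrow> nat \<Rightarrow> ('f, 'a + nat) uterm set" where
  "poly_terms A n = {p. wf_term A p \<and> vars p \<subseteq> univ A <+> {..<n}}"

definition poly_eval :: "('f, 'a) ualg \<Rightarrow> ('f, 'a + nat) uterm \<Rightarrow> 'a list \<Rightarrow> 'a" where
  "poly_eval A p xs = eval_term A (case_sum id (\<lambda>i. xs ! i)) p"

definition poly_ops :: "('f, 'a) ualg \<Rightarrow> nat \<Rightarrow> ('a list \<Rightarrow> 'a) set" where
  "poly_ops A n = (\<lambda>p. restrict (poly_eval A p) (tuples n (univ A))) ` poly_terms A n"

definition poly_equivalent :: "('f, 'a) ualg \<Rightarrow> ('g, 'a) ualg \<Rightarrow> bool" where
  "poly_equivalent A B \<longleftrightarrow> univ A = univ B \<and> (\<forall>n. poly_ops A n = poly_ops B n)"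

definition congruence :: "('f, 'a) ualg \<Rightarrow> 'a rel \<Rightarrow> bool" where
  "congruence A \<theta> \<longleftrightarrow> equiv (univ A) \<theta> \<and>
     (\<forall>f\<in>syms A. \<forall>xs ys. length xs = arity A f \<and> list_all2 (\<lambda>x y. (x, y) \<in> \<theta>) xs ys
        \<longrightarrow> (oper A f xs, oper A f ys) \<in> \<theta>)"

definition prime_quotient :: "('f, 'a) ualg \<Rightarrow> 'a rel \<Rightarrow> 'a rel \<Rightarrow> bool" where
  "prime_quotient A \<alpha> \<beta> \<longleftrightarrow> congruence A \<alpha> \<and> congruence A \<beta> \<and> \<alpha> \<subset> \<beta> \<and>
     \<not> (\<exists>\<gamma>. congruence A \<gamma> \<and> \<alpha> \<subset> \<gamma> \<and> \<gamma> \<subset> \<beta>)"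

text \<open>The images \<open>f(A)\<close> of unary polynomial operations \<open>f\<close> with \<open>f(\<beta>)\<close> not
  contained in \<open>\<alpha>\<close>.\<close>

definition separating_images :: "('f, 'a) ualg \<Rightarrow> 'a rel \<Rightarrow> 'a rel \<Rightarrow> 'a set set" where
  "separating_images A \<alpha> \<beta> = {(\<lambda>x. f [x]) ` univ A |f.
     f \<in> poly_ops A 1 \<and> (\<exists>(x, y)\<in>\<beta>. (f [x], f [y]) \<notin> \<alpha>)}"

definition minimal_set :: "('f, 'a) ualg \<Rightarrow> 'a rel \<Rightarrow> 'a rel \<Rightarrow> 'a set \<Rightarrow> bool" where
  "minimal_set A \<alpha> \<beta> U \<longleftrightarrow> U \<in> separating_images A \<alpha> \<beta> \<and>
     (\<forall>W\<in>separating_images A \<alpha> \<beta>. \<not> W \<subset> U)"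

definition tct_trace :: "('f, 'a) ualg \<Rightarrow> 'a rel \<Rightarrow> 'a rel \<Rightarrow> 'a set \<Rightarrow> bool" where
  "tct_trace A \<alpha> \<beta> N \<longleftrightarrow> (\<exists>U x. minimal_set A \<alpha> \<beta> U \<and> x \<in> U \<and>
     N = U \<inter> \<beta> `` {x} \<and> \<not> N \<subseteq> \<alpha> `` {x})"

text \<open>The algebra induced on \<open>N\<close>: its basic operations are all polynomial
  operations of \<open>A\<close> under which \<open>N\<close> is closed, restricted to \<open>N\<close>.\<close>

definition induced_ualg ::
    "('f, 'a) ualg \<Rightarrow> 'a set \<Rightarrow> (nat \<times> ('f, 'a + nat) uterm, 'a) ualg" where
  "induced_ualg A N = \<lparr>univ = N,
     syms = {(n, p). p \<in> poly_terms A n \<and> (\<forall>xs\<in>tuples n N. poly_eval A p xs \<in> N)},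
     arity = fst, oper = (\<lambda>(n, p). poly_eval A p)\<rparr>"

definition quotient_ualg :: "('f, 'a) ualg \<Rightarrow> 'a rel \<Rightarrow> ('f, 'a set) ualg" where
  "quotient_ualg A \<theta> = \<lparr>univ = univ A // \<theta>, syms = syms A, arity = arity A,
     oper = (\<lambda>f Xs. \<theta> `` {oper A f (map (\<lambda>X. SOME x. x \<in> X) Xs)})\<rparr>"

datatype tct_type = Type1 | Type2 | Type3 | Type4 | Type5

definition perm_ualg :: "'a set \<Rightarrow> ('a \<Rightarrow> 'a) set \<Rightarrow> ('a \<Rightarrow> 'a, 'a) ualg" where
  "perm_ualg X G = \<lparr>univ = X, syms = G, arity = (\<lambda>_. 1), oper = (\<lambda>g xs. g (xs ! 0))\<rparr>"

text \<open>The symbol \<^term>\<open>None\<close> is vector addition and \<^term>\<open>Some r\<close> is multiplication by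
  the scalar \<open>r\<close>.\<close>

definition vector_space_ualg ::
    "'k ring \<Rightarrow> ('k, 'a) module \<Rightarrow> ('k option, 'a) ualg" where
  "vector_space_ualg K V = \<lparr>univ = carrier V,
     syms = insert None (Some ` carrier K),
     arity = (\<lambda>f. case f of None \<Rightarrow> 2 | Some r \<Rightarrow> 1),
     oper = (\<lambda>f xs. case f of
       None \<Rightarrow> xs ! 0 \<oplus>\<^bsub>V\<^esub> xs ! 1 | Some r \<Rightarrow> r \<odot>\<^bsub>V\<^esub> xs ! 0)\<rparr>"

datatype bool_sym = MeetS | JoinS | ComplS

fun two_arity :: "bool_sym \<Rightarrow> nat" where
  "two_arity MeetS = 2" | "two_arity JoinS = 2" | "two_arity ComplS = 1"

fun two_oper :: "'a \<Rightarrow> 'a \<Rightarrow> bool_sym \<Rightarrow> 'a list \<Rightarrow> 'a" where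
  "two_oper a b MeetS xs = (if xs ! 0 = b \<and> xs ! 1 = b then b else a)"
| "two_oper a b JoinS xs = (if xs ! 0 = b \<or> xs ! 1 = b then b else a)"
| "two_oper a b ComplS xs = (if xs ! 0 = b then a else b)"

text \<open>The reduct to the operations \<open>F\<close> of the Boolean algebra \<open>{a, b}\<close> with \<open>a < b\<close>.\<close>

definition two_ualg :: "bool_sym set \<Rightarrow> 'a \<Rightarrow> 'a \<Rightarrow> (bool_sym, 'a) ualg" where
  "two_ualg F a b = \<lparr>univ = {a, b}, syms = F, arity = two_arity, oper = two_oper a b\<rparr>"

text \<open>The types of the finite minimal algebras. The scalar field in type 2 is
  finite, hence may be taken with carrier in \<^typ>\<open>nat\<close>.\<close>

fun minimal_algebra_type :: "('f, 'a) ualg \<Rightarrow> tct_type \<Rightarrow> bool" where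
  "minimal_algebra_type M Type1 \<longleftrightarrow>
     (\<exists>G. subgroup G (BijGroup (univ M)) \<and> poly_equivalent M (perm_ualg (univ M) G))"
| "minimal_algebra_type M Type2 \<longleftrightarrow>
     (\<exists>(K :: nat ring) V. field K \<and> module K V \<and> poly_equivalent M (vector_space_ualg K V))"
| "minimal_algebra_type M Type3 \<longleftrightarrow>
     (\<exists>a b. a \<noteq> b \<and> poly_equivalent M (two_ualg {MeetS, JoinS, ComplS} a b))"
| "minimal_algebra_type M Type4 \<longleftrightarrow>
     (\<exists>a b. a \<noteq> b \<and> poly_equivalent M (two_ualg {MeetS, JoinS} a b))"
| "minimal_algebra_type M Type5 \<longleftrightarrow>
     (\<exists>a b. a \<noteq> b \<and> poly_equivalent M (two_ualg {MeetS} a b))"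

text \<open>For a prime quotient of a finite algebra traces exist and all of them yield
  the same type, so the type is read off from any one trace.\<close>

definition has_tct_type :: "('f, 'a) ualg \<Rightarrow> 'a rel \<Rightarrow> 'a rel \<Rightarrow> tct_type \<Rightarrow> bool" where
  "has_tct_type A \<alpha> \<beta> \<tau> \<longleftrightarrow> (\<exists>N. tct_trace A \<alpha> \<beta> N \<and>
     minimal_algebra_type (quotient_ualg (induced_ualg A N) (\<alpha> \<inter> N \<times> N)) \<tau>)"

text \<open>Only finite members matter, and each is isomorphic to one with universe in
  \<^typ>\<open>nat\<close>; so for \<open>typ{\<V>}\<close> it is enough to take \<open>\<V>\<close> over \<^typ>\<open>nat\<close>.\<close>

definition typ_set :: "('f, 'a) ualg set \<Rightarrow> tct_type set" where
  "typ_set \<V> = {\<tau>. \<exists>A\<in>\<V>. finite (univ A) \<and>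
     (\<exists>\<alpha> \<beta>. prime_quotient A \<alpha> \<beta> \<and> has_tct_type A \<alpha> \<beta> \<tau>)}"


section \<open>Turing machines\<close>

text \<open>Tape symbols are booleans (\<^term>\<open>False\<close> is 0, \<^term>\<open>True\<close> is 1); the state
  \<open>\<mu>\<^sub>i\<close> is the number \<open>i\<close>. An instruction \<open>\<mu>\<^sub>i r s T \<mu>\<^sub>m\<close> is
  \<^term>\<open>instr M i r = (s, T, m)\<close>; values of \<^term>\<open>instr\<close> at states outside
  \<open>1, \<dots>, k\<close> are irrelevant.\<close>

datatype dir = Lft | Rgt

record tm =
  nstates :: nat
  instr :: "nat \<Rightarrow> bool \<Rightarrow> bool \<times> dir \<times> nat"

definition is_instr :: "tm \<Rightarrow> nat \<Rightarrow> bool \<Rightarrow> bool \<Rightarrow> dir \<Rightarrow> nat \<Rightarrow> bool" where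
  "is_instr \<T> i r s d m \<longleftrightarrow> 1 \<le> i \<and> i \<le> nstates \<T> \<and> instr \<T> i r = (s, d, m)"

definition turing_machine :: "tm \<Rightarrow> bool" where
  "turing_machine \<T> \<longleftrightarrow> 1 \<le> nstates \<T> \<and>
     (\<forall>i r s d m. is_instr \<T> i r s d m \<longrightarrow> m \<le> nstates \<T>)"

type_synonym config = "nat \<times> int \<times> (int \<Rightarrow> bool)"

inductive tm_step :: "tm \<Rightarrow> config \<Rightarrow> config \<Rightarrow> bool" for \<T> where
  "is_instr \<T> i (tape pos) s d m \<Longrightarrow>
   tm_step \<T> (i, pos, tape) (m, (case d of Lft \<Rightarrow> pos - 1 | Rgt \<Rightarrow> pos + 1), tape(pos := s))"

definition halts :: "tm \<Rightarrow> bool" where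
  "halts \<T> \<longleftrightarrow> (\<exists>pos tape. (tm_step \<T>)\<^sup>*\<^sup>* (1, 0, \<lambda>_. False) (0, pos, tape))"


section \<open>The algebra of a Turing machine\<close>

text \<open>\<open>SymC i r s\<close> is \<open>C\<^sub>i\<^sub>r\<^sup>s\<close>, \<open>SymD i r s\<close> is \<open>D\<^sub>i\<^sub>r\<^sup>s\<close>, \<open>SymM i r\<close> is \<open>M\<^sub>i\<^sup>r\<close>.
  \<open>Pos v\<close> and \<open>Neg v\<close> are \<open>v\<close> and its barred copy; \<open>E1\<close>, \<open>E2\<close>, \<open>EH\<close> are the
  formal symbols \<open>1\<close>, \<open>2\<close>, \<open>H\<close>.\<close>

datatype vsym = SymC nat bool bool | SymD nat bool bool | SymM nat bool

datatype elem = Zero | P0 | P1 | P2 | E1 | E2 | EH | Pos vsym | Neg vsym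

fun state_index :: "vsym \<Rightarrow> nat" where
  "state_index (SymC i r s) = i"
| "state_index (SymD i r s) = i"
| "state_index (SymM i r) = i"

definition P_set :: "elem set" where "P_set = {P0, P1, P2}"
definition U_set :: "elem set" where "U_set = {E1, E2, EH}"

definition V_set :: "tm \<Rightarrow> elem set" where
  "V_set \<T> = Pos ` {v. state_index v \<le> nstates \<T>}"

definition Vbar_set :: "tm \<Rightarrow> elem set" where
  "Vbar_set \<T> = Neg ` {v. state_index v \<le> nstates \<T>}"

definition B_univ :: "tm \<Rightarrow> elem set" where
  "B_univ \<T> = {Zero} \<union> P_set \<union> U_set \<union> V_set \<T> \<union> Vbar_set \<T>"

definition V0_set :: "elem set" where
  "V0_set = Pos ` {v. state_index v = 0}"

definition V100_set :: "elem set" where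
  "V100_set = {Pos (SymC 1 False False), Pos (SymD 1 False False), Pos (SymM 1 False)}"

text \<open>The value \<open>Zero\<close> outside the barred and unbarred symbols is never used.\<close>

fun bar :: "elem \<Rightarrow> elem" where
  "bar (Pos v) = Neg v"
| "bar (Neg v) = Pos v"
| "bar _ = Zero"

definition B_le :: "elem \<Rightarrow> elem \<Rightarrow> bool" where
  "B_le x y \<longleftrightarrow> x = Zero \<or> x = y \<or> (x = P2 \<and> y \<in> {P0, P1})"

definition B_meet :: "elem \<Rightarrow> elem \<Rightarrow> elem" where
  "B_meet x y = (THE z. B_le z x \<and> B_le z y \<and> (\<forall>w. B_le w x \<and> B_le w y \<longrightarrow> B_le w z))"

datatype ix = I0 | I1 | I2

fun sep :: "ix \<Rightarrow> elem" where
  "sep I0 = Pos (SymC 1 False False)"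
| "sep I1 = Pos (SymM 1 False)"
| "sep I2 = Pos (SymD 1 False False)"

definition B_meeti :: "ix \<Rightarrow> elem \<Rightarrow> elem \<Rightarrow> elem" where
  "B_meeti i x y = (if x = y \<and> x \<in> (P_set \<union> V100_set) - {sep i} then x else Zero)"

definition B_T0 :: "elem \<Rightarrow> elem" where
  "B_T0 x = (if x \<in> {P0, P2} then P2 else if x = P1 then P0
     else if x \<in> V0_set then x else Zero)"

definition B_T1 :: "elem \<Rightarrow> elem \<Rightarrow> elem" where
  "B_T1 x y = (if (x = P0 \<and> y = P0) \<or> {x, y} = {P0, P1} \<or> {x, y} = {P0, P2} then P1
     else if {x, y} \<subseteq> {P1, P2} then P2
     else if x = y \<and> x \<in> V100_set then x else Zero)"

definition B_J :: "tm \<Rightarrow> elem \<Rightarrow> elem \<Rightarrow> elem \<Rightarrow> elem" where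
  "B_J \<T> x y z = (if x = y \<or> {x, y} \<subseteq> P_set then B_meet x z
     else if x = bar y \<and> x \<in> V_set \<T> \<union> Vbar_set \<T> then x else Zero)"

definition B_t :: "elem \<Rightarrow> elem \<Rightarrow> elem \<Rightarrow> elem" where
  "B_t x y z = (if x = y then z else x)"

definition B_S1 :: "tm \<Rightarrow> elem \<Rightarrow> elem \<Rightarrow> elem \<Rightarrow> elem \<Rightarrow> elem" where
  "B_S1 \<T> u x y z =
     (if u \<in> {E1, E2} \<and> x = y \<and> y = z \<and> x \<in> U_set \<union> V_set \<T> \<union> Vbar_set \<T> then x
      else if {x, y, z} \<subseteq> P_set then B_t x y z else Zero)"

definition B_S2 :: "tm \<Rightarrow> elem \<Rightarrow> elem \<Rightarrow> elem \<Rightarrow> elem \<Rightarrow> elem \<Rightarrow> elem" where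
  "B_S2 \<T> u v x y z =
     (if u = bar v \<and> u \<in> V_set \<T> \<union> Vbar_set \<T> \<and>
         x = y \<and> y = z \<and> x \<in> U_set \<union> V_set \<T> \<union> Vbar_set \<T> then x
      else if {x, y, z} \<subseteq> P_set then B_t x y z else Zero)"

text \<open>The machine operations are determined by their instruction \<open>\<mu>\<^sub>i r s T \<mu>\<^sub>m\<close> and \<open>t\<close>.
  In \<open>L_pos\<close> and \<open>R_pos\<close> the clause for barred \<open>u\<close> is left out; it is added in
  \<open>move_op\<close>.\<close>

definition L_pos :: "nat \<Rightarrow> bool \<Rightarrow> bool \<Rightarrow> nat \<Rightarrow> bool \<Rightarrow> elem \<Rightarrow> elem \<Rightarrow> elem \<Rightarrow> elem" where
  "L_pos i r s m t x y u =
     (if x = E1 \<and> y = E1 \<and> u \<in> P_set then u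
      else if x = E1 \<and> y = E1 \<and> (\<exists>s'. u = Pos (SymC i r s'))
        then Pos (SymC m t (THE s'. u = Pos (SymC i r s')))
      else if x = EH \<and> y = E1 \<and> u = Pos (SymC i r t) then Pos (SymM m t)
      else if x = E2 \<and> y = EH \<and> u = Pos (SymM i r) then Pos (SymD m t s)
      else if x = E2 \<and> y = E2 \<and> (\<exists>s'. u = Pos (SymD i r s'))
        then Pos (SymD m t (THE s'. u = Pos (SymD i r s')))
      else Zero)"

definition R_pos :: "nat \<Rightarrow> bool \<Rightarrow> bool \<Rightarrow> nat \<Rightarrow> bool \<Rightarrow> elem \<Rightarrow> elem \<Rightarrow> elem \<Rightarrow> elem" where
  "R_pos i r s m t x y u =
     (if x = E1 \<and> y = E1 \<and> u \<in> P_set then u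
      else if x = E1 \<and> y = E1 \<and> (\<exists>s'. u = Pos (SymC i r s'))
        then Pos (SymC m t (THE s'. u = Pos (SymC i r s')))
      else if x = EH \<and> y = E1 \<and> u = Pos (SymM i r) then Pos (SymC m t s)
      else if x = E2 \<and> y = EH \<and> u = Pos (SymD i r t) then Pos (SymM m t)
      else if x = E2 \<and> y = E2 \<and> (\<exists>s'. u = Pos (SymD i r s'))
        then Pos (SymD m t (THE s'. u = Pos (SymD i r s')))
      else Zero)"

text \<open>\<open>MoveOp d i r t\<close> names \<open>L\<^sub>i\<^sub>r\<^sub>t\<close> or \<open>R\<^sub>i\<^sub>r\<^sub>t\<close>, according to \<open>d\<close>.\<close>

datatype move_sym = MoveOp dir nat bool bool

fun move_pos :: "tm \<Rightarrow> move_sym \<Rightarrow> elem \<Rightarrow> elem \<Rightarrow> elem \<Rightarrow> elem" where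
  "move_pos \<T> (MoveOp d i r t) = (case instr \<T> i r of (s, _, m) \<Rightarrow>
     (case d of Lft \<Rightarrow> L_pos i r s m t | Rgt \<Rightarrow> R_pos i r s m t))"

definition move_op :: "tm \<Rightarrow> move_sym \<Rightarrow> elem \<Rightarrow> elem \<Rightarrow> elem \<Rightarrow> elem" where
  "move_op \<T> F x y u =
     (if u \<in> Vbar_set \<T>
      then (if move_pos \<T> F x y (bar u) \<in> V_set \<T> then bar (move_pos \<T> F x y (bar u)) else Zero)
      else move_pos \<T> F x y u)"

definition move_rev :: "tm \<Rightarrow> move_sym \<Rightarrow> elem \<Rightarrow> elem \<Rightarrow> elem \<Rightarrow> elem" where
  "move_rev \<T> F x y u =
     (if u \<noteq> Zero \<and> (\<exists>v\<in>B_univ \<T>. move_op \<T> F x y v = u)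
      then THE v. v \<in> B_univ \<T> \<and> move_op \<T> F x y v = u else Zero)"

datatype mach_sym = Fwd move_sym | Rev move_sym

definition move_syms :: "tm \<Rightarrow> move_sym set" where
  "move_syms \<T> = {MoveOp d i r t |d i r t. \<exists>s m. is_instr \<T> i r s d m}"

definition mach_syms :: "tm \<Rightarrow> mach_sym set" where
  "mach_syms \<T> = Fwd ` move_syms \<T> \<union> Rev ` move_syms \<T>"

fun mach_op :: "tm \<Rightarrow> mach_sym \<Rightarrow> elem \<Rightarrow> elem \<Rightarrow> elem \<Rightarrow> elem" where
  "mach_op \<T> (Fwd F) = move_op \<T> F"
| "mach_op \<T> (Rev F) = move_rev \<T> F"

definition prec :: "elem \<Rightarrow> elem \<Rightarrow> bool" where
  "prec x y \<longleftrightarrow> (x, y) \<in> {(E2, E2), (E2, EH), (EH, E1), (E1, E1)}"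

definition B_U1 :: "tm \<Rightarrow> mach_sym \<Rightarrow> elem \<Rightarrow> elem \<Rightarrow> elem \<Rightarrow> elem \<Rightarrow> elem" where
  "B_U1 \<T> F x y z u =
     (if prec x y \<and> prec x z \<and> y \<noteq> z \<and> mach_op \<T> F x y u \<in> V_set \<T> \<union> Vbar_set \<T>
        then bar (mach_op \<T> F x y u)
      else if prec x y \<and> y = z then mach_op \<T> F x y u else Zero)"

definition B_U2 :: "tm \<Rightarrow> mach_sym \<Rightarrow> elem \<Rightarrow> elem \<Rightarrow> elem \<Rightarrow> elem \<Rightarrow> elem" where
  "B_U2 \<T> F x y z u =
     (if prec x z \<and> prec y z \<and> x \<noteq> y \<and> mach_op \<T> F y z u \<in> V_set \<T> \<union> Vbar_set \<T>
        then bar (mach_op \<T> F y z u)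
      else if x = y \<and> prec y z then mach_op \<T> F y z u else Zero)"

datatype B_sym = OZero | OMeet | OMeeti ix | OT0 | OT1 | OJ | OS1 | OS2
  | OMach mach_sym | OU1 mach_sym | OU2 mach_sym

fun B_arity :: "B_sym \<Rightarrow> nat" where
  "B_arity OZero = 0"
| "B_arity OMeet = 2"
| "B_arity (OMeeti i) = 2"
| "B_arity OT0 = 1"
| "B_arity OT1 = 2"
| "B_arity OJ = 3"
| "B_arity OS1 = 4"
| "B_arity OS2 = 5"
| "B_arity (OMach F) = 3"
| "B_arity (OU1 F) = 4"
| "B_arity (OU2 F) = 4"

fun B_oper :: "tm \<Rightarrow> B_sym \<Rightarrow> elem list \<Rightarrow> elem" where
  "B_oper \<T> OZero xs = Zero"
| "B_oper \<T> OMeet xs = B_meet (xs ! 0) (xs ! 1)"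
| "B_oper \<T> (OMeeti i) xs = B_meeti i (xs ! 0) (xs ! 1)"
| "B_oper \<T> OT0 xs = B_T0 (xs ! 0)"
| "B_oper \<T> OT1 xs = B_T1 (xs ! 0) (xs ! 1)"
| "B_oper \<T> OJ xs = B_J \<T> (xs ! 0) (xs ! 1) (xs ! 2)"
| "B_oper \<T> OS1 xs = B_S1 \<T> (xs ! 0) (xs ! 1) (xs ! 2) (xs ! 3)"
| "B_oper \<T> OS2 xs = B_S2 \<T> (xs ! 0) (xs ! 1) (xs ! 2) (xs ! 3) (xs ! 4)"
| "B_oper \<T> (OMach F) xs = mach_op \<T> F (xs ! 0) (xs ! 1) (xs ! 2)"
| "B_oper \<T> (OU1 F) xs = B_U1 \<T> F (xs ! 0) (xs ! 1) (xs ! 2) (xs ! 3)"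
| "B_oper \<T> (OU2 F) xs = B_U2 \<T> F (xs ! 0) (xs ! 1) (xs ! 2) (xs ! 3)"

definition B_syms :: "tm \<Rightarrow> B_sym set" where
  "B_syms \<T> = {OZero, OMeet, OT0, OT1, OJ, OS1, OS2} \<union> range OMeeti \<union>
     OMach ` mach_syms \<T> \<union> OU1 ` mach_syms \<T> \<union> OU2 ` mach_syms \<T>"

definition B_alg :: "tm \<Rightarrow> (B_sym, elem) ualg" where
  "B_alg \<T> = \<lparr>univ = B_univ \<T>, syms = B_syms \<T>, arity = B_arity, oper = B_oper \<T>\<rparr>"

end

theory Submission
  imports Defs
begin

text \<open>On \<open>{P\<^sub>2, P\<^sub>0}\<close> the operation \<open>\<and>\<close> is the meet and \<open>T\<^sub>0(T\<^sub>1(x, y))\<close> the join of a two-element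
  lattice. Over a finite window of the tape, a configuration \<open>w\<close> is a tuple with entries in \<open>V\<close>;
  with one more coordinate \<open>p \<in> P\<close> it becomes an element \<open>w\<^sup>p\<close> of a power of \<open>B(\<T>)\<close>. The tuples
  \<open>(1, \<dots>, 1, H, 2, \<dots>, 2)\<close> let the machine operations run \<open>\<T>\<close> forwards and backwards on the
  \<open>w\<^sup>p\<close> without changing \<open>p\<close>. As \<open>T\<^sub>1\<close> acts on the start configuration and \<open>T\<^sub>0\<close> only on a halting one, the
  join on \<open>{start\<^sup>P\<^sup>2, start\<^sup>P\<^sup>0}\<close> is a polynomial because \<open>\<T>\<close> halts: apply \<open>T\<^sub>1\<close>, run to the end,
  apply \<open>T\<^sub>0\<close>, run back. All tuples with a zero in the window are collapsed to one
  absorbing element. In the quotient \<open>S\<^sub>1\<close>, \<open>S\<^sub>2\<close> and \<open>\<and>\<^sup>i\<close> vanish, and every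
  operation respects the order of the coordinate \<open>p\<close>, so no complement is a polynomial. The
  congruence ``same configuration'' is an atom with trace \<open>{start\<^sup>P\<^sup>2, start\<^sup>P\<^sup>0}\<close>.\<close>

section \<open>A criterion for type 4\<close>

definition compatible :: "('f, 'a) ualg \<Rightarrow> ('a \<Rightarrow> 'a \<Rightarrow> bool) \<Rightarrow> bool" where
  "compatible A R \<longleftrightarrow> (\<forall>x\<in>univ A. R x x) \<and>
     (\<forall>f\<in>syms A. \<forall>xs\<in>tuples (arity A f) (univ A). \<forall>ys\<in>tuples (arity A f) (univ A).
        list_all2 R xs ys \<longrightarrow> R (oper A f xs) (oper A f ys))"

lemma eval_compatible:
  assumes A: "is_ualg A" "compatible A R" and t: "wf_term A t"
    and \<rho>: "\<And>v. v \<in> vars t \<Longrightarrow> \<rho> v \<in> univ A \<and> \<sigma> v \<in> univ A \<and> R (\<rho> v) (\<sigma> v)"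
  shows "R (eval_term A \<rho> t) (eval_term A \<sigma> t)"
  using t \<rho>
proof (induction t)
  case (App f ts)
  have cl: "map (eval_term A \<tau>) ts \<in> tuples (arity A f) (univ A)"
    if "\<And>v. v \<in> vars (App f ts) \<Longrightarrow> \<tau> v \<in> univ A" for \<tau>
  proof -
    have "eval_term A \<tau> t \<in> univ A" if "t \<in> set ts" for t
      by (rule eval_closed[OF A(1)]) (use App.prems \<open>t \<in> set ts\<close> \<open>\<And>v. v \<in> vars (App f ts) \<Longrightarrow> \<tau> v \<in> univ A\<close> in auto)
    then show ?thesis using App.prems by (auto simp: tuples_def)
  qed
  have 1: "map (eval_term A \<rho>) ts \<in> tuples (arity A f) (univ A)"
    "map (eval_term A \<sigma>) ts \<in> tuples (arity A f) (univ A)"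
    using cl App.prems(2) by blast+
  have "R (eval_term A \<rho> t) (eval_term A \<sigma> t)" if "t \<in> set ts" for t
    using App that by auto
  then have "list_all2 R (map (eval_term A \<rho>) ts) (map (eval_term A \<sigma>) ts)"
    by (simp add: list_all2_conv_all_nth)
  moreover have "f \<in> syms A" using App.prems by simp
  ultimately show ?case using A(2) 1 unfolding compatible_def eval_term.simps by blast
qed auto

lemma poly_env:
  assumes "p \<in> poly_terms A n" "xs \<in> tuples n (univ A)" "v \<in> vars p"
  shows "case_sum id (\<lambda>i. xs ! i) v \<in> univ A"
  using assms by (fastforce simp: poly_terms_def tuples_def split: sum.splits)

lemma poly_eval_closed:
  assumes "is_ualg A" "p \<in> poly_terms A n" "xs \<in> tuples n (univ A)"
  shows "poly_eval A p xs \<in> univ A"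
  unfolding poly_eval_def
  by (rule eval_closed[OF assms(1)]) (use assms poly_env[OF assms(2,3)] in \<open>auto simp: poly_terms_def\<close>)

lemma poly_eval_compatible:
  assumes "is_ualg A" "compatible A R" "p \<in> poly_terms A n"
    "xs \<in> tuples n (univ A)" "ys \<in> tuples n (univ A)" "list_all2 R xs ys"
  shows "R (poly_eval A p xs) (poly_eval A p ys)"
  unfolding poly_eval_def
proof (rule eval_compatible[OF assms(1,2)])
  show "wf_term A p" using assms(3) by (simp add: poly_terms_def)
  fix v assume v: "v \<in> vars p"
  have "R (case_sum id ((!) xs) v) (case_sum id ((!) ys) v)"
  proof (cases v)
    \<comment> \<open>Constants of the polynomial are compared with themselves, which is where the
      reflexivity in \<open>compatible\<close> enters. Congruences and the order \<open>ord\<close>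
      are both treated as such relations.\<close>
    case (Inl c)
    then show ?thesis using v assms(2,3) by (auto simp: poly_terms_def compatible_def)
  next
    case (Inr i)
    then have "i < n" using v assms(3) by (auto simp: poly_terms_def)
    then show ?thesis using assms(4-6) Inr by (auto simp: tuples_def list_all2_conv_all_nth)
  qed
  then show "case_sum id ((!) xs) v \<in> univ A \<and> case_sum id ((!) ys) v \<in> univ A
      \<and> R (case_sum id ((!) xs) v) (case_sum id ((!) ys) v)"
    using poly_env assms(3-5) v by blast
qed

lemma congruence_compatible:
  assumes "congruence A \<theta>"
  shows "compatible A (\<lambda>x y. (x, y) \<in> \<theta>)"
  using assms unfolding compatible_def congruence_def equiv_def refl_on_def tuples_def by blast

text \<open>The value \<open>z\<close> enters at an occurrence of \<open>v\<close> and is passed on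
  by every operation on the path from there to the root of the term.\<close>

lemma eval_absorbing:
  assumes A: "is_ualg A"
    and absorb: "\<And>f xs. f \<in> syms A \<Longrightarrow> xs \<in> tuples (arity A f) (univ A) \<Longrightarrow> z \<in> set xs
      \<Longrightarrow> oper A f xs = z"
    and t: "wf_term A t" "\<rho> ` vars t \<subseteq> univ A" "v \<in> vars t" "\<rho> v = z"
  shows "eval_term A \<rho> t = z"
  using t
proof (induction t)
  case (App f ts)
  have "eval_term A \<rho> t \<in> univ A" if "t \<in> set ts" for t
    by (rule eval_closed[OF A]) (use App.prems that in auto)
  then have "map (eval_term A \<rho>) ts \<in> tuples (arity A f) (univ A)"
    using App.prems by (auto simp: tuples_def)
  moreover obtain t where t: "t \<in> set ts" "v \<in> vars t" using App.prems by auto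
  have "eval_term A \<rho> t = z" by (rule App.IH[OF t(1)]) (use App.prems t in auto)
  then have "z \<in> set (map (eval_term A \<rho>) ts)" using t(1) by force
  ultimately show ?case using absorb App.prems(1) by simp
qed auto

lemma poly_terms_mono: "n \<le> n' \<Longrightarrow> poly_terms A n \<subseteq> poly_terms A n'"
  by (fastforce simp: poly_terms_def)

lemma poly_eval_append:
  assumes "p \<in> poly_terms A n" "length xs = n"
  shows "poly_eval A p (xs @ ys) = poly_eval A p xs"
  unfolding poly_eval_def
  by (rule eval_cong) (use assms in \<open>auto simp: poly_terms_def nth_append split: sum.splits\<close>)

section \<open>Polynomial operations of the two-element lattice\<close>

abbreviation lattice2 :: "'a \<Rightarrow> 'a \<Rightarrow> (bool_sym, 'a) ualg" where
  "lattice2 a b \<equiv> two_ualg {MeetS, JoinS} a b"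

text \<open>For elements of \<open>{a, b}\<close> the condition \<open>x = a \<or> y = b\<close> is
  the order with \<open>a\<close> below \<open>b\<close>, so this is closure together with
  monotonicity.\<close>

definition mono2 :: "'a \<Rightarrow> 'a \<Rightarrow> nat \<Rightarrow> ('a list \<Rightarrow> 'a) \<Rightarrow> bool" where
  "mono2 a b n g \<longleftrightarrow> (\<forall>xs\<in>tuples n {a, b}. g xs \<in> {a, b}) \<and>
    (\<forall>xs\<in>tuples n {a, b}. \<forall>ys\<in>tuples n {a, b}.
      list_all2 (\<lambda>x y. x = a \<or> y = b) xs ys \<longrightarrow> g xs = a \<or> g ys = b)"

lemma tuples_append: "xs \<in> tuples n X \<Longrightarrow> x \<in> X \<Longrightarrow> xs @ [x] \<in> tuples (Suc n) X"
  by (auto simp: tuples_def)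

text \<open>\<open>g (xs, x) = g (xs, a) \<or> (x \<and> g (xs, b))\<close> for monotone \<open>g\<close>.\<close>

lemma mono2_is_poly:
  assumes "a \<noteq> b" "mono2 a b n g"
  shows "\<exists>t\<in>poly_terms (lattice2 a b) n. \<forall>xs\<in>tuples n {a, b}. poly_eval (lattice2 a b) t xs = g xs"
  using assms(2)
proof (induction n arbitrary: g)
  case 0
  have "g [] \<in> {a, b}" using 0 by (simp add: mono2_def tuples_def)
  then show ?case
    by (intro bexI[of _ "Var (Inl (g []))"])
      (auto simp: poly_terms_def two_ualg_def tuples_def poly_eval_def)
next
  case (Suc n)
  let ?L = "lattice2 a b"
  have ord: "list_all2 (\<lambda>x y. x = a \<or> y = b) xs xs" if "xs \<in> tuples n {a, b}" for xs
    using that by (auto simp: tuples_def list_all2_conv_all_nth dest!: nth_mem)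
  have m: "mono2 a b n (\<lambda>xs. g (xs @ [c]))" if "c \<in> {a, b}" for c
    unfolding mono2_def
  proof (intro conjI ballI impI)
    fix xs ys assume xs: "xs \<in> tuples n {a, b}"
    show "g (xs @ [c]) \<in> {a, b}"
      using Suc.prems tuples_append[OF xs that] unfolding mono2_def by blast
    assume ys: "ys \<in> tuples n {a, b}" and le: "list_all2 (\<lambda>x y. x = a \<or> y = b) xs ys"
    have "list_all2 (\<lambda>x y. x = a \<or> y = b) (xs @ [c]) (ys @ [c])"
      by (rule list_all2_appendI[OF le]) (use that in auto)
    then show "g (xs @ [c]) = a \<or> g (ys @ [c]) = b"
      using Suc.prems tuples_append[OF xs that] tuples_append[OF ys that]
      unfolding mono2_def by blast
  qed
  obtain ta where ta: "ta \<in> poly_terms ?L n"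
    "\<And>xs. xs \<in> tuples n {a, b} \<Longrightarrow> poly_eval ?L ta xs = g (xs @ [a])" using Suc.IH[OF m[of a]] by auto
  obtain tb where tb: "tb \<in> poly_terms ?L n"
    "\<And>xs. xs \<in> tuples n {a, b} \<Longrightarrow> poly_eval ?L tb xs = g (xs @ [b])" using Suc.IH[OF m[of b]] by auto
  define t where "t = App JoinS [ta, App MeetS [Var (Inr n), tb]]"
  have "t \<in> poly_terms ?L (Suc n)"
    using ta(1) tb(1) poly_terms_mono[of n "Suc n" ?L]
    by (auto simp: t_def poly_terms_def two_ualg_def)
  moreover have "poly_eval ?L t zs = g zs" if zt: "zs \<in> tuples (Suc n) {a, b}" for zs
  proof -
    obtain xs x where zs: "zs = xs @ [x]"
      using zt by (cases zs rule: rev_cases) (auto simp: tuples_def)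
    have xs: "xs \<in> tuples n {a, b}" and x: "x \<in> {a, b}" using zt by (auto simp: zs tuples_def)
    have e: "poly_eval ?L ta zs = g (xs @ [a])" "poly_eval ?L tb zs = g (xs @ [b])"
      using poly_eval_append[OF ta(1)] poly_eval_append[OF tb(1)] ta(2) tb(2) xs
      by (auto simp: zs tuples_def)
    have "poly_eval ?L t zs = two_oper a b JoinS [poly_eval ?L ta zs, two_oper a b MeetS [x, poly_eval ?L tb zs]]"
      using xs by (simp add: t_def poly_eval_def two_ualg_def zs tuples_def nth_append)
    \<comment> \<open>At \<open>x = b\<close> the term evaluates to the join of both values of
      \<open>g\<close>; monotonicity in the last argument makes this join equal to
      \<open>g (xs @ [b])\<close>.\<close>
    moreover have "g (xs @ [a]) = a \<or> g (xs @ [b]) = b"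
    proof -
      have "list_all2 (\<lambda>x y. x = a \<or> y = b) (xs @ [a]) (xs @ [b])"
        by (rule list_all2_appendI[OF ord[OF xs]]) auto
      then show ?thesis using Suc.prems tuples_append[OF xs, of a] tuples_append[OF xs, of b]
        unfolding mono2_def by blast
    qed
    moreover have "g (xs @ [a]) \<in> {a, b}" "g (xs @ [b]) \<in> {a, b}"
      using Suc.prems tuples_append[OF xs, of a] tuples_append[OF xs, of b]
      unfolding mono2_def by blast+
    ultimately show ?thesis using x assms(1) e by (auto simp: zs)
  qed
  ultimately show ?case by blast
qed

text \<open>If all basic operations are monotone, the order on \<open>{a, b}\<close> is a compatible
  relation, and polynomials preserve those.\<close>

lemma poly_eval_mono2:
  assumes M: "is_ualg M" "univ M = {a, b}" and p: "p \<in> poly_terms M n"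
    and basic: "\<And>f. f \<in> syms M \<Longrightarrow> mono2 a b (arity M f) (oper M f)"
  shows "mono2 a b n (poly_eval M p)"
proof -
  let ?R = "\<lambda>x y. x = a \<or> y = b"
  have "compatible M ?R"
    unfolding compatible_def using basic M(2) by (auto simp: mono2_def)
  then show ?thesis
    using poly_eval_closed[OF M(1) p] poly_eval_compatible[OF M(1) _ p, of ?R] M(2)
    by (auto simp: mono2_def)
qed

text \<open>The symbols \<open>MeetS\<close> and \<open>JoinS\<close> in the lattice term are
  replaced by \<open>fm\<close> and \<open>fj\<close>. Membership of the values in
  \<open>{a, b}\<close> is carried through the induction because the operations are known to agree
  only there.\<close>

lemma lattice2_translate:
  assumes M: "univ M = {a, b}" "a \<noteq> b"
    and m: "fm \<in> syms M" "arity M fm = 2" "\<And>x y. x \<in> {a, b} \<Longrightarrow> y \<in> {a, b} \<Longrightarrow>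
      oper M fm [x, y] = two_oper a b MeetS [x, y]"
    and j: "fj \<in> syms M" "arity M fj = 2" "\<And>x y. x \<in> {a, b} \<Longrightarrow> y \<in> {a, b} \<Longrightarrow>
      oper M fj [x, y] = two_oper a b JoinS [x, y]"
    and p: "p \<in> poly_terms (lattice2 a b) n"
  shows "\<exists>q\<in>poly_terms M n. \<forall>xs\<in>tuples n {a, b}. poly_eval M q xs = poly_eval (lattice2 a b) p xs
    \<and> poly_eval M q xs \<in> {a, b}"
  using p
proof (induction p)
  case (Var v)
  have "poly_eval M (Var v) xs \<in> {a, b}" if "xs \<in> tuples n {a, b}" for xs
  proof (cases v)
    case (Inl c)
    then show ?thesis using Var by (auto simp: poly_eval_def poly_terms_def two_ualg_def)
  next
    case (Inr i)
    then have "i < length xs" using Var that by (auto simp: poly_terms_def two_ualg_def tuples_def)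
    then show ?thesis using that nth_mem[of i xs] Inr by (auto simp: poly_eval_def tuples_def simp del: nth_mem)
  qed
  moreover have "Var v \<in> poly_terms M n" using Var M by (auto simp: poly_terms_def two_ualg_def)
  ultimately show ?case by (intro bexI[of _ "Var v"]) (auto simp: poly_eval_def)
next
  case (App f ts)
  have f: "f \<in> {MeetS, JoinS}" and "length ts = 2" using App.prems by (auto simp: poly_terms_def two_ualg_def)
  then obtain t u where ts: "ts = [t, u]" by (auto simp: numeral_2_eq_2 length_Suc_conv)
  have "t \<in> poly_terms (lattice2 a b) n" "u \<in> poly_terms (lattice2 a b) n"
    using App.prems by (auto simp: ts poly_terms_def)
  then obtain t' u' where t': "t' \<in> poly_terms M n" "u' \<in> poly_terms M n"
    "\<And>xs. xs \<in> tuples n {a, b} \<Longrightarrow> poly_eval M t' xs = poly_eval (lattice2 a b) t xs \<and> poly_eval M t' xs \<in> {a, b}"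
    "\<And>xs. xs \<in> tuples n {a, b} \<Longrightarrow> poly_eval M u' xs = poly_eval (lattice2 a b) u xs \<and> poly_eval M u' xs \<in> {a, b}"
    using App.IH[of t] App.IH[of u] ts by (metis list.set_intros)
  define g where "g = (if f = MeetS then fm else fj)"
  have g: "g \<in> syms M" "arity M g = 2" "\<And>x y. x \<in> {a, b} \<Longrightarrow> y \<in> {a, b} \<Longrightarrow>
      oper M g [x, y] = two_oper a b f [x, y]"
    using f m j by (auto simp: g_def simp del: two_oper.simps)
  have "App g [t', u'] \<in> poly_terms M n" using t' g by (auto simp: poly_terms_def)
  moreover have "poly_eval M (App g [t', u']) xs = poly_eval (lattice2 a b) (App f ts) xs \<and>
    poly_eval M (App g [t', u']) xs \<in> {a, b}" if xs: "xs \<in> tuples n {a, b}" for xs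
  proof -
    have "poly_eval M (App g [t', u']) xs = oper M g [poly_eval M t' xs, poly_eval M u' xs]"
      by (simp add: poly_eval_def)
    also have "\<dots> = two_oper a b f [poly_eval (lattice2 a b) t xs, poly_eval (lattice2 a b) u xs]"
      using g(3) t'(3,4)[OF xs] by metis
    finally show ?thesis using f by (auto simp: poly_eval_def ts two_ualg_def)
  qed
  ultimately show ?case by blast
qed

text \<open>The polynomials of \<open>M\<close> are monotone, and every monotone operation is a
  lattice polynomial; conversely the lattice operations are basic in \<open>M\<close>. So both sets
  of polynomials are squeezed together.\<close>

lemma poly_equivalent_lattice2:
  assumes M: "is_ualg M" "univ M = {a, b}" "a \<noteq> b"
    and basic: "\<And>f. f \<in> syms M \<Longrightarrow> mono2 a b (arity M f) (oper M f)"
    and m: "fm \<in> syms M" "arity M fm = 2" "\<And>x y. x \<in> {a, b} \<Longrightarrow> y \<in> {a, b} \<Longrightarrow>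
      oper M fm [x, y] = two_oper a b MeetS [x, y]"
    and j: "fj \<in> syms M" "arity M fj = 2" "\<And>x y. x \<in> {a, b} \<Longrightarrow> y \<in> {a, b} \<Longrightarrow>
      oper M fj [x, y] = two_oper a b JoinS [x, y]"
  shows "poly_equivalent M (lattice2 a b)"
proof -
  have u: "univ (lattice2 a b) = {a, b}" by (simp add: two_ualg_def)
  have "poly_ops M n = poly_ops (lattice2 a b) n" for n
  proof (intro equalityI subsetI)
    fix g assume "g \<in> poly_ops M n"
    then obtain p where p: "p \<in> poly_terms M n" "g = restrict (poly_eval M p) (tuples n {a, b})"
      by (auto simp: poly_ops_def M)
    obtain t where t: "t \<in> poly_terms (lattice2 a b) n"
      "\<forall>xs\<in>tuples n {a, b}. poly_eval (lattice2 a b) t xs = poly_eval M p xs"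
      using mono2_is_poly[OF M(3) poly_eval_mono2[OF M(1,2) p(1) basic]] by blast
    have "g = restrict (poly_eval (lattice2 a b) t) (tuples n {a, b})"
      unfolding p(2) using t(2) by (intro restrict_ext) auto
    then show "g \<in> poly_ops (lattice2 a b) n" using t(1) by (auto simp: poly_ops_def u)
  next
    fix g assume "g \<in> poly_ops (lattice2 a b) n"
    then obtain p where p: "p \<in> poly_terms (lattice2 a b) n"
      "g = restrict (poly_eval (lattice2 a b) p) (tuples n {a, b})"
      by (auto simp: poly_ops_def u)
    obtain q where q: "q \<in> poly_terms M n"
      "\<forall>xs\<in>tuples n {a, b}. poly_eval M q xs = poly_eval (lattice2 a b) p xs"
      using lattice2_translate[OF M(2,3) m j p(1)] by blast
    have "g = restrict (poly_eval M q) (tuples n {a, b})"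
      unfolding p(2) using q(2) by (intro restrict_ext) auto
    then show "g \<in> poly_ops M n" using q(1) by (auto simp: poly_ops_def M)
  qed
  then show ?thesis by (simp add: poly_equivalent_def M u)
qed

text \<open>A compatible relation leading from \<open>a\<close> to \<open>b\<close> but not back
  forces every polynomial that preserves \<open>{a, b}\<close> to be monotone, which leaves exactly
  the lattice clone once \<open>pm\<close> and \<open>pj\<close> are present.\<close>

lemma lattice_trace_type4:
  assumes A: "is_ualg A" and R: "compatible A R" and ab: "R a b" "\<not> R b a"
    and N: "a \<in> univ A" "b \<in> univ A"
    and pm: "pm \<in> poly_terms A 2" "\<And>x y. x \<in> {a, b} \<Longrightarrow> y \<in> {a, b} \<Longrightarrow>
      poly_eval A pm [x, y] = two_oper a b MeetS [x, y]"
    and pj: "pj \<in> poly_terms A 2" "\<And>x y. x \<in> {a, b} \<Longrightarrow> y \<in> {a, b} \<Longrightarrow>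
      poly_eval A pj [x, y] = two_oper a b JoinS [x, y]"
  shows "minimal_algebra_type (quotient_ualg (induced_ualg A {a, b})
    (Id_on (univ A) \<inter> {a, b} \<times> {a, b})) Type4"
proof -
  have neq: "a \<noteq> b" using ab by auto
  have Id: "Id_on (univ A) \<inter> {a, b} \<times> {a, b} = {(a, a), (b, b)}" using N by auto
  define M where "M = quotient_ualg (induced_ualg A {a, b}) {(a, a), (b, b)}"
  have uM: "univ M = {{a}, {b}}"
    using neq by (auto simp: M_def quotient_ualg_def induced_ualg_def quotient_def)
  have sM: "(n, p) \<in> syms M \<longleftrightarrow> p \<in> poly_terms A n \<and> (\<forall>xs\<in>tuples n {a, b}. poly_eval A p xs \<in> {a, b})" for n p
    by (simp add: M_def quotient_ualg_def induced_ualg_def)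
  have aM: "arity M (n, p) = n" for n p
    by (simp add: M_def quotient_ualg_def induced_ualg_def)
  have lift: "\<exists>xs\<in>tuples n {a, b}. Xs = map (\<lambda>x. {x}) xs" if "Xs \<in> tuples n {{a}, {b}}" for n Xs
  proof (intro bexI)
    show "Xs = map (\<lambda>x. {x}) (map the_elem Xs)"
      using that by (auto simp: tuples_def comp_def intro!: map_idI[symmetric])
    show "map the_elem Xs \<in> tuples n {a, b}" using that by (auto simp: tuples_def)
  qed
  \<comment> \<open>Each class is a singleton, so the representatives chosen by \<open>SOME\<close>
    in the quotient are determined.\<close>
  have oM: "oper M (n, p) (map (\<lambda>x. {x}) xs) = {poly_eval A p xs}"
    if "(n, p) \<in> syms M" "xs \<in> tuples n {a, b}" for n p xs
    using that sM[of n p] by (auto simp: M_def quotient_ualg_def induced_ualg_def comp_def)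
  have algM: "is_ualg M"
    unfolding is_ualg_def uM
  proof (intro conjI ballI)
    fix f Xs assume f: "f \<in> syms M" and Xs: "Xs \<in> tuples (arity M f) {{a}, {b}}"
    obtain n p where np: "f = (n, p)" by (cases f)
    obtain xs where xs: "xs \<in> tuples n {a, b}" "Xs = map (\<lambda>x. {x}) xs"
      using lift Xs by (auto simp: np aM)
    have "poly_eval A p xs \<in> {a, b}" using f xs(1) sM np by blast
    then show "oper M f Xs \<in> {{a}, {b}}"
      using oM f xs by (auto simp: np)
  qed auto
  have mono: "mono2 {a} {b} (arity M f) (oper M f)" if f: "f \<in> syms M" for f
    unfolding mono2_def
  proof (intro conjI ballI impI)
    fix Xs Ys assume Xs: "Xs \<in> tuples (arity M f) {{a}, {b}}"
    then show "oper M f Xs \<in> {{a}, {b}}" using algM f unfolding is_ualg_def uM by blast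
    assume Ys: "Ys \<in> tuples (arity M f) {{a}, {b}}"
      and le: "list_all2 (\<lambda>x y. x = {a} \<or> y = {b}) Xs Ys"
    obtain n p where np: "f = (n, p)" by (cases f)
    obtain xs where xs: "xs \<in> tuples n {a, b}" "Xs = map (\<lambda>x. {x}) xs"
      using lift Xs by (auto simp: np aM)
    obtain ys where ys: "ys \<in> tuples n {a, b}" "Ys = map (\<lambda>x. {x}) ys"
      using lift Ys by (auto simp: np aM)
    have pp: "p \<in> poly_terms A n" "poly_eval A p xs \<in> {a, b}" "poly_eval A p ys \<in> {a, b}"
      using f sM xs ys by (auto simp: np)
    have ta: "xs \<in> tuples n (univ A)" "ys \<in> tuples n (univ A)"
      using xs ys N by (auto simp: tuples_def)
    have "R x x" if "x \<in> {a, b}" for x using R that N by (auto simp: compatible_def)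
    moreover have "xs ! i \<in> {a, b}" "ys ! i \<in> {a, b}" if "i < n" for i
      using xs(1) ys(1) that nth_mem[of i xs] nth_mem[of i ys] by (auto simp: tuples_def simp del: nth_mem)
    moreover have "xs ! i = a \<or> ys ! i = b" if "i < n" for i
      using le that xs ys by (auto simp: list_all2_conv_all_nth tuples_def)
    ultimately have "R (xs ! i) (ys ! i)" if "i < n" for i
      using that ab(1) by (metis insertE singletonD)
    then have "list_all2 R xs ys" using xs ys by (auto simp: list_all2_conv_all_nth tuples_def)
    from poly_eval_compatible[OF A R pp(1) ta this]
    \<comment> \<open>The only other possibility is the value \<open>b\<close> at \<open>xs\<close>
      and \<open>a\<close> at \<open>ys\<close>, which would give \<open>R b a\<close>.\<close>
    have "poly_eval A p xs = a \<or> poly_eval A p ys = b" using pp ab(2) by auto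
    then show "oper M f Xs = {a} \<or> oper M f Ys = {b}"
      using oM f xs ys by (simp add: np)
  qed
  have two: "\<exists>x y. xs = [x, y] \<and> x \<in> {a, b} \<and> y \<in> {a, b}" if "xs \<in> tuples 2 {a, b}" for xs
    using that by (auto simp: tuples_def numeral_2_eq_2 length_Suc_conv)
  have smj: "(2, pm) \<in> syms M" "(2, pj) \<in> syms M"
    unfolding sM using pm pj by (auto dest!: two)
  have om: "oper M (2, p) [X, Y] = two_oper {a} {b} s [X, Y]"
    if h: "(2, p) \<in> syms M" "s \<in> {MeetS, JoinS}" "X \<in> {{a}, {b}}" "Y \<in> {{a}, {b}}"
      "\<And>x y. x \<in> {a, b} \<Longrightarrow> y \<in> {a, b} \<Longrightarrow> poly_eval A p [x, y] = two_oper a b s [x, y]" for p s X Y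
  proof -
    obtain x y where xy: "X = {x}" "Y = {y}" "x \<in> {a, b}" "y \<in> {a, b}" using h(3,4) by auto
    have "oper M (2, p) [X, Y] = {poly_eval A p [x, y]}"
      using oM[OF h(1), of "[x, y]"] xy by (simp add: tuples_def)
    also have "\<dots> = {two_oper a b s [x, y]}" using h(5)[OF xy(3,4)] by simp
    also have "\<dots> = two_oper {a} {b} s [X, Y]" using h(2) xy(1,2) by auto
    finally show ?thesis .
  qed
  have neq': "{a} \<noteq> {b}" using neq by simp
  have mm: "MeetS \<in> {MeetS, JoinS}" "JoinS \<in> {MeetS, JoinS}" by simp_all
  have "poly_equivalent M (lattice2 {a} {b})"
  proof (rule poly_equivalent_lattice2[OF algM uM neq' mono smj(1) aM _ smj(2) aM])
    fix X Y assume XY: "X \<in> {{a}, {b}}" "Y \<in> {{a}, {b}}"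
    show "oper M (2, pm) [X, Y] = two_oper {a} {b} MeetS [X, Y]"
      by (rule om[OF smj(1) mm(1) XY pm(2)])
    show "oper M (2, pj) [X, Y] = two_oper {a} {b} JoinS [X, Y]"
      by (rule om[OF smj(2) mm(2) XY pj(2)])
  qed
  then have "minimal_algebra_type M Type4"
    unfolding minimal_algebra_type.simps using neq' by (intro exI conjI)
  then show ?thesis unfolding Id M_def .
qed

lemma congruence_Id: "is_ualg A \<Longrightarrow> congruence A (Id_on (univ A))"
  unfolding congruence_def
proof (intro conjI ballI allI impI)
  show "equiv (univ A) (Id_on (univ A))"
    by (auto simp: equiv_def refl_on_def sym_def trans_def)
  fix f xs ys assume A: "is_ualg A" and f: "f \<in> syms A"
    and h: "length xs = arity A f \<and> list_all2 (\<lambda>x y. (x, y) \<in> Id_on (univ A)) xs ys"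
  have "xs = ys" "set xs \<subseteq> univ A"
    using h by (auto simp: list_all2_conv_all_nth in_set_conv_nth Id_on_iff intro: nth_equalityI)
  then show "(oper A f xs, oper A f ys) \<in> Id_on (univ A)"
    using A f h by (auto simp: is_ualg_def tuples_def)
qed

text \<open>Every polynomial that depends on its variable fixes the absorbing element \<open>z\<close>, so no
  separating image inside \<open>{z, a, b}\<close> can be smaller.\<close>

lemma atom_type4:
  assumes A: "is_ualg A"
    and z: "z \<in> univ A" "\<And>f xs. f \<in> syms A \<Longrightarrow> xs \<in> tuples (arity A f) (univ A) \<Longrightarrow> z \<in> set xs
      \<Longrightarrow> oper A f xs = z"
    and \<beta>: "congruence A \<beta>" "(a, b) \<in> \<beta>" "\<And>x. (z, x) \<in> \<beta> \<Longrightarrow> x = z"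
    and atom: "\<And>\<theta> x y. congruence A \<theta> \<Longrightarrow> (x, y) \<in> \<theta> \<Longrightarrow> (x, y) \<in> \<beta> \<Longrightarrow> x \<noteq> y \<Longrightarrow> \<beta> \<subseteq> \<theta>"
    and R: "compatible A R" and ab: "R a b" "\<not> R b a"
    and pe: "pe \<in> poly_terms A 1" "\<And>x. x \<in> univ A \<Longrightarrow> poly_eval A pe [x] \<in> {z, a, b}"
      "poly_eval A pe [a] = a" "poly_eval A pe [b] = b"
    and pm: "pm \<in> poly_terms A 2" "\<And>x y. x \<in> {a, b} \<Longrightarrow> y \<in> {a, b} \<Longrightarrow>
      poly_eval A pm [x, y] = two_oper a b MeetS [x, y]"
    and pj: "pj \<in> poly_terms A 2" "\<And>x y. x \<in> {a, b} \<Longrightarrow> y \<in> {a, b} \<Longrightarrow>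
      poly_eval A pj [x, y] = two_oper a b JoinS [x, y]"
  shows "prime_quotient A (Id_on (univ A)) \<beta> \<and> has_tct_type A (Id_on (univ A)) \<beta> Type4"
proof
  have \<beta>e: "equiv (univ A) \<beta>" using \<beta>(1) by (simp add: congruence_def)
  have \<beta>s: "\<beta> \<subseteq> univ A \<times> univ A" using \<beta>e by (auto simp: equiv_def)
  have \<beta>sym: "(y, x) \<in> \<beta>" if "(x, y) \<in> \<beta>" for x y using \<beta>e that by (auto simp: equiv_def sym_def)
  have \<beta>r: "(x, x) \<in> \<beta>" if "x \<in> univ A" for x using \<beta>e that by (auto simp: equiv_def refl_on_def)
  have N: "a \<in> univ A" "b \<in> univ A" using \<beta>s \<beta>(2) by auto
  have neq: "a \<noteq> b" using ab by auto
  \<comment> \<open>The class of \<open>z\<close> under \<open>\<beta>\<close> is trivial, whereas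
    \<open>a\<close> and \<open>b\<close> are distinct and related.\<close>
  have az: "a \<noteq> z" "b \<noteq> z" using \<beta>(2,3) \<beta>sym neq by metis+
  have sub: "Id_on (univ A) \<subset> \<beta>" using \<beta>r \<beta>(2) neq by auto
  show "prime_quotient A (Id_on (univ A)) \<beta>"
    unfolding prime_quotient_def
  proof (intro conjI notI)
    assume "\<exists>\<gamma>. congruence A \<gamma> \<and> Id_on (univ A) \<subset> \<gamma> \<and> \<gamma> \<subset> \<beta>"
    then obtain \<gamma> where \<gamma>: "congruence A \<gamma>" "Id_on (univ A) \<subset> \<gamma>" "\<gamma> \<subset> \<beta>" by blast
    then obtain x y where "(x, y) \<in> \<gamma>" "x \<noteq> y" using \<beta>s by fastforce
    then show False using atom[OF \<gamma>(1)] \<gamma>(3) by blast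
  qed (use congruence_Id[OF A] \<beta>(1) sub in auto)
  let ?\<alpha> = "Id_on (univ A)" and ?U = "{z, a, b}"
  have t1: "[x] \<in> tuples 1 (univ A) \<longleftrightarrow> x \<in> univ A" for x by (simp add: tuples_def)
  have zW: "z \<in> W \<and> a \<in> W \<and> b \<in> W" if W: "W \<in> separating_images A ?\<alpha> \<beta>" "W \<subseteq> ?U" for W
  proof -
    obtain p x y where p: "p \<in> poly_terms A 1" and Wp: "W = (\<lambda>x. poly_eval A p [x]) ` univ A"
      and xy: "(x, y) \<in> \<beta>" "(poly_eval A p [x], poly_eval A p [y]) \<notin> ?\<alpha>"
      using W(1) \<beta>s unfolding separating_images_def poly_ops_def
      by (fastforce simp: t1[unfolded One_nat_def] image_iff)
    have xyA: "x \<in> univ A" "y \<in> univ A" using xy \<beta>s by auto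
    have pu: "poly_eval A p [x] \<in> univ A" "poly_eval A p [y] \<in> univ A"
      using poly_eval_closed[OF A p] xyA by (simp_all add: tuples_def)
    have pn: "poly_eval A p [x] \<noteq> poly_eval A p [y]" using xy(2) pu by auto
    have vp: "wf_term A p" "vars p \<subseteq> univ A <+> {0}" using p by (auto simp: poly_terms_def)
    \<comment> \<open>A polynomial that omits its variable is constant and separates
      nothing.\<close>
    have "Inr 0 \<in> vars p"
    proof (rule ccontr)
      assume "Inr 0 \<notin> vars p"
      then have "poly_eval A p [x] = poly_eval A p [y]"
        unfolding poly_eval_def using vp(2) by (intro eval_cong) auto
      then show False using pn by simp
    qed
    then have "poly_eval A p [z] = z"
      unfolding poly_eval_def
      by (intro eval_absorbing[OF A z(2) vp(1), of _ "Inr 0"]) (use vp(2) z(1) in auto)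
    then have zW: "z \<in> W" using Wp z(1) by (metis image_eqI)
    have "list_all2 (\<lambda>x y. (x, y) \<in> \<beta>) [x] [y]" using xy by simp
    then have pb: "(poly_eval A p [x], poly_eval A p [y]) \<in> \<beta>"
      using poly_eval_compatible[OF A congruence_compatible[OF \<beta>(1)] p] xyA
      by (simp add: tuples_def)
    \<comment> \<open>Two distinct values related by \<open>\<beta>\<close> both avoid
      \<open>z\<close>; inside \<open>{z, a, b}\<close> they must therefore be \<open>a\<close> and
      \<open>b\<close>, so the image is all of that set.\<close>
    then have "poly_eval A p [x] \<noteq> z" "poly_eval A p [y] \<noteq> z" using pn \<beta>(3) \<beta>sym by metis+
    moreover have "poly_eval A p [x] \<in> W" "poly_eval A p [y] \<in> W" using xyA Wp by auto
    ultimately show ?thesis using zW W(2) pn by (metis insertE singletonD subsetD)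
  qed
  \<comment> \<open>With this \<open>pe\<close> fixes \<open>{z, a, b}\<close> pointwise, so its
    image is the whole set.\<close>
  have "poly_eval A pe [z] = z"
  proof (cases "Inr 0 \<in> vars pe")
    case True
    then show ?thesis unfolding poly_eval_def
      by (intro eval_absorbing[OF A z(2), of _ _ "Inr 0"]) (use pe(1) z(1) in \<open>auto simp: poly_terms_def\<close>)
  next
    case False
    then have "poly_eval A pe [a] = poly_eval A pe [b]"
      unfolding poly_eval_def using pe(1) by (intro eval_cong) (auto simp: poly_terms_def)
    then show ?thesis using pe neq by simp
  qed
  then have 1: "{z, a, b} = (\<lambda>x. poly_eval A pe [x]) ` {z, a, b}" using pe(3,4) by simp
  have 2: "(\<lambda>x. poly_eval A pe [x]) ` {z, a, b} \<subseteq> (\<lambda>x. poly_eval A pe [x]) ` univ A"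
    using z(1) N by (intro image_mono) simp
  have 3: "(\<lambda>x. poly_eval A pe [x]) ` univ A \<subseteq> ?U"
    by (rule image_subsetI) (rule pe(2))
  have "?U = (\<lambda>x. poly_eval A pe [x]) ` univ A"
    by (rule equalityI[OF ord_eq_le_trans[OF 1 2] 3])
  then have Us: "?U = (\<lambda>x. restrict (poly_eval A pe) (tuples 1 (univ A)) [x]) ` univ A"
    by (simp add: tuples_def)
  have "?U \<in> separating_images A ?\<alpha> \<beta>"
    unfolding separating_images_def
  proof (intro CollectI exI conjI)
    show "?U = (\<lambda>x. restrict (poly_eval A pe) (tuples 1 (univ A)) [x]) ` univ A" by (rule Us)
    show "restrict (poly_eval A pe) (tuples 1 (univ A)) \<in> poly_ops A 1"
      using pe(1) by (auto simp: poly_ops_def)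
    show "\<exists>(x, y)\<in>\<beta>. (restrict (poly_eval A pe) (tuples 1 (univ A)) [x],
        restrict (poly_eval A pe) (tuples 1 (univ A)) [y]) \<notin> ?\<alpha>"
      by (intro bexI[OF _ \<beta>(2)]) (use N pe neq in \<open>auto simp: tuples_def\<close>)
  qed
  then have minU: "minimal_set A ?\<alpha> \<beta> ?U"
    unfolding minimal_set_def using zW by blast
  \<comment> \<open>The trace is the class of \<open>a\<close> inside the minimal set;
    \<open>z\<close> drops out because its class is trivial.\<close>
  have "tct_trace A ?\<alpha> \<beta> {a, b}"
    unfolding tct_trace_def
    using minU \<beta>r[OF N(1)] \<beta>(2,3) \<beta>sym az neq
    by (intro exI[of _ ?U] exI[of _ a]) auto
  then show "has_tct_type A ?\<alpha> \<beta> Type4"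
    unfolding has_tct_type_def
    using lattice_trace_type4[OF A R ab N pm pj] by blast
qed

section \<open>The operations of the algebra coordinatewise\<close>

text \<open>Above \<open>Zero\<close> the only strict comparabilities put \<open>P2\<close> below
  \<open>P0\<close> and \<open>P1\<close>. Hence distinct elements of \<open>P_set\<close> meet in
  \<open>P2\<close>, and every other distinct pair meets in \<open>Zero\<close>.\<close>

lemma B_meet_eq: "B_meet x y = (if x = y then x else if x \<in> P_set \<and> y \<in> P_set then P2 else Zero)"
  (is "_ = ?m")
proof -
  have "B_le ?m x \<and> B_le ?m y" by (auto simp: B_le_def P_set_def)
  moreover have "B_le w ?m" if "B_le w x \<and> B_le w y" for w
    using that by (auto simp: B_le_def P_set_def)
  moreover have "B_le u v \<Longrightarrow> B_le v u \<Longrightarrow> u = v" for u v by (auto simp: B_le_def)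
  ultimately show ?thesis unfolding B_meet_def by (intro the_equality) blast+
qed

lemma P_set_simps [simp]:
  "Zero \<notin> P_set" "E1 \<notin> P_set" "E2 \<notin> P_set" "EH \<notin> P_set" "Pos v \<notin> P_set" "Neg v \<notin> P_set"
  "P0 \<in> P_set" "P1 \<in> P_set" "P2 \<in> P_set"
  by (simp_all add: P_set_def)

section \<open>Machine operations on a single coordinate: injectivity, sorts and reversal\<close>

lemma move_pos_cases:
  assumes "move_pos \<T> F x y u \<noteq> Zero"
  shows "prec x y \<and> ((x = E1 \<and> y = E1 \<and> u \<in> P_set \<and> move_pos \<T> F x y u = u)
    \<or> (\<exists>a b. u = Pos a \<and> move_pos \<T> F x y u = Pos b))"
  \<comment> \<open>Every clause with nonzero value has its first two arguments among (1,1), (H,1),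
    (2,H), (2,2), and these are the pairs in \<open>prec\<close>.\<close>
  using assms
  by (cases F) (auto simp: L_pos_def R_pos_def prec_def split: prod.splits dir.splits if_splits)


text \<open>For fixed \<open>x\<close> and \<open>y\<close> one clause governs the symbols of
  \<open>V\<close>, and it keeps the one index of its argument that it leaves free.\<close>

lemma move_pos_inj:
  assumes "move_pos \<T> F x y (Pos a) = Pos c" "move_pos \<T> F x y (Pos a') = Pos c"
  shows "a = a'"
  using assms
  by (cases F) (auto simp: L_pos_def R_pos_def P_set_def split: prod.splits dir.splits if_splits)

text \<open>Away from the head the sorts \<open>C\<close> and \<open>D\<close> are kept. Argument
  and value are both described so that reversed operations are covered too; this secures the two
  ends of the tape window.\<close>

lemma move_pos_sort:
  assumes "move_pos \<T> F x x (Pos a) = Pos b"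
  shows "(x = E1 \<longrightarrow> (\<exists>i r s. a = SymC i r s) \<and> (\<exists>i r s. b = SymC i r s)) \<and>
    (x = E2 \<longrightarrow> (\<exists>i r s. a = SymD i r s) \<and> (\<exists>i r s. b = SymD i r s))"
  using assms
  by (cases F) (auto simp: L_pos_def R_pos_def split: prod.splits dir.splits if_splits)

text \<open>At the two squares involved in a move the first two arguments are (H,1) on the left and
  (2,H) on the right. A left move puts the head on the left square and takes it from the right one;
  a right move does the opposite. The last two clauses serve reversed operations.\<close>

lemma move_pos_head:
  "(\<forall>a b. move_pos \<T> (MoveOp Lft i r t) EH E1 (Pos a) = Pos b \<longrightarrow> (\<exists>i r. b = SymM i r)) \<and>
   (\<forall>a b. move_pos \<T> (MoveOp Rgt i r t) E2 EH (Pos a) = Pos b \<longrightarrow> (\<exists>i r. b = SymM i r)) \<and>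
   (\<forall>a b. move_pos \<T> (MoveOp Lft i r t) E2 EH (Pos a) = Pos b \<longrightarrow> (\<exists>i r. a = SymM i r)) \<and>
   (\<forall>a b. move_pos \<T> (MoveOp Rgt i r t) EH E1 (Pos a) = Pos b \<longrightarrow> (\<exists>i r. a = SymM i r))"
  by (auto simp: L_pos_def R_pos_def split: prod.splits if_splits)

lemma move_pos_index:
  assumes "turing_machine \<T>" "F \<in> move_syms \<T>" "move_pos \<T> F x y (Pos a) = Pos b"
  shows "state_index b \<le> nstates \<T>"
proof -
  obtain d i r t s m where F: "F = MoveOp d i r t" and i: "is_instr \<T> i r s d m"
    using assms(2) by (auto simp: move_syms_def)
  then have "m \<le> nstates \<T>" using assms(1) by (auto simp: turing_machine_def)
  then show ?thesis using assms(3) i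
    by (auto simp: F L_pos_def R_pos_def is_instr_def split: dir.splits if_splits)
qed

lemma move_op_cases:
  assumes "move_op \<T> F x y u \<noteq> Zero"
  shows "prec x y \<and> ((x = E1 \<and> y = E1 \<and> u \<in> P_set \<and> move_op \<T> F x y u = u)
    \<or> (\<exists>a b. u = Pos a \<and> move_op \<T> F x y u = Pos b \<and> move_pos \<T> F x y (Pos a) = Pos b)
    \<or> (\<exists>a b. u = Neg a \<and> move_op \<T> F x y u = Neg b \<and> move_pos \<T> F x y (Pos a) = Pos b))"
proof (cases "u \<in> Vbar_set \<T>")
  case True
  then obtain a where u: "u = Neg a" by (auto simp: Vbar_set_def)
  with True assms have mv: "move_op \<T> F x y u = bar (move_pos \<T> F x y (Pos a))"
    and v: "move_pos \<T> F x y (Pos a) \<in> V_set \<T>"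
    by (auto simp: move_op_def split: if_splits)
  then obtain b where b: "move_pos \<T> F x y (Pos a) = Pos b" by (auto simp: V_set_def)
  then show ?thesis using move_pos_cases[of \<T> F x y "Pos a"] mv u by simp
next
  case False
  then show ?thesis using assms move_pos_cases[of \<T> F x y u] by (auto simp: move_op_def)
qed

text \<open>This uniqueness of the preimage of a nonzero value gives meaning to the description
  operator in \<open>move_rev\<close>.\<close>

lemma move_op_inj:
  assumes "move_op \<T> F x y u = v" "move_op \<T> F x y u' = v" "v \<noteq> Zero"
  shows "u = u'"
  using move_op_cases[of \<T> F x y u] move_op_cases[of \<T> F x y u'] assms move_pos_inj[of \<T> F x y]
  by (auto simp: P_set_def)

lemma move_rev_eq_iff:
  assumes "v \<noteq> Zero" "u \<noteq> Zero"
  shows "move_rev \<T> F x y u = v \<longleftrightarrow> v \<in> B_univ \<T> \<and> move_op \<T> F x y v = u"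
proof
  assume h: "v \<in> B_univ \<T> \<and> move_op \<T> F x y v = u"
  then have "(THE v. v \<in> B_univ \<T> \<and> move_op \<T> F x y v = u) = v"
    using move_op_inj assms(2) by blast
  then show "move_rev \<T> F x y u = v" using h assms by (auto simp: move_rev_def)
next
  assume r: "move_rev \<T> F x y u = v"
  then obtain w where w: "w \<in> B_univ \<T>" "move_op \<T> F x y w = u"
    using assms by (auto simp: move_rev_def split: if_splits)
  then have "(THE v. v \<in> B_univ \<T> \<and> move_op \<T> F x y v = u) = w"
    using move_op_inj assms(2) by blast
  then show "v \<in> B_univ \<T> \<and> move_op \<T> F x y v = u" using r w assms by (auto simp: move_rev_def)
qed

lemma move_op_move_rev:
  "move_rev \<T> F x y u \<noteq> Zero \<Longrightarrow> u \<noteq> Zero \<Longrightarrow> move_op \<T> F x y (move_rev \<T> F x y u) = u"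
  using move_rev_eq_iff by blast

lemma move_rev_Zero [simp]: "move_rev \<T> F x y Zero = Zero"
  by (simp add: move_rev_def)

text \<open>Every machine operation has its partial inverse among the machine operations; hence
  steps between configurations can be undone.\<close>

fun flip :: "mach_sym \<Rightarrow> mach_sym" where
  "flip (Fwd F) = Rev F" | "flip (Rev F) = Fwd F"

lemma flip_syms: "F \<in> mach_syms \<T> \<Longrightarrow> flip F \<in> mach_syms \<T>"
  by (auto simp: mach_syms_def)

lemma mach_op_flip:
  assumes "mach_op \<T> F x y u \<noteq> Zero" "u \<in> B_univ \<T>"
  shows "mach_op \<T> (flip F) x y (mach_op \<T> F x y u) = u"
proof (cases F)
  case (Fwd G)
  then have "u \<noteq> Zero" using assms move_op_cases[of \<T> G x y u] by (auto simp: P_set_def)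
  then show ?thesis using Fwd assms by (simp add: move_rev_eq_iff)
next
  case (Rev G)
  then have "u \<noteq> Zero" using assms by auto
  then show ?thesis using Rev assms by (simp add: move_op_move_rev)
qed

lemma mach_op_cases:
  assumes "mach_op \<T> F x y u \<noteq> Zero"
  shows "prec x y \<and> ((x = E1 \<and> y = E1 \<and> u \<in> P_set \<and> mach_op \<T> F x y u = u)
    \<or> (\<exists>a b. u = Pos a \<and> mach_op \<T> F x y u = Pos b)
    \<or> (\<exists>a b. u = Neg a \<and> mach_op \<T> F x y u = Neg b))"
proof (cases F)
  case (Fwd G)
  then show ?thesis using assms move_op_cases[of \<T> G x y u] by auto
next
  case (Rev G)
  then have "u \<noteq> Zero" using assms by auto
  then have "move_op \<T> G x y (mach_op \<T> F x y u) = u" using Rev assms by (simp add: move_op_move_rev)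
  then show ?thesis using \<open>u \<noteq> Zero\<close> move_op_cases[of \<T> G x y "mach_op \<T> F x y u"] by auto
qed

lemma mach_op_P: "p \<in> P_set \<Longrightarrow> mach_op \<T> F E1 E1 p = p"
proof -
  assume p: "p \<in> P_set"
  have f: "move_op \<T> G E1 E1 p = p" for G
    using p by (cases G) (auto simp: move_op_def Vbar_set_def P_set_def L_pos_def R_pos_def split: prod.splits dir.splits)
  have "p \<noteq> Zero" "p \<in> B_univ \<T>" using p by (auto simp: P_set_def B_univ_def)
  then show ?thesis using f by (cases F) (simp_all add: move_rev_eq_iff)
qed

lemma mach_op_closed:
  assumes "turing_machine \<T>" "F \<in> mach_syms \<T>" "u \<in> B_univ \<T>"
  shows "mach_op \<T> F x y u \<in> B_univ \<T>"
proof (cases "mach_op \<T> F x y u = Zero")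
  case False
  show ?thesis
  proof (cases F)
    case (Fwd G)
    then have G: "G \<in> move_syms \<T>" using assms(2) by (auto simp: mach_syms_def)
    show ?thesis using Fwd False move_op_cases[of \<T> G x y u] assms(3) move_pos_index[OF assms(1) G]
      by (auto simp: B_univ_def V_set_def Vbar_set_def)
  next
    case (Rev G)
    then have "u \<noteq> Zero" using False by auto
    then show ?thesis using Rev False move_rev_eq_iff[of "mach_op \<T> F x y u" u \<T> G x y] by auto
  qed
qed (simp add: B_univ_def)

text \<open>Reduces claims about all machine operations to \<open>move_pos\<close>, with argument
  and value exchanged for reversed operations.\<close>

lemma mach_op_Pos:
  assumes "mach_op \<T> F x y (Pos a) = Pos b"
  obtains G where "F = Fwd G" "move_pos \<T> G x y (Pos a) = Pos b"
  | G where "F = Rev G" "move_pos \<T> G x y (Pos b) = Pos a"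
proof (cases F)
  case (Fwd G)
  then show ?thesis using that(1) assms move_op_cases[of \<T> G x y "Pos a"] by auto
next
  case (Rev G)
  then have "move_op \<T> G x y (Pos b) = Pos a" using assms by (simp add: move_rev_eq_iff)
  then show ?thesis using that(2) Rev move_op_cases[of \<T> G x y "Pos b"] by auto
qed

lemma mach_op_sort:
  assumes "mach_op \<T> F x x (Pos a) = Pos b"
  shows "(x = E1 \<longrightarrow> (\<exists>i r s. b = SymC i r s)) \<and> (x = E2 \<longrightarrow> (\<exists>i r s. b = SymD i r s))"
  using assms by (rule mach_op_Pos) (use move_pos_sort in blast)+

text \<open>A left move and a reversed right move both put the head on the left of the two squares,
  the other two kinds on the right; so some square always receives a symbol
  \<open>M\<close>.\<close>

lemma mach_op_head:
  "(\<forall>a b. mach_op \<T> F EH E1 (Pos a) = Pos b \<longrightarrow> (\<exists>i r. b = SymM i r)) \<or>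
   (\<forall>a b. mach_op \<T> F E2 EH (Pos a) = Pos b \<longrightarrow> (\<exists>i r. b = SymM i r))"
proof -
  obtain G where G: "F = Fwd G \<or> F = Rev G" by (cases F) auto
  obtain d i r t where d: "G = MoveOp d i r t" by (cases G)
  have L: "\<exists>i r. b = SymM i r" if "F = Fwd (MoveOp Lft i r t) \<or> F = Rev (MoveOp Rgt i r t)"
    "mach_op \<T> F EH E1 (Pos a) = Pos b" for a b
    using that(2) by (rule mach_op_Pos) (use that(1) move_pos_head[of \<T> i r t] in auto)
  have R: "\<exists>i r. b = SymM i r" if "F = Fwd (MoveOp Rgt i r t) \<or> F = Rev (MoveOp Lft i r t)"
    "mach_op \<T> F E2 EH (Pos a) = Pos b" for a b
    using that(2) by (rule mach_op_Pos) (use that(1) move_pos_head[of \<T> i r t] in auto)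
  consider "F = Fwd (MoveOp Lft i r t) \<or> F = Rev (MoveOp Rgt i r t)"
    | "F = Fwd (MoveOp Rgt i r t) \<or> F = Rev (MoveOp Lft i r t)"
    using G d by (cases d) auto
  then show ?thesis
  proof cases
    case 1
    then show ?thesis using L by blast
  next
    case 2
    then show ?thesis using R by blast
  qed
qed

lemma bar_closed: "x \<in> V_set \<T> \<union> Vbar_set \<T> \<Longrightarrow> bar x \<in> B_univ \<T>"
  by (auto simp: B_univ_def V_set_def Vbar_set_def)

lemma B_oper_closed:
  assumes tm: "turing_machine \<T>" and f: "f \<in> B_syms \<T>"
    and xs: "xs \<in> tuples (B_arity f) (B_univ \<T>)"
  shows "B_oper \<T> f xs \<in> B_univ \<T>"
proof -
  have n: "xs ! i \<in> B_univ \<T>" if "i < B_arity f" for i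
    using xs that by (auto simp: tuples_def)
  have P: "x \<in> P_set \<Longrightarrow> x \<in> B_univ \<T>" for x by (simp add: B_univ_def)
  have Z: "Zero \<in> B_univ \<T>" "P0 \<in> B_univ \<T>" "P1 \<in> B_univ \<T>" "P2 \<in> B_univ \<T>"
    by (auto simp: B_univ_def P_set_def)
  have ms: "F \<in> mach_syms \<T>" if "f = OMach F \<or> f = OU1 F \<or> f = OU2 F" for F
    using f that by (auto simp: B_syms_def)
  note mc = mach_op_closed[OF tm ms]
  have mt: "B_meet x y \<in> B_univ \<T>" if "x \<in> B_univ \<T>" for x y
    using that Z by (auto simp: B_meet_eq)
  show ?thesis
  proof (cases f)
    case OZero then show ?thesis using Z by simp
  next
    case OMeet
    then show ?thesis using n[of 0] Z by (auto simp add: B_meet_eq)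
  next
    case (OMeeti i)
    then show ?thesis using n[of 0] Z by (auto simp add: B_meeti_def)
  next
    case OT0
    then show ?thesis using n[of 0] Z by (auto simp add: B_T0_def)
  next
    case OT1
    then show ?thesis using n[of 0] Z by (auto simp add: B_T1_def)
  next
    case OJ
    then show ?thesis using n[of 0] mt Z(1) by (metis B_J_def B_arity.simps(6) B_oper.simps(6) zero_less_numeral)
  next
    case OS1
    then show ?thesis using n[of 1] n[of 3] Z by (simp add: B_S1_def B_t_def)
  next
    case OS2
    then show ?thesis using n[of 2] n[of 4] Z by (simp add: B_S2_def B_t_def)
  next
    case (OMach F)
    then show ?thesis using mc[of F] n[of 2] by simp
  next
    case (OU1 F)
    then show ?thesis using mc[of F] n[of 3] Z bar_closed by (simp add: B_U1_def)
  next
    case (OU2 F)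
    then show ?thesis using mc[of F] n[of 3] Z bar_closed by (simp add: B_U2_def)
  qed
qed

lemma is_ualg_B_alg: "turing_machine \<T> \<Longrightarrow> is_ualg (B_alg \<T>)"
  using B_oper_closed by (auto simp: is_ualg_def B_alg_def B_univ_def)

text \<open>The only argument tuples at \<open>None\<close> for which an operation can have a value without
  zeros in the window.\<close>

fun live_args :: "B_sym \<Rightarrow> elem list \<Rightarrow> bool" where
  "live_args OMeet ps \<longleftrightarrow> ps = [E1, E1] \<or> (\<exists>p\<in>P_set. \<exists>q\<in>P_set. ps = [p, q])"
| "live_args OT0 ps \<longleftrightarrow> (\<exists>p\<in>P_set. ps = [p])"
| "live_args OT1 ps \<longleftrightarrow> (\<exists>p\<in>P_set. \<exists>q\<in>P_set. ps = [p, q])"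
| "live_args OJ ps \<longleftrightarrow> ps = [E1, E1, E1] \<or> (\<exists>p\<in>P_set. \<exists>q\<in>P_set. \<exists>r\<in>P_set. ps = [p, q, r])"
| "live_args (OMach F) ps \<longleftrightarrow> (\<exists>p\<in>P_set. ps = [E1, E1, p])"
| "live_args (OU1 F) ps \<longleftrightarrow> (\<exists>p\<in>P_set. ps = [E1, E1, E1, p])"
| "live_args (OU2 F) ps \<longleftrightarrow> (\<exists>p\<in>P_set. ps = [E1, E1, E1, p])"
| "live_args _ ps \<longleftrightarrow> False"

section \<open>Monotonicity at the coordinate \<open>None\<close>\<close>

lemma P_meet: "p \<in> P_set \<Longrightarrow> q \<in> P_set \<Longrightarrow> B_meet p q \<in> P_set"
  by (simp add: B_meet_eq)

lemma P_T0: "p \<in> P_set \<Longrightarrow> B_T0 p \<in> P_set"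
  by (auto simp: B_T0_def P_set_def)

lemma P_T1: "p \<in> P_set \<Longrightarrow> q \<in> P_set \<Longrightarrow> B_T1 p q \<in> P_set"
  by (auto simp: B_T1_def P_set_def)

lemma T1_cases:
  assumes "B_T1 x y \<noteq> Zero"
  shows "(x \<in> P_set \<and> y \<in> P_set) \<or> (x = y \<and> x \<in> V100_set \<and> B_T1 x y = x)"
proof (cases "x \<in> P_set \<and> y \<in> P_set")
  case False
  then have "\<not> ((x = P0 \<and> y = P0) \<or> {x, y} = {P0, P1} \<or> {x, y} = {P0, P2})" "\<not> {x, y} \<subseteq> {P1, P2}"
    by (auto simp: doubleton_eq_iff)
  then have "B_T1 x y = (if x = y \<and> x \<in> V100_set then x else Zero)"
    unfolding B_T1_def by (simp only: if_False)
  then show ?thesis using assms by (auto split: if_splits)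
qed simp

lemma P_J: "p \<in> P_set \<Longrightarrow> q \<in> P_set \<Longrightarrow> B_J \<T> p q r = B_meet p r"
  by (auto simp: B_J_def)

lemma B_le_E1: "B_le E1 q \<longleftrightarrow> q = E1"
  by (auto simp: B_le_def)

lemma meet_mono:
  assumes "p \<in> P_set" "q \<in> P_set" "p' \<in> P_set" "q' \<in> P_set" "B_le p p'" "B_le q q'"
  shows "B_le (B_meet p q) (B_meet p' q')"
  using assms by (auto simp: B_le_def B_meet_eq P_set_def)

lemma T0_mono:
  assumes "p \<in> P_set" "p' \<in> P_set" "B_le p p'"
  shows "B_le (B_T0 p) (B_T0 p')"
  using assms by (auto simp: B_le_def B_T0_def P_set_def)

text \<open>On \<open>P_set\<close> the value of \<open>B_T1\<close> is \<open>P1\<close> if some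
  argument is \<open>P0\<close>, and \<open>P2\<close> otherwise. Since \<open>P0\<close> is
  maximal, an argument \<open>P0\<close> stays \<open>P0\<close> when the arguments are
  raised.\<close>

lemma T1_mono:
  assumes "p \<in> P_set" "q \<in> P_set" "p' \<in> P_set" "q' \<in> P_set" "B_le p p'" "B_le q q'"
  shows "B_le (B_T1 p q) (B_T1 p' q')"
  using assms by (auto simp: B_le_def B_T1_def P_set_def)

lemma B_le_refl: "B_le x x" by (simp add: B_le_def)

lemma not_P_le_E1: "p \<in> P_set \<Longrightarrow> \<not> B_le p E1"
  by (auto simp: B_le_def P_set_def)

lemma B_U1_P: "p \<in> P_set \<Longrightarrow> B_U1 \<T> F E1 E1 E1 p = p"
  and B_U2_P: "p \<in> P_set \<Longrightarrow> B_U2 \<T> F E1 E1 E1 p = p"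
  by (simp_all add: B_U1_def B_U2_def prec_def mach_op_P)

text \<open>On live tuples an operation is \<open>B_meet\<close>, \<open>B_T0\<close>,
  \<open>B_T1\<close> or a projection, and tuples of \<open>E1\<close> are incomparable with tuples
  over \<open>P_set\<close>. The restriction matters: \<open>OS1\<close> and \<open>OS2\<close> act
  on \<open>P_set\<close> by \<open>B_t\<close>, where \<open>B_t P2 P2 P0 = P0\<close> but
  \<open>B_t P2 P0 P0 = P2\<close>.\<close>

lemma live_args_mono:
  assumes ps: "live_args f ps" and qs: "live_args f qs" and le: "list_all2 B_le ps qs"
  shows "B_le (B_oper \<T> f ps) (B_oper \<T> f qs)"
proof (cases f)
  case OMeet
  then show ?thesis using ps qs le meet_mono B_le_refl by (auto simp: B_le_E1 not_P_le_E1)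
next
  case OT0
  then show ?thesis using ps qs le T0_mono by auto
next
  case OT1
  then show ?thesis using ps qs le T1_mono by auto
next
  case OJ
  then show ?thesis using ps qs le by (auto simp: B_le_E1 not_P_le_E1 P_J B_le_refl intro!: meet_mono)
next
  case (OMach F)
  then show ?thesis using ps qs le by (auto simp: B_le_E1 mach_op_P)
next
  case (OU1 F)
  then show ?thesis using ps qs le by (auto simp: B_le_E1 B_U1_P)
next
  case (OU2 F)
  then show ?thesis using ps qs le by (auto simp: B_le_E1 B_U2_P)
qed (use ps in auto)

section \<open>Finiteness of the algebra and boundedness of a run\<close>

lemma finite_B_univ: "finite (B_univ \<T>)"
proof -
  let ?n = "nstates \<T>"
  have "{v. state_index v \<le> ?n} \<subseteq>
    (\<lambda>(i, r, s). SymC i r s) ` ({..?n} \<times> UNIV \<times> UNIV) \<union>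
    (\<lambda>(i, r, s). SymD i r s) ` ({..?n} \<times> UNIV \<times> UNIV) \<union>
    (\<lambda>(i, r). SymM i r) ` ({..?n} \<times> UNIV)"
  proof
    fix v assume "v \<in> {v. state_index v \<le> ?n}"
    then show "v \<in> (\<lambda>(i, r, s). SymC i r s) ` ({..?n} \<times> UNIV \<times> UNIV) \<union>
      (\<lambda>(i, r, s). SymD i r s) ` ({..?n} \<times> UNIV \<times> UNIV) \<union>
      (\<lambda>(i, r). SymM i r) ` ({..?n} \<times> UNIV)"
      by (cases v) (auto simp: image_iff)
  qed
  then have "finite {v. state_index v \<le> ?n}"
    by (rule finite_subset) auto
  then show ?thesis by (auto simp: B_univ_def V_set_def Vbar_set_def P_set_def U_set_def)
qed

text \<open>A finite run visits finitely many squares. The bound is asserted for all larger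
  \<open>n\<close> so that the induction can enlarge it at each step.\<close>

lemma run_bounded:
  assumes "(tm_step \<T>)\<^sup>*\<^sup>* c c'"
  shows "\<exists>m\<ge>1. \<forall>n\<ge>m. (\<lambda>c c'. tm_step \<T> c c' \<and> \<bar>fst (snd c)\<bar> < n \<and> \<bar>fst (snd c')\<bar> < n)\<^sup>*\<^sup>* c c'"
  using assms
proof induction
  case (step c' c'')
  then obtain m where m: "m \<ge> 1" "\<And>n. n \<ge> m \<Longrightarrow>
    (\<lambda>c c'. tm_step \<T> c c' \<and> \<bar>fst (snd c)\<bar> < n \<and> \<bar>fst (snd c')\<bar> < n)\<^sup>*\<^sup>* c c'" by blast
  let ?m = "max m (max (\<bar>fst (snd c')\<bar> + 1) (\<bar>fst (snd c'')\<bar> + 1))"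
  show ?case
  proof (intro exI conjI allI impI)
    fix n assume "?m \<le> n"
    then show "(\<lambda>c c'. tm_step \<T> c c' \<and> \<bar>fst (snd c)\<bar> < n \<and> \<bar>fst (snd c')\<bar> < n)\<^sup>*\<^sup>* c c''"
      by (intro rtranclp.rtrancl_into_rtrancl[OF m(2)]) (use step.hyps(2) in auto)
  qed (use m(1) in auto)
qed auto

section \<open>A subalgebra of a power over a finite tape window\<close>

text \<open>The product has one coordinate \<open>None\<close>, in which configurations take values in \<open>P\<close>, and
  the tape squares \<open>-m, \<dots>, m\<close>. The head stays off the two outer squares, so every
  configuration has a coordinate of each of the kinds \<open>C\<close>, \<open>M\<close>, \<open>D\<close>.\<close>

locale tape_window =
  fixes \<T> :: tm and m :: int
  assumes tm: "turing_machine \<T>" and m: "1 \<le> m"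
begin

definition win :: "int set" where "win = {-m..m}"
definition idx :: "int option set" where "idx = insert None (Some ` win)"

text \<open>\<open>fv j\<close> is the tuple (1,...,1,H,2,...,2) with \<open>H\<close> at square
  \<open>j\<close>. The pair \<open>fv j\<close>, \<open>fv (j + 1)\<close> selects a head move
  between these two squares.\<close>

definition fv :: "int \<Rightarrow> int \<Rightarrow> elem" where
  "fv j k = (if k < j then E1 else if k = j then EH else E2)"

text \<open>The sort tells whether a square lies left of, at or right of the head. Every entry
  carries the state and the scanned symbol; \<open>C\<close> and \<open>D\<close> also carry the
  content of their own square, which for \<open>M\<close> is the scanned symbol.\<close>

definition config_vec :: "config \<Rightarrow> int \<Rightarrow> elem" where
  "config_vec c = (case c of (i, q, \<tau>) \<Rightarrow> \<lambda>k\<in>win. Pos (if k < q then SymC i (\<tau> q) (\<tau> k)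
     else if k = q then SymM i (\<tau> q) else SymD i (\<tau> q) (\<tau> k)))"

definition start :: "int \<Rightarrow> elem" where "start = config_vec (1, 0, \<lambda>_. False)"

definition mv :: "mach_sym \<Rightarrow> int \<Rightarrow> (int \<Rightarrow> elem) \<Rightarrow> int \<Rightarrow> elem" where
  "mv F j w = (\<lambda>k\<in>win. mach_op \<T> F (fv j k) (fv (j + 1) k) (w k))"

definition head_pos :: "int set" where "head_pos = {-m<..<m}"

text \<open>A step is any forward or reversed operation whose result has no zero in the window,
  rather than a step of the machine; this makes \<open>configs\<close> closed under all such
  operations.\<close>

definition mstep :: "(int \<Rightarrow> elem) \<Rightarrow> (int \<Rightarrow> elem) \<Rightarrow> bool" where
  "mstep w w' \<longleftrightarrow> (\<exists>F\<in>mach_syms \<T>. \<exists>j. j \<in> head_pos \<and> j + 1 \<in> head_pos \<and> w' = mv F j w \<and>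
     (\<forall>k\<in>win. w' k \<noteq> Zero))"

definition configs :: "(int \<Rightarrow> elem) set" where "configs = {w. mstep\<^sup>*\<^sup>* start w}"

definition tup :: "(int \<Rightarrow> elem) \<Rightarrow> elem \<Rightarrow> int option \<Rightarrow> elem" where
  "tup w p = (\<lambda>i\<in>idx. case i of None \<Rightarrow> p | Some k \<Rightarrow> w k)"

abbreviation Pw :: "(B_sym, int option \<Rightarrow> elem) ualg" where
  "Pw \<equiv> power_ualg idx (B_alg \<T>)"

text \<open>A zero at \<open>None\<close> does not count: with \<open>(1, \<dots>, 1)\<close> on the window and \<open>0\<close> at \<open>None\<close>
  as its first argument, \<open>S\<^sub>1\<close> would not vanish in the quotient.\<close>

definition Zs :: "(int option \<Rightarrow> elem) set" where
  "Zs = {x \<in> idx \<rightarrow>\<^sub>E B_univ \<T>. \<exists>k\<in>win. x (Some k) = Zero}"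

definition Ns :: "(int option \<Rightarrow> elem) set" where
  "Ns = {tup (fv j) E1 |j. j \<in> head_pos} \<union> {tup w p |w p. w \<in> configs \<and> p \<in> P_set}"

definition Sub :: "(int option \<Rightarrow> elem) set" where "Sub = Zs \<union> Ns"

section \<open>Window tuples and reachable configurations\<close>

lemma tup_simps [simp]: "tup w p None = p" "k \<in> win \<Longrightarrow> tup w p (Some k) = w k"
  by (auto simp: tup_def idx_def)

lemma tup_eqI:
  assumes "x \<in> extensional idx" "x None = p" "\<And>k. k \<in> win \<Longrightarrow> x (Some k) = w k"
  shows "x = tup w p"
  by (rule extensionalityI[OF assms(1)]) (use assms in \<open>auto simp: tup_def idx_def\<close>)

text \<open>Since \<open>j\<close> and \<open>j + 1\<close> lie strictly inside the window, the end
  squares see only the argument pairs (1,1) and (2,2), so \<open>C\<close> and \<open>D\<close>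
  persist there; the symbol \<open>M\<close> comes from \<open>mach_op_head\<close>. The three sorts
  together make the operations \<open>OMeeti\<close> vanish.\<close>

lemma configs_props:
  assumes "w \<in> configs"
  shows "w \<in> extensional win \<and> (\<forall>k\<in>win. w k \<in> V_set \<T>) \<and>
    (\<exists>i r s. w (-m) = Pos (SymC i r s)) \<and> (\<exists>i r s. w m = Pos (SymD i r s)) \<and>
    (\<exists>k\<in>win. \<exists>i r. w k = Pos (SymM i r))"
proof -
  have "mstep\<^sup>*\<^sup>* start w" using assms by (simp add: configs_def)
  then show ?thesis
  proof induction
    case base
    have "1 \<le> nstates \<T>" using tm by (simp add: turing_machine_def)
    then show ?case using m by (auto simp: start_def config_vec_def V_set_def win_def extensional_def intro: bexI[of _ 0])
  next
    case (step w w')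
    then obtain F j where F: "F \<in> mach_syms \<T>" and j: "j \<in> head_pos" "j + 1 \<in> head_pos"
      and w': "w' = mv F j w" and nz: "\<And>k. k \<in> win \<Longrightarrow> w' k \<noteq> Zero"
      by (auto simp: mstep_def)
    have w'k: "w' k = mach_op \<T> F (fv j k) (fv (j + 1) k) (w k)" if "k \<in> win" for k
      using that by (simp add: w' mv_def)
    have jm: "-m < j" "j + 1 < m" using j by (auto simp: head_pos_def)
    have ex: "\<exists>a b. w k = Pos a \<and> w' k = Pos b \<and> state_index b \<le> nstates \<T>" if k: "k \<in> win" for k
    proof -
      obtain a where a: "w k = Pos a" "w k \<in> B_univ \<T>"
        using step.IH k by (auto simp: V_set_def B_univ_def)
      then obtain b where b: "w' k = Pos b"
        using nz[OF k] mach_op_cases[of \<T> F "fv j k" "fv (j + 1) k" "w k"] by (auto simp: w'k[OF k])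
      have "w' k \<in> B_univ \<T>" unfolding w'k[OF k] by (rule mach_op_closed[OF tm F a(2)])
      then show ?thesis using a b by (auto simp: B_univ_def V_set_def Vbar_set_def P_set_def U_set_def)
    qed
    have V: "w' k \<in> V_set \<T>" if "k \<in> win" for k using ex[OF that] by (auto simp: V_set_def)
    have ends: "-m \<in> win" "m \<in> win" and jw: "j \<in> win" "j + 1 \<in> win" using jm by (auto simp: win_def)
    have "\<exists>i r s. w' (-m) = Pos (SymC i r s)"
      using ex[OF ends(1)] w'k[OF ends(1)] jm mach_op_sort[of \<T> F E1] by (auto simp: fv_def)
    moreover have "\<exists>i r s. w' m = Pos (SymD i r s)"
      using ex[OF ends(2)] w'k[OF ends(2)] jm mach_op_sort[of \<T> F E2] by (auto simp: fv_def)
    moreover have "(\<exists>i r. w' j = Pos (SymM i r)) \<or> (\<exists>i r. w' (j + 1) = Pos (SymM i r))"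
      using ex[OF jw(1)] ex[OF jw(2)] w'k[OF jw(1)] w'k[OF jw(2)] mach_op_head[of \<T> F]
      by (auto simp: fv_def)
    then have "\<exists>k\<in>win. \<exists>i r. w' k = Pos (SymM i r)" using jw by blast
    moreover have "w' \<in> extensional win" by (simp add: w' mv_def)
    ultimately show ?case using V by blast
  qed
qed

lemma configs_V: "w \<in> configs \<Longrightarrow> k \<in> win \<Longrightarrow> w k \<in> V_set \<T>"
  using configs_props by blast

lemma configs_step: "w \<in> configs \<Longrightarrow> mstep w w' \<Longrightarrow> w' \<in> configs"
  by (simp add: configs_def)

lemma start_configs: "start \<in> configs"
  by (simp add: configs_def)

text \<open>The operation \<open>flip F\<close> at the same \<open>j\<close> undoes the
  step.\<close>

lemma mstep_sym:
  assumes "w \<in> configs" "mstep w w'"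
  shows "mstep w' w"
proof -
  obtain F j where F: "F \<in> mach_syms \<T>" and j: "j \<in> head_pos" "j + 1 \<in> head_pos"
    and w': "w' = mv F j w" and nz: "\<And>k. k \<in> win \<Longrightarrow> w' k \<noteq> Zero"
    using assms(2) by (auto simp: mstep_def)
  have wk: "w k \<in> B_univ \<T>" "w k \<noteq> Zero" if "k \<in> win" for k
    using configs_V[OF assms(1) that] by (auto simp: B_univ_def V_set_def)
  have "w = mv (flip F) j w'"
  proof (rule extensionalityI[of _ win])
    show "w \<in> extensional win" using configs_props assms(1) by blast
    fix k assume k: "k \<in> win"
    then show "w k = mv (flip F) j w' k"
      using mach_op_flip[of \<T> F "fv j k" "fv (j + 1) k" "w k"] nz[OF k] wk[OF k] by (simp add: w' mv_def)
  qed (simp add: mv_def)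
  then show ?thesis using flip_syms[OF F] j wk(2) unfolding mstep_def by blast
qed

lemma configs_connected:
  assumes "w \<in> configs"
  shows "mstep\<^sup>*\<^sup>* w start"
proof -
  have "mstep\<^sup>*\<^sup>* start w" using assms by (simp add: configs_def)
  then show ?thesis
  proof induction
    case (step w w')
    then have "w \<in> configs" by (simp add: configs_def)
    then show ?case using mstep_sym step by (meson converse_rtranclp_into_rtranclp)
  qed simp
qed

section \<open>Elements without zeros in the window\<close>

lemma V_set_simps: "x \<in> V_set \<T> \<Longrightarrow> x \<noteq> Zero \<and> x \<notin> P_set \<and> x \<notin> U_set \<and> x \<in> B_univ \<T> \<and> (\<exists>a. x = Pos a)"
  by (auto simp: V_set_def U_set_def B_univ_def)

lemma fv_U: "fv j k \<in> U_set"
  by (auto simp: fv_def U_set_def)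

lemma U_set_simps: "x \<in> U_set \<Longrightarrow> x \<noteq> Zero \<and> x \<notin> P_set \<and> x \<in> B_univ \<T>"
  by (auto simp: U_set_def B_univ_def)

lemma Ns_cases:
  assumes "x \<in> Ns"
  obtains j where "j \<in> head_pos" "x = tup (fv j) E1"
  | w p where "w \<in> configs" "p \<in> P_set" "x = tup w p"
  using assms by (auto simp: Ns_def)

lemma Ns_win:
  assumes "x \<in> Ns" "k \<in> win"
  shows "x (Some k) \<in> U_set \<union> V_set \<T> \<and> x (Some k) \<noteq> Zero \<and> x (Some k) \<notin> P_set"
  using assms(1)
  by (cases rule: Ns_cases) (use assms(2) fv_U configs_V U_set_simps V_set_simps in auto)

lemma Ns_univ: "Ns \<subseteq> idx \<rightarrow>\<^sub>E B_univ \<T>"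
proof
  fix x assume x: "x \<in> Ns"
  have "x \<in> extensional idx" "x None \<in> B_univ \<T>"
    using x by (auto simp: Ns_def tup_def idx_def B_univ_def U_set_def)
  moreover have "x (Some k) \<in> B_univ \<T>" if "k \<in> win" for k
    using Ns_win[OF x that] by (auto simp: B_univ_def)
  ultimately show "x \<in> idx \<rightarrow>\<^sub>E B_univ \<T>" by (auto simp: idx_def PiE_def)
qed

lemma Ns_Zs: "x \<in> Ns \<Longrightarrow> x \<notin> Zs"
  using Ns_win by (auto simp: Zs_def)

lemma Sub_univ: "Sub \<subseteq> idx \<rightarrow>\<^sub>E B_univ \<T>"
  using Ns_univ by (auto simp: Sub_def Zs_def)

lemma Sub_NsI: "x \<in> Sub \<Longrightarrow> (\<And>k. k \<in> win \<Longrightarrow> x (Some k) \<noteq> Zero) \<Longrightarrow> x \<in> Ns"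
  by (auto simp: Sub_def Zs_def)

lemma head_win: "j \<in> head_pos \<Longrightarrow> j \<in> win"
  by (auto simp: head_pos_def win_def)

lemma zero_win: "0 \<in> win"
  using m by (auto simp: win_def)

lemma fv_inj:
  assumes "\<And>k. k \<in> win \<Longrightarrow> fv j k = fv l k" "j \<in> head_pos"
  shows "j = l"
  using assms(1)[OF head_win[OF assms(2)]] by (auto simp: fv_def split: if_splits)

text \<open>The window determines an element of \<open>Ns\<close> up to its entry at
  \<open>None\<close>. Entries of \<open>fv\<close> tuples lie in \<open>U_set\<close> and those of
  configurations in \<open>V\<close>, so square 0 already separates the two kinds.\<close>

lemma Ns_same:
  assumes x: "x \<in> Ns" and y: "y \<in> Ns" and eq: "\<forall>k\<in>win. x (Some k) = y (Some k)"
  obtains j where "j \<in> head_pos" "x = tup (fv j) E1" "y = tup (fv j) E1"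
  | w p q where "w \<in> configs" "p \<in> P_set" "q \<in> P_set" "x = tup w p" "y = tup w q"
  using x
proof (cases rule: Ns_cases)
  case (1 j)
  note xj = this
  show ?thesis using y
  proof (cases rule: Ns_cases)
    case (1 l)
    then have "j = l" using xj eq by (intro fv_inj) auto
    then show ?thesis using that(1) 1 xj by blast
  next
    case (2 w p)
    then have "fv j 0 \<in> V_set \<T>" using bspec[OF eq zero_win] xj configs_V zero_win by simp
    then show ?thesis using fv_U V_set_simps by blast
  qed
next
  case (2 w p)
  note xw = this
  show ?thesis using y
  proof (cases rule: Ns_cases)
    case (1 l)
    then have "fv l 0 \<in> V_set \<T>" using bspec[OF eq zero_win] xw configs_V[of w 0] zero_win by simp
    then show ?thesis using fv_U V_set_simps by blast
  next
    case (2 w' q)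
    have "w = w'"
      by (rule extensionalityI[of _ win]) (use configs_props 2 xw eq in auto)
    then show ?thesis using that(2) 2 xw by blast
  qed
qed

text \<open>At square \<open>j\<close> the first tuple has \<open>H\<close>, so the second must have
  \<open>1\<close> there, giving \<open>j < l\<close>. If \<open>l\<close> exceeded
  \<open>j + 1\<close>, square \<open>j + 1\<close> would show the pair (2,1), which is not in
  \<open>prec\<close>.\<close>

lemma fv_prec:
  assumes "\<And>k. k \<in> win \<Longrightarrow> prec (fv j k) (fv l k)" "j \<in> head_pos" "l \<in> head_pos"
  shows "l = j + 1"
proof -
  have "prec (fv j j) (fv l j)" "prec (fv j l) (fv l l)" using assms head_win by blast+
  then have "j < l" by (auto simp: prec_def fv_def split: if_splits)
  moreover have "\<not> j + 1 < l"
  proof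
    assume l: "j + 1 < l"
    then have "j + 1 \<in> win" using assms(2,3) by (auto simp: head_pos_def win_def)
    then have "prec (fv j (j + 1)) (fv l (j + 1))" using assms(1) by blast
    then show False using l by (simp add: prec_def fv_def)
  qed
  ultimately show ?thesis by simp
qed

lemma prec_fv: "prec (fv j k) (fv (j + 1) k)"
  by (auto simp: prec_def fv_def)

lemma Ns_prec:
  assumes x: "x \<in> Ns" and y: "y \<in> Ns" and pr: "\<And>k. k \<in> win \<Longrightarrow> prec (x (Some k)) (y (Some k))"
  obtains j where "j \<in> head_pos" "j + 1 \<in> head_pos" "x = tup (fv j) E1" "y = tup (fv (j + 1)) E1"
proof -
  have U: "x (Some 0) \<in> U_set" "y (Some 0) \<in> U_set"
    using pr[OF zero_win] by (auto simp: prec_def U_set_def)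
  obtain j where j: "j \<in> head_pos" "x = tup (fv j) E1"
    using x by (cases rule: Ns_cases) (use U(1) zero_win configs_V V_set_simps in auto)
  obtain l where l: "l \<in> head_pos" "y = tup (fv l) E1"
    using y by (cases rule: Ns_cases) (use U(2) zero_win configs_V V_set_simps in auto)
  have "l = j + 1" by (rule fv_prec) (use j l pr in auto)
  then show ?thesis using that j l by blast
qed

section \<open>Operations whose result has no zero in the window\<close>

lemma Pw_oper: "oper Pw f xs = (\<lambda>i\<in>idx. B_oper \<T> f (map (\<lambda>g. g i) xs))"
  by (simp add: power_ualg_def B_alg_def)

lemma None_idx: "None \<in> idx" and Some_idx: "Some k \<in> idx \<longleftrightarrow> k \<in> win"
  by (auto simp: idx_def)

lemma Pw_oper_ext: "oper Pw f xs \<in> extensional idx"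
  by (simp add: Pw_oper)

lemma prec_tup:
  assumes "i \<in> idx"
  shows "prec (tup (fv j) E1 i) (tup (fv (j + 1)) E1 i)"
proof (cases i)
  case None
  then show ?thesis by (simp add: prec_def)
next
  case (Some k)
  then show ?thesis using assms prec_fv by (simp add: Some_idx)
qed

lemma fv_Pos [simp]: "fv j k \<noteq> Pos v"
  by (simp add: fv_def)

lemma NsI: "j \<in> head_pos \<Longrightarrow> tup (fv j) E1 \<in> Ns" "w \<in> configs \<Longrightarrow> p \<in> P_set \<Longrightarrow> tup w p \<in> Ns"
  by (auto simp: Ns_def)

text \<open>Nonzero values force \<open>prec\<close> throughout the window, so the first two
  arguments are consecutive \<open>fv\<close> tuples. The third has no entry in \<open>U_set\<close>
  and must be a configuration; the operation then performs an \<open>mstep\<close>.\<close>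

lemma res_mach:
  assumes F: "F \<in> mach_syms \<T>" and S: "x \<in> Sub" "y \<in> Sub" "u \<in> Sub"
    and nz: "\<And>k. k \<in> win \<Longrightarrow> mach_op \<T> F (x (Some k)) (y (Some k)) (u (Some k)) \<noteq> Zero"
  obtains j w p where "j \<in> head_pos" "j + 1 \<in> head_pos" "w \<in> configs" "p \<in> P_set"
    "x = tup (fv j) E1" "y = tup (fv (j + 1)) E1" "u = tup w p" "mv F j w \<in> configs"
    "oper Pw (OMach F) [x, y, u] = tup (mv F j w) p"
proof -
  have pr: "prec (x (Some k)) (y (Some k))" and uk: "u (Some k) \<noteq> Zero" "u (Some k) \<notin> U_set" if "k \<in> win" for k
    using mach_op_cases[OF nz[OF that]] by (auto simp: P_set_def U_set_def)
  have xy: "x \<in> Ns" "y \<in> Ns"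
    by (rule Sub_NsI; use S pr in \<open>force simp: prec_def\<close>)+
  have u: "u \<in> Ns" by (rule Sub_NsI[OF S(3) uk(1)])
  obtain j where j: "j \<in> head_pos" "j + 1 \<in> head_pos" "x = tup (fv j) E1" "y = tup (fv (j + 1)) E1"
    using Ns_prec[OF xy pr] by metis
  obtain w p where w: "w \<in> configs" "p \<in> P_set" "u = tup w p"
    using u by (cases rule: Ns_cases) (use uk(2)[OF zero_win] zero_win fv_U in auto)
  have mk: "mv F j w k \<noteq> Zero" if "k \<in> win" for k
    using nz[OF that] that by (simp add: j w mv_def)
  then have "mstep w (mv F j w)" using F j unfolding mstep_def by blast
  then have c: "mv F j w \<in> configs" using configs_step w by blast
  have "oper Pw (OMach F) [x, y, u] = tup (mv F j w) p"
    by (rule tup_eqI[OF Pw_oper_ext]) (use w in \<open>auto simp: Pw_oper None_idx Some_idx j mach_op_P mv_def\<close>)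
  then show ?thesis using that j w c by blast
qed

text \<open>Common ending for the operations that return the window of an argument unchanged; only
  the entry at \<open>None\<close> remains to be checked.\<close>

lemma res_same:
  assumes xy: "x \<in> Ns" "y \<in> Ns" and eq: "\<forall>k\<in>win. x (Some k) = y (Some k)"
    and r: "r \<in> extensional idx" "\<And>k. k \<in> win \<Longrightarrow> r (Some k) = x (Some k)"
    and E1: "x None = E1 \<Longrightarrow> y None = E1 \<Longrightarrow> r None = E1"
    and P: "x None \<in> P_set \<Longrightarrow> y None \<in> P_set \<Longrightarrow> r None \<in> P_set"
  shows "r \<in> Ns"
  using xy eq
proof (cases rule: Ns_same)
  case (1 j)
  have "r = tup (fv j) E1" by (rule tup_eqI[OF r(1)]) (use 1 E1 r(2) in auto)
  then show ?thesis using 1 NsI by blast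
next
  case (2 w p q)
  have "r = tup w (r None)" by (rule tup_eqI[OF r(1)]) (use 2 r(2) in auto)
  moreover have "r None \<in> P_set" using 2 P by simp
  ultimately show ?thesis using 2 NsI by metis
qed

lemma same_None:
  assumes "x \<in> Ns" "y \<in> Ns" "\<forall>k\<in>win. x (Some k) = y (Some k)"
  shows "(x None = E1 \<and> y None = E1) \<or> (x None \<in> P_set \<and> y None \<in> P_set)"
  using assms by (cases rule: Ns_same) auto

text \<open>The central case analysis. A result outside \<open>Zs\<close> comes only from arguments
  in \<open>Ns\<close>, so \<open>Zs\<close> can be collapsed to an absorbing element, and it leaves
  only live arguments at \<open>None\<close>, so the order is respected.\<close>

lemma op_result:
  assumes f: "f \<in> B_syms \<T>" and xs: "xs \<in> tuples (B_arity f) Sub" and r: "oper Pw f xs \<notin> Zs"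
  shows "set xs \<subseteq> Ns \<and> live_args f (map (\<lambda>g. g None) xs) \<and> oper Pw f xs \<in> Ns"
proof -
  have univ: "oper Pw f xs \<in> idx \<rightarrow>\<^sub>E B_univ \<T>"
  proof -
    have "B_oper \<T> f (map (\<lambda>g. g i) xs) \<in> B_univ \<T>" if "i \<in> idx" for i
      by (rule B_oper_closed[OF tm f]) (use xs Sub_univ that in \<open>fastforce simp: tuples_def\<close>)
    then show ?thesis by (auto simp: Pw_oper)
  qed
  have nz: "B_oper \<T> f (map (\<lambda>g. g (Some k)) xs) \<noteq> Zero" if k: "k \<in> win" for k
  proof
    assume "B_oper \<T> f (map (\<lambda>g. g (Some k)) xs) = Zero"
    then have "oper Pw f xs (Some k) = Zero" using k by (simp add: Pw_oper Some_idx)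
    then show False using r univ k by (auto simp: Zs_def)
  qed
  have len: "length xs = B_arity f" and S: "\<And>x. x \<in> set xs \<Longrightarrow> x \<in> Sub"
    using xs by (auto simp: tuples_def)
  have rN: "oper Pw f xs None = B_oper \<T> f (map (\<lambda>g. g None) xs)"
    and rS: "\<And>k. k \<in> win \<Longrightarrow> oper Pw f xs (Some k) = B_oper \<T> f (map (\<lambda>g. g (Some k)) xs)"
    by (simp_all add: Pw_oper None_idx Some_idx)
  note ext = Pw_oper_ext[of f xs]
  \<comment> \<open>The absence of barred entries disables the bar clauses of \<open>B_J\<close> and
    \<open>B_S2\<close>.\<close>
  have neg: "x (Some k) \<noteq> Neg v" if "x \<in> Ns" "k \<in> win" for x k v
    using Ns_win[OF that] by (auto simp: U_set_def V_set_def)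
  show ?thesis
  proof (cases f)
    case OZero
    then show ?thesis using nz[OF zero_win] by simp
  next
    case OMeet
    then obtain x y where xs2: "xs = [x, y]" using len by (auto simp: numeral_2_eq_2 length_Suc_conv)
    have "x (Some k) \<noteq> Zero \<and> y (Some k) \<noteq> Zero" if "k \<in> win" for k
      using nz[OF that] by (auto simp: OMeet xs2 B_meet_eq split: if_splits)
    then have N: "x \<in> Ns" "y \<in> Ns" using S Sub_NsI by (auto simp: xs2)
    have eq: "\<forall>k\<in>win. x (Some k) = y (Some k)"
    proof
      fix k assume k: "k \<in> win"
      show "x (Some k) = y (Some k)"
        using nz[OF k] Ns_win[OF N(1) k] by (auto simp: OMeet xs2 B_meet_eq split: if_splits)
    qed
    have "oper Pw f xs \<in> Ns"
      by (rule res_same[OF N eq ext]) (use eq rN rS in \<open>auto simp: OMeet xs2 B_meet_eq\<close>)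
    then show ?thesis using N same_None[OF N eq] by (auto simp: OMeet xs2)
  next
    case (OMeeti i)
    then obtain x y where xs2: "xs = [x, y]" using len by (auto simp: numeral_2_eq_2 length_Suc_conv)
    have h: "x (Some k) \<in> (P_set \<union> V100_set) - {sep i} \<and> x (Some k) \<noteq> Zero" if "k \<in> win" for k
      using nz[OF that] by (auto simp: OMeeti xs2 B_meeti_def split: if_splits)
    then have N: "x \<in> Ns" using S Sub_NsI by (auto simp: xs2)
    then have h: "x (Some k) \<in> V100_set - {sep i}" if "k \<in> win" for k
      using h[OF that] Ns_win[OF N that] by auto
    obtain w p where w: "w \<in> configs" "x = tup w p"
      using N by (cases rule: Ns_cases) (use h[OF zero_win] zero_win in \<open>auto simp: V100_set_def U_set_def\<close>)
    \<comment> \<open>Each operation \<open>OMeeti i\<close> excludes one of the sorts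
      \<open>C\<close>, \<open>M\<close>, \<open>D\<close>, but all three occur in a
      configuration.\<close>
    have "\<exists>k\<in>win. \<exists>i r s. w k = Pos (SymC i r s)" "\<exists>k\<in>win. \<exists>i r s. w k = Pos (SymD i r s)"
      by (rule bexI[of _ "-m"], use configs_props[OF w(1)] m in \<open>auto simp: win_def\<close>)
        (rule bexI[of _ m], use configs_props[OF w(1)] m in \<open>auto simp: win_def\<close>)
    moreover have "\<exists>k\<in>win. \<exists>i r. w k = Pos (SymM i r)" using configs_props[OF w(1)] by blast
    ultimately show ?thesis using h w by (cases i) (fastforce simp: V100_set_def)+
  next
    case OT0
    then obtain x where xs2: "xs = [x]" using len by (auto simp: length_Suc_conv)
    have "x (Some k) \<noteq> Zero" if "k \<in> win" for k
      using nz[OF that] by (auto simp: OT0 xs2 B_T0_def V0_set_def split: if_splits)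
    then have N: "x \<in> Ns" using S Sub_NsI by (auto simp: xs2)
    have V0: "x (Some k) \<in> V0_set \<and> B_T0 (x (Some k)) = x (Some k)" if "k \<in> win" for k
      using nz[OF that] Ns_win[OF N that] by (auto simp: OT0 xs2 B_T0_def split: if_splits)
    have P: "x None \<in> P_set"
      using N by (cases rule: Ns_cases) (use V0[OF zero_win] zero_win in \<open>auto simp: V0_set_def U_set_def\<close>)
    have "oper Pw f xs \<in> Ns"
      by (rule res_same[OF N N _ ext]) (use P P_T0 V0 rN rS in \<open>auto simp: OT0 xs2\<close>)
    then show ?thesis using N P by (auto simp: OT0 xs2)
  next
    case OT1
    then obtain x y where xs2: "xs = [x, y]" using len by (auto simp: numeral_2_eq_2 length_Suc_conv)
    have "x (Some k) \<noteq> Zero \<and> y (Some k) \<noteq> Zero" if "k \<in> win" for k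
      using T1_cases[of "x (Some k)" "y (Some k)"] nz[OF that] by (auto simp: OT1 xs2 V100_set_def)
    then have N: "x \<in> Ns" "y \<in> Ns" using S Sub_NsI by (auto simp: xs2)
    have h: "x (Some k) = y (Some k) \<and> x (Some k) \<in> V100_set \<and> B_T1 (x (Some k)) (y (Some k)) = x (Some k)"
      if "k \<in> win" for k
      using T1_cases[of "x (Some k)" "y (Some k)"] nz[OF that] Ns_win[OF N(1) that]
      by (auto simp: OT1 xs2)
    then have eq: "\<forall>k\<in>win. x (Some k) = y (Some k)" by blast
    have "x None \<in> P_set"
      using N(1) by (cases rule: Ns_cases) (use h[OF zero_win] zero_win in \<open>auto simp: V100_set_def U_set_def\<close>)
    then have P: "x None \<in> P_set" "y None \<in> P_set" using same_None[OF N eq] by auto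
    have "oper Pw f xs (Some k) = x (Some k)" if "k \<in> win" for k
    proof -
      have "oper Pw f xs (Some k) = B_T1 (x (Some k)) (y (Some k))"
        using rS[OF that] by (simp add: OT1 xs2)
      then show ?thesis using h[OF that] by metis
    qed
    then have "oper Pw f xs \<in> Ns"
      by (intro res_same[OF N eq ext]) (use P P_T1 rN in \<open>auto simp: OT1 xs2\<close>)
    then show ?thesis using N P by (auto simp: OT1 xs2)
  next
    case OJ
    then obtain x y z where xs2: "xs = [x, y, z]" using len by (auto simp: numeral_3_eq_3 length_Suc_conv)
    have "x (Some k) \<noteq> Zero \<and> y (Some k) \<noteq> Zero" if "k \<in> win" for k
      using nz[OF that] by (auto simp: OJ xs2 B_J_def B_meet_eq V_set_def Vbar_set_def split: if_splits)
    then have N: "x \<in> Ns" "y \<in> Ns" using S Sub_NsI by (auto simp: xs2)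
    have h: "x (Some k) = y (Some k) \<and> z (Some k) = x (Some k)" if "k \<in> win" for k
    proof -
      have nb: "\<not> (x (Some k) = bar (y (Some k)) \<and> x (Some k) \<in> V_set \<T> \<union> Vbar_set \<T>)"
        using neg[OF N(1) that] neg[OF N(2) that]
        by (cases "y (Some k)") (auto simp: V_set_def Vbar_set_def)
      show ?thesis using nb nz[OF that] Ns_win[OF N(1) that]
        by (auto simp: OJ xs2 B_J_def B_meet_eq split: if_splits)
    qed
    then have "z (Some k) \<noteq> Zero" if "k \<in> win" for k using Ns_win[OF N(1) that] that by auto
    then have Nz: "z \<in> Ns" using S Sub_NsI by (auto simp: xs2)
    have eq: "\<forall>k\<in>win. x (Some k) = y (Some k)" "\<forall>k\<in>win. x (Some k) = z (Some k)" using h by auto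
    have "oper Pw f xs \<in> Ns"
      by (rule res_same[OF N(1) Nz eq(2) ext])
        (use same_None[OF N eq(1)] h rN rS in \<open>auto simp: OJ xs2 P_J P_meet B_J_def B_meet_eq\<close>)
    then show ?thesis using N Nz same_None[OF N eq(1)] same_None[OF N(1) Nz eq(2)] by (auto simp: OJ xs2)
  next
    case OS1
    then obtain u x y z where xs2: "xs = [u, x, y, z]" using len by (auto simp: eval_nat_numeral length_Suc_conv)
    have "x (Some k) \<noteq> Zero" if "k \<in> win" for k
      using nz[OF that] by (auto simp: OS1 xs2 B_S1_def U_set_def V_set_def Vbar_set_def split: if_splits)
    then have N: "x \<in> Ns" using S Sub_NsI by (auto simp: xs2)
    have h: "u (Some k) \<in> {E1, E2}" if "k \<in> win" for k
      using nz[OF that] Ns_win[OF N that] by (auto simp: OS1 xs2 B_S1_def split: if_splits)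
    \<comment> \<open>The first argument would consist of \<open>1\<close> and \<open>2\<close> on
      the window. No element of \<open>Ns\<close> does: \<open>fv j\<close> has an \<open>H\<close>
      at square \<open>j\<close>, and configurations have entries in \<open>V\<close>.\<close>
    have "u \<in> Ns" by (rule Sub_NsI) (use S h in \<open>force simp: xs2\<close>)+
    then show ?thesis
    proof (cases rule: Ns_cases)
      case (1 j)
      then show ?thesis using h[OF head_win[of j]] head_win[of j] by (simp add: fv_def)
    next
      case (2 w p)
      then show ?thesis using h[OF zero_win] configs_V[OF _ zero_win, of w] zero_win by (auto simp: V_set_def)
    qed
  next
    case OS2
    then obtain u v x y z where xs2: "xs = [u, v, x, y, z]" using len by (auto simp: eval_nat_numeral length_Suc_conv)
    have "x (Some k) \<noteq> Zero" if "k \<in> win" for k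
      using nz[OF that] by (auto simp: OS2 xs2 B_S2_def U_set_def V_set_def Vbar_set_def split: if_splits)
    then have N: "x \<in> Ns" using S Sub_NsI by (auto simp: xs2)
    have h: "u (Some k) = bar (v (Some k)) \<and> u (Some k) \<in> V_set \<T> \<union> Vbar_set \<T>" if "k \<in> win" for k
      using nz[OF that] Ns_win[OF N that] by (auto simp: OS2 xs2 B_S2_def split: if_splits)
    then have "u (Some k) \<noteq> Zero \<and> v (Some k) \<noteq> Zero" if "k \<in> win" for k
      using h[OF that] by (auto simp: V_set_def Vbar_set_def)
    then have "u \<in> Ns" "v \<in> Ns" using S Sub_NsI by (auto simp: xs2)
    then have "u (Some 0) \<noteq> bar (v (Some 0)) \<or> u (Some 0) \<notin> V_set \<T> \<union> Vbar_set \<T>"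
      using neg[of u 0] neg[of v 0] zero_win by (cases "v (Some 0)") (auto simp: V_set_def Vbar_set_def)
    then show ?thesis using h[OF zero_win] by blast
  next
    case (OMach F)
    then obtain x y u where xs2: "xs = [x, y, u]" using len by (auto simp: numeral_3_eq_3 length_Suc_conv)
    have F: "F \<in> mach_syms \<T>" using f by (auto simp: OMach B_syms_def)
    have S': "x \<in> Sub" "y \<in> Sub" "u \<in> Sub" using S by (auto simp: xs2)
    obtain j w p where "j \<in> head_pos" "j + 1 \<in> head_pos" "w \<in> configs" "p \<in> P_set"
      "x = tup (fv j) E1" "y = tup (fv (j + 1)) E1" "u = tup w p" "mv F j w \<in> configs"
      "oper Pw (OMach F) [x, y, u] = tup (mv F j w) p"
      using res_mach[OF F S'] nz by (auto simp: OMach xs2)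
    then show ?thesis by (auto simp: OMach xs2 NsI)
  next
    case (OU1 F)
    then obtain x y z u where xs2: "xs = [x, y, z, u]" using len by (auto simp: eval_nat_numeral length_Suc_conv)
    have F: "F \<in> mach_syms \<T>" using f by (auto simp: OU1 B_syms_def)
    have S': "x \<in> Sub" "y \<in> Sub" "z \<in> Sub" "u \<in> Sub" using S by (auto simp: xs2)
    have h: "prec (x (Some k)) (z (Some k)) \<and> mach_op \<T> F (x (Some k)) (y (Some k)) (u (Some k)) \<noteq> Zero"
      if "k \<in> win" for k
      using nz[OF that] by (auto simp: OU1 xs2 B_U1_def V_set_def Vbar_set_def split: if_splits)
    obtain j w p where j: "j \<in> head_pos" "j + 1 \<in> head_pos" "w \<in> configs" "p \<in> P_set"
      "x = tup (fv j) E1" "y = tup (fv (j + 1)) E1" "u = tup w p" "mv F j w \<in> configs"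
      "oper Pw (OMach F) [x, y, u] = tup (mv F j w) p"
      using res_mach[OF F S'(1,2,4)] h by metis
    have xN: "x \<in> Ns" using j NsI by simp
    have zN: "z \<in> Ns" by (rule Sub_NsI[OF S'(3)]) (use h in \<open>force simp: prec_def\<close>)
    obtain l where l: "l \<in> head_pos" "x = tup (fv l) E1" "z = tup (fv (l + 1)) E1"
      using Ns_prec[OF xN zN] h by metis
    \<comment> \<open>Both \<open>y\<close> and \<open>z\<close> succeed the same tuple
      \<open>x\<close>, so they coincide and only the clause without bar can apply.\<close>
    have "fv j k = fv l k" if "k \<in> win" for k
      using that l(2) j(5) tup_simps(2)[of k "fv j" E1] tup_simps(2)[of k "fv l" E1] by simp
    then have "j = l" using fv_inj j(1) by blast
    then have yz: "z = y" using j l by simp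
    have "oper Pw f xs = oper Pw (OMach F) [x, y, u]"
      unfolding Pw_oper
    proof (rule restrict_ext)
      fix i assume "i \<in> idx"
      then have "prec (x i) (y i)" using j prec_tup by simp
      then show "B_oper \<T> f (map (\<lambda>g. g i) xs) = B_oper \<T> (OMach F) (map (\<lambda>g. g i) [x, y, u])"
        by (simp add: OU1 xs2 yz B_U1_def)
    qed
    then show ?thesis using j NsI yz by (auto simp: OU1 xs2)
  next
    case (OU2 F)
    then obtain x y z u where xs2: "xs = [x, y, z, u]" using len by (auto simp: eval_nat_numeral length_Suc_conv)
    have F: "F \<in> mach_syms \<T>" using f by (auto simp: OU2 B_syms_def)
    have S': "x \<in> Sub" "y \<in> Sub" "z \<in> Sub" "u \<in> Sub" using S by (auto simp: xs2)
    have h: "prec (x (Some k)) (z (Some k)) \<and> mach_op \<T> F (y (Some k)) (z (Some k)) (u (Some k)) \<noteq> Zero"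
      if "k \<in> win" for k
      using nz[OF that] by (auto simp: OU2 xs2 B_U2_def V_set_def Vbar_set_def split: if_splits)
    obtain j w p where j: "j \<in> head_pos" "j + 1 \<in> head_pos" "w \<in> configs" "p \<in> P_set"
      "y = tup (fv j) E1" "z = tup (fv (j + 1)) E1" "u = tup w p" "mv F j w \<in> configs"
      "oper Pw (OMach F) [y, z, u] = tup (mv F j w) p"
      using res_mach[OF F S'(2,3,4)] h by metis
    have zN: "z \<in> Ns" using j NsI by simp
    have xN: "x \<in> Ns" by (rule Sub_NsI[OF S'(1)]) (use h in \<open>force simp: prec_def\<close>)
    obtain l where l: "l \<in> head_pos" "x = tup (fv l) E1" "z = tup (fv (l + 1)) E1"
      using Ns_prec[OF xN zN] h by metis
    \<comment> \<open>Dually, \<open>x\<close> and \<open>y\<close> precede the same tuple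
      \<open>z\<close> and therefore coincide.\<close>
    have "fv (j + 1) k = fv (l + 1) k" if "k \<in> win" for k
      using that l(3) j(6) tup_simps(2)[of k "fv (j + 1)" E1] tup_simps(2)[of k "fv (l + 1)" E1] by simp
    then have "j + 1 = l + 1" using fv_inj j(2) by blast
    then have yz: "x = y" using j l by simp
    have "oper Pw f xs = oper Pw (OMach F) [y, z, u]"
      unfolding Pw_oper
    proof (rule restrict_ext)
      fix i assume "i \<in> idx"
      then have "prec (y i) (z i)" using j prec_tup by simp
      then show "B_oper \<T> f (map (\<lambda>g. g i) xs) = B_oper \<T> (OMach F) (map (\<lambda>g. g i) [y, z, u])"
        by (simp add: OU2 xs2 yz B_U2_def)
    qed
    then show ?thesis using j NsI yz by (auto simp: OU2 xs2)
  qed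
qed

section \<open>The quotient algebra\<close>

lemma config_vec_step:
  assumes "tm_step \<T> c c'" "\<bar>fst (snd c)\<bar> < m" "\<bar>fst (snd c')\<bar> < m"
  shows "mstep (config_vec c) (config_vec c')"
  using assms(1)
proof cases
  case (1 i \<tau> q s d n)
  define q' where "q' = (case d of Lft \<Rightarrow> q - 1 | Rgt \<Rightarrow> q + 1)"
  \<comment> \<open>The left one of the two squares between which the head moves.\<close>
  define j where "j = (case d of Lft \<Rightarrow> q - 1 | Rgt \<Rightarrow> q)"
  \<comment> \<open>The last parameter is the symbol scanned after the move; writing at
    \<open>q\<close> does not affect it, since \<open>q'\<close> differs from
    \<open>q\<close>.\<close>
  define G where "G = MoveOp d i (\<tau> q) (\<tau> q')"
  have G: "Fwd G \<in> mach_syms \<T>"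
    unfolding mach_syms_def move_syms_def G_def using 1(3) by blast
  have j: "j \<in> head_pos" "j + 1 \<in> head_pos"
    using assms(2,3) unfolding 1(1,2) by (auto simp: j_def head_pos_def split: dir.splits)
  have ins: "instr \<T> i (\<tau> q) = (s, d, n)" using 1(3) by (simp add: is_instr_def)
  have "config_vec c' k = mv (Fwd G) j (config_vec c) k" if "k \<in> win" for k
  proof -
    consider "k < j" | "k = j" | "k = j + 1" | "k > j + 1" by linarith
    then show ?thesis using that
      by cases (cases d; auto simp: 1(1,2) config_vec_def mv_def move_op_def Vbar_set_def G_def
          ins j_def q'_def fv_def L_pos_def R_pos_def)+
  qed
  moreover have "config_vec c' \<in> extensional win" "mv (Fwd G) j (config_vec c) \<in> extensional win"
    by (auto simp: config_vec_def mv_def split: prod.splits)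
  ultimately have "config_vec c' = mv (Fwd G) j (config_vec c)"
    by (intro extensionalityI)
  moreover have "config_vec c' k \<noteq> Zero" if "k \<in> win" for k
    using that by (auto simp: 1(2) config_vec_def)
  ultimately show ?thesis using G j unfolding mstep_def by metis
qed

lemma config_vec_run:
  assumes "(\<lambda>c c'. tm_step \<T> c c' \<and> \<bar>fst (snd c)\<bar> < m \<and> \<bar>fst (snd c')\<bar> < m)\<^sup>*\<^sup>* c c'"
  shows "mstep\<^sup>*\<^sup>* (config_vec c) (config_vec c')"
  using assms by induction (auto intro: rtranclp.rtrancl_into_rtrancl config_vec_step)

section \<open>The quotient in the generated variety\<close>

lemma finite_Ns: "finite Ns"
proof (rule finite_subset[OF Ns_univ])
  show "finite (idx \<rightarrow>\<^sub>E B_univ \<T>)"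
    by (intro finite_PiE) (auto simp: idx_def win_def finite_B_univ)
qed

definition code :: "(int option \<Rightarrow> elem) \<Rightarrow> nat" where
  "code = (SOME g. inj_on g Ns)"

lemma inj_code: "inj_on code Ns"
  unfolding code_def using finite_imp_inj_to_nat_seg[OF finite_Ns] by (metis someI)

text \<open>\<open>Q\<close> is the quotient that collapses \<open>Zs\<close>, transported to the natural numbers.\<close>

definition encode :: "(int option \<Rightarrow> elem) \<Rightarrow> nat" where
  "encode x = (if x \<in> Zs then 0 else Suc (code x))"

text \<open>At \<open>0\<close> this is an unspecified element of \<open>Zs\<close>; on codes of
  elements of \<open>Ns\<close> it inverts \<open>encode\<close>.\<close>

definition decode :: "nat \<Rightarrow> int option \<Rightarrow> elem" where
  "decode = inv_into Sub encode"

definition Q :: "(B_sym, nat) ualg" where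
  "Q = \<lparr>univ = encode ` Sub, syms = B_syms \<T>, arity = B_arity,
     oper = (\<lambda>f ds. encode (oper Pw f (map decode ds)))\<rparr>"

lemma Q_simps [simp]: "univ Q = encode ` Sub" "syms Q = B_syms \<T>" "arity Q = B_arity"
  by (simp_all add: Q_def)

lemma decode_Sub: "d \<in> encode ` Sub \<Longrightarrow> decode d \<in> Sub \<and> encode (decode d) = d"
  unfolding decode_def by (simp add: inv_into_into f_inv_into_f)

lemma encode_eq: "x \<in> Sub \<Longrightarrow> y \<in> Sub \<Longrightarrow> encode x = encode y \<longleftrightarrow> (x \<in> Zs \<and> y \<in> Zs) \<or> (x \<in> Ns \<and> y = x)"
  using inj_code Ns_Zs by (auto simp: encode_def Sub_def inj_on_def)

lemma decode_encode: "x \<in> Sub \<Longrightarrow> (x \<in> Zs \<and> decode (encode x) \<in> Zs) \<or> (x \<in> Ns \<and> decode (encode x) = x)"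
  using decode_Sub[of "encode x"] encode_eq[of x "decode (encode x)"] by auto

lemma decode_Ns: "x \<in> Ns \<Longrightarrow> decode (encode x) = x"
  using decode_encode[of x] Ns_Zs by (auto simp: Sub_def)

lemma op_Sub: "f \<in> B_syms \<T> \<Longrightarrow> xs \<in> tuples (B_arity f) Sub \<Longrightarrow> oper Pw f xs \<in> Sub"
  using op_result by (auto simp: Sub_def)

lemma op_Zs: "f \<in> B_syms \<T> \<Longrightarrow> xs \<in> tuples (B_arity f) Sub \<Longrightarrow> x \<in> set xs \<Longrightarrow> x \<in> Zs \<Longrightarrow> oper Pw f xs \<in> Zs"
  using op_result Ns_Zs by blast

text \<open>The choice made by \<open>decode\<close> is harmless: elements of \<open>Ns\<close> are
  recovered exactly, and an argument in \<open>Zs\<close> puts the result in \<open>Zs\<close>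
  whichever representative is taken.\<close>

lemma Q_oper:
  assumes f: "f \<in> B_syms \<T>" and xs: "xs \<in> tuples (B_arity f) Sub"
  shows "oper Q f (map encode xs) = encode (oper Pw f xs)"
proof -
  let ?ys = "map decode (map encode xs)"
  have ys: "?ys \<in> tuples (B_arity f) Sub" using xs decode_Sub by (auto simp: tuples_def)
  have "encode (oper Pw f ?ys) = encode (oper Pw f xs)"
  proof (cases "\<exists>x\<in>set xs. x \<in> Zs")
    case True
    then obtain x where x: "x \<in> set xs" "x \<in> Zs" by blast
    then have "x \<in> Sub" "decode (encode x) \<in> set ?ys" using xs by (auto simp: tuples_def)
    then have "decode (encode x) \<in> Zs" using decode_encode[of x] x Ns_Zs by blast
    then have "oper Pw f ?ys \<in> Zs" "oper Pw f xs \<in> Zs"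
      using op_Zs[OF f ys] op_Zs[OF f xs] x \<open>decode (encode x) \<in> set ?ys\<close> by blast+
    then show ?thesis by (simp add: encode_def)
  next
    case False
    then have "?ys = xs" using xs decode_encode by (fastforce simp: tuples_def intro!: map_idI)
    then show ?thesis by (simp only:)
  qed
  then show ?thesis by (simp add: Q_def)
qed

lemma map_encode_decode: "ds \<in> tuples n (encode ` Sub) \<Longrightarrow> map decode ds \<in> tuples n Sub \<and> map encode (map decode ds) = ds"
  using decode_Sub by (auto simp: tuples_def subset_iff intro!: map_idI)

definition zero :: "int option \<Rightarrow> elem" where "zero = (\<lambda>i\<in>idx. Zero)"

lemma zero_Zs: "zero \<in> Zs"
  using zero_win by (auto simp: zero_def Zs_def idx_def B_univ_def)

lemma Q_variety: "Q \<in> variety_generated (B_alg \<T>)"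
proof (rule variety_generated_if_HSP[OF is_ualg_B_alg[OF tm]])
  show "subuniverse Sub Pw"
    unfolding subuniverse_def
    using Sub_univ op_Sub zero_Zs by (auto simp: power_ualg_def B_alg_def Sub_def)
  show "hom_onto encode (Pw\<lparr>univ := Sub\<rparr>) Q"
    unfolding hom_onto_def using Q_oper
    by (auto simp: similar_def power_ualg_def B_alg_def)
qed

lemma Q_ualg: "is_ualg Q"
  using Q_variety by (simp add: variety_generated_def)

lemma Q_absorb:
  assumes "f \<in> B_syms \<T>" "ds \<in> tuples (B_arity f) (encode ` Sub)" "0 \<in> set ds"
  shows "oper Q f ds = 0"
proof -
  have "decode 0 \<in> Zs" using decode_encode[of zero] zero_Zs Ns_Zs by (auto simp: Sub_def encode_def)
  moreover have "decode 0 \<in> set (map decode ds)" using assms(3) by simp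
  ultimately have "oper Pw f (map decode ds) \<in> Zs"
    using op_Zs[OF assms(1)] map_encode_decode[OF assms(2)] by blast
  then show ?thesis by (simp add: Q_def encode_def)
qed

section \<open>The kernel of the projection to the window and a compatible order\<close>

definition proj :: "(int option \<Rightarrow> elem) \<Rightarrow> (int \<Rightarrow> elem) option" where
  "proj x = (if x \<in> Zs then None else Some (\<lambda>k\<in>win. x (Some k)))"

text \<open>Operations act coordinatewise and membership in \<open>Zs\<close> is read off the
  window, so the entry at \<open>None\<close> never influences the projection of a result.\<close>

lemma proj_op:
  assumes f: "f \<in> B_syms \<T>" and xs: "xs \<in> tuples (B_arity f) Sub" and ys: "ys \<in> tuples (B_arity f) Sub"
    and eq: "list_all2 (\<lambda>x y. proj x = proj y) xs ys"
  shows "proj (oper Pw f xs) = proj (oper Pw f ys)"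
proof (cases "\<exists>x\<in>set xs. x \<in> Zs")
  case True
  then obtain i where i: "i < length xs" "xs ! i \<in> Zs" by (metis in_set_conv_nth)
  then have "ys ! i \<in> Zs" "i < length ys" using eq by (auto simp: list_all2_conv_all_nth proj_def split: if_splits)
  then show ?thesis using op_Zs[OF f xs nth_mem] op_Zs[OF f ys nth_mem] i by (simp add: proj_def)
next
  case False
  then have "xs ! i \<notin> Zs" if "i < length xs" for i using that by auto
  then have rr: "xs ! i \<notin> Zs \<and> ys ! i \<notin> Zs \<and> (\<lambda>k\<in>win. (xs ! i) (Some k)) = (\<lambda>k\<in>win. (ys ! i) (Some k))" if "i < length xs" for i
    using eq that unfolding list_all2_conv_all_nth proj_def by (metis option.distinct(1) option.inject)
  have e: "(xs ! i) (Some k) = (ys ! i) (Some k)" if "i < length xs" "k \<in> win" for i k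
  proof -
    have "(\<lambda>k\<in>win. (xs ! i) (Some k)) = (\<lambda>k\<in>win. (ys ! i) (Some k))"
      using rr[OF that(1)] by blast
    from fun_cong[OF this, of k] show ?thesis using that(2) by simp
  qed
  have "map (\<lambda>g. g (Some k)) xs = map (\<lambda>g. g (Some k)) ys" if "k \<in> win" for k
    by (rule nth_equalityI) (use e that list_all2_lengthD[OF eq] in auto)
  then have c: "oper Pw f xs (Some k) = oper Pw f ys (Some k)" if "k \<in> win" for k
    using that by (simp add: Pw_oper Some_idx)
  have "oper Pw f xs \<in> idx \<rightarrow>\<^sub>E B_univ \<T>" "oper Pw f ys \<in> idx \<rightarrow>\<^sub>E B_univ \<T>"
    using op_Sub[OF f xs] op_Sub[OF f ys] Sub_univ by auto
  then have "oper Pw f xs \<in> Zs \<longleftrightarrow> oper Pw f ys \<in> Zs"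
    using c by (auto simp: Zs_def)
  moreover have "(\<lambda>k\<in>win. oper Pw f xs (Some k)) = (\<lambda>k\<in>win. oper Pw f ys (Some k))"
    using c by (intro restrict_ext) auto
  ultimately show ?thesis by (simp add: proj_def)
qed

definition beta :: "nat rel" where
  "beta = {(d, e). d \<in> encode ` Sub \<and> e \<in> encode ` Sub \<and> proj (decode d) = proj (decode e)}"

lemma beta_congruence: "congruence Q beta"
  unfolding congruence_def
proof (intro conjI ballI allI impI)
  show "equiv (univ Q) beta"
    by (auto simp: equiv_def refl_on_def sym_def trans_def beta_def)
  fix f ds es assume f: "f \<in> syms Q"
    and h: "length ds = arity Q f \<and> list_all2 (\<lambda>x y. (x, y) \<in> beta) ds es"
  then have ds: "ds \<in> tuples (B_arity f) (encode ` Sub)" and es: "es \<in> tuples (B_arity f) (encode ` Sub)"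
    by (auto simp: tuples_def list_all2_conv_all_nth in_set_conv_nth beta_def)
  have "list_all2 (\<lambda>x y. proj x = proj y) (map decode ds) (map decode es)"
    using h by (auto simp: list_all2_conv_all_nth beta_def)
  then have p: "proj (oper Pw f (map decode ds)) = proj (oper Pw f (map decode es))"
    using proj_op f map_encode_decode[OF ds] map_encode_decode[OF es] by simp
  have S: "oper Pw f (map decode ds) \<in> Sub" "oper Pw f (map decode es) \<in> Sub"
    using op_Sub f map_encode_decode[OF ds] map_encode_decode[OF es] by simp_all
  have ph: "proj (decode (encode x)) = proj x" if "x \<in> Sub" for x
    using decode_encode[OF that] by (auto simp: proj_def)
  show "(oper Q f ds, oper Q f es) \<in> beta"
    using p S ph by (simp add: beta_def Q_def)
qed

text \<open>Respected by all operations, which rules out a complement on the trace.\<close>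

definition ord :: "nat \<Rightarrow> nat \<Rightarrow> bool" where
  "ord d e \<longleftrightarrow> proj (decode d) = proj (decode e) \<and> (decode d \<in> Zs \<or> B_le (decode d None) (decode e None))"

lemma ord_compatible: "compatible Q ord"
  unfolding compatible_def
proof (intro conjI ballI impI)
  fix x assume "x \<in> univ Q"
  then show "ord x x" by (simp add: ord_def B_le_refl)
next
  fix f ds es assume f: "f \<in> syms Q" and ds: "ds \<in> tuples (arity Q f) (univ Q)"
    and es: "es \<in> tuples (arity Q f) (univ Q)" and h: "list_all2 ord ds es"
  let ?xs = "map decode ds" and ?ys = "map decode es"
  have f: "f \<in> B_syms \<T>" using f by simp
  have xs: "?xs \<in> tuples (B_arity f) Sub" and ys: "?ys \<in> tuples (B_arity f) Sub"
    using map_encode_decode ds es by simp_all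
  have "list_all2 (\<lambda>x y. proj x = proj y) ?xs ?ys"
    using h by (auto simp: list_all2_conv_all_nth ord_def)
  then have p: "proj (oper Pw f ?xs) = proj (oper Pw f ?ys)" by (rule proj_op[OF f xs ys])
  show "ord (oper Q f ds) (oper Q f es)"
  proof (cases "oper Pw f ?xs \<in> Zs")
    case True
    then have "oper Pw f ?ys \<in> Zs" using p by (auto simp: proj_def split: if_splits)
    then have "encode (oper Pw f ?ys) = encode (oper Pw f ?xs)" using True by (simp add: encode_def)
    then show ?thesis by (simp add: Q_def ord_def B_le_refl)
  next
    case False
    then have "oper Pw f ?ys \<notin> Zs" using p by (auto simp: proj_def split: if_splits)
    \<comment> \<open>Both results avoid \<open>Zs\<close>, so both argument lists are live and
      \<open>live_args_mono\<close> applies at \<open>None\<close>.\<close>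
    note rx = op_result[OF f xs False] and ry = op_result[OF f ys this]
    have nz: "\<forall>x\<in>set ?xs. x \<notin> Zs" using rx Ns_Zs by blast
    have "list_all2 B_le (map (\<lambda>g. g None) ?xs) (map (\<lambda>g. g None) ?ys)"
      using h nz by (auto simp: list_all2_conv_all_nth ord_def)
    then have "B_le (oper Pw f ?xs None) (oper Pw f ?ys None)"
      using live_args_mono rx ry unfolding Pw_oper by (simp add: None_idx)
    moreover have "decode (oper Q f ds) = oper Pw f ?xs" "decode (oper Q f es) = oper Pw f ?ys"
      using decode_Ns rx ry by (simp_all add: Q_def)
    ultimately show ?thesis using p by (simp add: ord_def)
  qed
qed

section \<open>Operations and runs on configurations in the quotient\<close>

lemma tup_Sub: "w \<in> configs \<Longrightarrow> p \<in> P_set \<Longrightarrow> tup w p \<in> Sub" "j \<in> head_pos \<Longrightarrow> tup (fv j) E1 \<in> Sub"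
  by (simp_all add: Sub_def NsI)

lemma meet_tup: "oper Pw OMeet [tup w p, tup w q] = tup w (B_meet p q)"
  by (rule tup_eqI[OF Pw_oper_ext]) (simp_all add: Pw_oper None_idx Some_idx B_meet_eq)

lemma T1_tup:
  "oper Pw OT1 [tup start p, tup start q] = tup start (B_T1 p q)"
proof (rule tup_eqI[OF Pw_oper_ext])
  fix k assume "k \<in> win"
  \<comment> \<open>The machine starts in state 1 on the all-zero tape, so all entries are among the
    three symbols of \<open>V100_set\<close>.\<close>
  moreover from this have "start k \<in> V100_set" by (simp add: start_def config_vec_def V100_set_def)
  then have "B_T1 (start k) (start k) = start k"
    by (auto simp: B_T1_def V100_set_def)
  ultimately show "oper Pw OT1 [tup start p, tup start q] (Some k) = start k"
    by (simp add: Pw_oper Some_idx)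
qed (simp add: Pw_oper None_idx)

lemma T0_tup:
  assumes "\<And>k. k \<in> win \<Longrightarrow> w k \<in> V0_set"
  shows "oper Pw OT0 [tup w p] = tup w (B_T0 p)"
  by (rule tup_eqI[OF Pw_oper_ext])
    (use assms in \<open>fastforce simp: Pw_oper None_idx Some_idx B_T0_def V0_set_def\<close>)+

lemma move_tup:
  assumes "p \<in> P_set"
  shows "oper Pw (OMach F) [tup (fv j) E1, tup (fv (j + 1)) E1, tup w p] = tup (mv F j w) p"
  by (rule tup_eqI[OF Pw_oper_ext]) (use assms in \<open>simp_all add: Pw_oper None_idx Some_idx mach_op_P mv_def\<close>)

lemma syms_basic: "OMeet \<in> B_syms \<T>" "OT0 \<in> B_syms \<T>" "OT1 \<in> B_syms \<T>"
  "F \<in> mach_syms \<T> \<Longrightarrow> OMach F \<in> B_syms \<T>"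
  by (auto simp: B_syms_def)

lemma Q_move:
  assumes "F \<in> mach_syms \<T>" "j \<in> head_pos" "j + 1 \<in> head_pos" "w \<in> configs" "p \<in> P_set"
  shows "oper Q (OMach F) [encode (tup (fv j) E1), encode (tup (fv (j + 1)) E1), encode (tup w p)] = encode (tup (mv F j w) p)"
  using Q_oper[of "OMach F" "[tup (fv j) E1, tup (fv (j + 1)) E1, tup w p]"] assms move_tup[of p F j w]
  by (simp add: syms_basic tuples_def tup_Sub)

lemma Q_meet:
  assumes "w \<in> configs" "p \<in> P_set" "q \<in> P_set"
  shows "oper Q OMeet [encode (tup w p), encode (tup w q)] = encode (tup w (B_meet p q))"
  using Q_oper[of OMeet "[tup w p, tup w q]"] assms meet_tup[of w p q]
  by (simp add: syms_basic tuples_def tup_Sub)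

lemma Q_T1:
  assumes "p \<in> P_set" "q \<in> P_set"
  shows "oper Q OT1 [encode (tup start p), encode (tup start q)] = encode (tup start (B_T1 p q))"
  using Q_oper[of OT1 "[tup start p, tup start q]"] assms T1_tup[of p q]
  by (simp add: syms_basic tuples_def tup_Sub start_configs)

lemma Q_T0:
  assumes "w \<in> configs" "\<And>k. k \<in> win \<Longrightarrow> w k \<in> V0_set" "p \<in> P_set"
  shows "oper Q OT0 [encode (tup w p)] = encode (tup w (B_T0 p))"
  using Q_oper[of OT0 "[tup w p]"] assms T0_tup[of w p]
  by (simp add: syms_basic tuples_def tup_Sub)

text \<open>A run becomes one transformation \<open>G\<close> of polynomial terms, nesting machine
  operations with \<open>fv\<close> tuples as constants. It works for all \<open>p\<close> at once
  because the steps leave \<open>p\<close> alone.\<close>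

lemma run_poly:
  assumes "mstep\<^sup>*\<^sup>* w w'" "w \<in> configs"
  obtains G where "\<And>n t. t \<in> poly_terms Q n \<Longrightarrow> G t \<in> poly_terms Q n"
    "\<And>t xs p. p \<in> P_set \<Longrightarrow> poly_eval Q t xs = encode (tup w p) \<Longrightarrow> poly_eval Q (G t) xs = encode (tup w' p)"
proof -
  have "w' \<in> configs \<and> (\<exists>G. (\<forall>n t. t \<in> poly_terms Q n \<longrightarrow> G t \<in> poly_terms Q n) \<and>
    (\<forall>t xs. \<forall>p\<in>P_set. poly_eval Q t xs = encode (tup w p) \<longrightarrow> poly_eval Q (G t) xs = encode (tup w' p)))"
    using assms(1)
  proof induction
    case base
    then show ?case using assms(2) by (intro conjI exI[of _ id]) auto
  next
    case (step w' w'')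
    then obtain G where G: "\<And>n t. t \<in> poly_terms Q n \<Longrightarrow> G t \<in> poly_terms Q n"
      "\<And>t xs p. p \<in> P_set \<Longrightarrow> poly_eval Q t xs = encode (tup w p) \<Longrightarrow> poly_eval Q (G t) xs = encode (tup w' p)"
      by blast
    obtain F j where F: "F \<in> mach_syms \<T>" and j: "j \<in> head_pos" "j + 1 \<in> head_pos" and w'': "w'' = mv F j w'"
      using step.hyps(2) by (auto simp: mstep_def)
    define G' where "G' t = App (OMach F) [Var (Inl (encode (tup (fv j) E1))),
      Var (Inl (encode (tup (fv (j + 1)) E1))), G t]" for t
    have "G' t \<in> poly_terms Q n" if "t \<in> poly_terms Q n" for n t
      using G(1)[OF that] F j tup_Sub by (auto simp: G'_def poly_terms_def syms_basic)
    moreover have "poly_eval Q (G' t) xs = encode (tup w'' p)"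
      if "p \<in> P_set" "poly_eval Q t xs = encode (tup w p)" for t xs p
      using G(2)[OF that] Q_move[OF F j _ that(1), of w'] step.IH
      by (simp add: G'_def poly_eval_def w'')
    moreover have "w'' \<in> configs" using configs_step step by blast
    ultimately show ?case by blast
  qed
  then show ?thesis using that by blast
qed

section \<open>Minimality of \<open>beta\<close>\<close>

lemma congruence_op:
  "congruence Q \<theta> \<Longrightarrow> f \<in> B_syms \<T> \<Longrightarrow> length xs = B_arity f \<Longrightarrow>
    list_all2 (\<lambda>x y. (x, y) \<in> \<theta>) xs ys \<Longrightarrow> (oper Q f xs, oper Q f ys) \<in> \<theta>"
  unfolding congruence_def by simp

lemma congruence_move:
  assumes \<theta>: "congruence Q \<theta>" and w: "w \<in> configs" "mstep\<^sup>*\<^sup>* w w'" and p: "p \<in> P_set" "q \<in> P_set"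
    and pq: "(encode (tup w p), encode (tup w q)) \<in> \<theta>"
  shows "(encode (tup w' p), encode (tup w' q)) \<in> \<theta>"
proof -
  obtain G where G: "\<And>n t. t \<in> poly_terms Q n \<Longrightarrow> G t \<in> poly_terms Q n"
    "\<And>t xs p. p \<in> P_set \<Longrightarrow> poly_eval Q t xs = encode (tup w p) \<Longrightarrow> poly_eval Q (G t) xs = encode (tup w' p)"
    using run_poly[OF w(2,1)] by metis
  have "Var (Inr 0) \<in> poly_terms Q 1" by (auto simp: poly_terms_def)
  note t = G(1)[OF this]
  have S: "[encode (tup w p)] \<in> tuples 1 (univ Q)" "[encode (tup w q)] \<in> tuples 1 (univ Q)"
    using w p tup_Sub by (auto simp: tuples_def)
  have "(poly_eval Q (G (Var (Inr 0))) [encode (tup w p)], poly_eval Q (G (Var (Inr 0))) [encode (tup w q)]) \<in> \<theta>"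
    by (rule poly_eval_compatible[OF Q_ualg congruence_compatible[OF \<theta>] t S]) (use pq in simp)
  then show ?thesis using G(2)[OF p(1), of "Var (Inr 0)" "[encode (tup w p)]"]
      G(2)[OF p(2), of "Var (Inr 0)" "[encode (tup w q)]"] by (simp add: poly_eval_def)
qed

text \<open>The collapsed class and the \<open>fv\<close> tuples are determined by their projection,
  so nontrivial pairs come from one configuration with two entries at \<open>None\<close>.\<close>

lemma beta_cases:
  assumes "(d, e) \<in> beta" "d \<noteq> e"
  obtains w p q where "w \<in> configs" "p \<in> P_set" "q \<in> P_set" "d = encode (tup w p)" "e = encode (tup w q)"
proof -
  have S: "decode d \<in> Sub" "decode e \<in> Sub" "encode (decode d) = d" "encode (decode e) = e"
    and pr: "proj (decode d) = proj (decode e)"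
    using assms(1) decode_Sub by (auto simp: beta_def)
  have nz: "decode d \<notin> Zs" using S pr assms(2) by (auto simp: proj_def encode_def split: if_splits)
  then have "decode e \<notin> Zs" using pr by (auto simp: proj_def split: if_splits)
  then have N: "decode d \<in> Ns" "decode e \<in> Ns" using nz S by (auto simp: Sub_def)
  have r: "(\<lambda>k\<in>win. decode d (Some k)) = (\<lambda>k\<in>win. decode e (Some k))"
    using pr nz \<open>decode e \<notin> Zs\<close> by (simp add: proj_def)
  have eq: "\<forall>k\<in>win. decode d (Some k) = decode e (Some k)"
  proof
    fix k assume "k \<in> win"
    then show "decode d (Some k) = decode e (Some k)" using fun_cong[OF r, of k] by simp
  qed
  from N eq show ?thesis
    by (cases rule: Ns_same) (use that S assms(2) in metis)+
qed

text \<open>A nontrivial pair is carried back to the start configuration, where it generates all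
  pairs over \<open>P_set\<close>; runs then spread these to every configuration.\<close>

lemma beta_atom:
  assumes h: "h \<in> configs" "\<And>k. k \<in> win \<Longrightarrow> h k \<in> V0_set"
    and \<theta>: "congruence Q \<theta>" and de: "(d, e) \<in> \<theta>" "(d, e) \<in> beta" "d \<noteq> e"
  shows "beta \<subseteq> \<theta>"
proof -
  define E where "E p q \<longleftrightarrow> p \<in> P_set \<and> q \<in> P_set \<and> (encode (tup start p), encode (tup start q)) \<in> \<theta>" for p q
  note sc = start_configs
  have eqv: "equiv (encode ` Sub) \<theta>" using \<theta> by (simp add: congruence_def)
  have refl: "(x, x) \<in> \<theta>" if "x \<in> encode ` Sub" for x using eqv that by (auto simp: equiv_def refl_on_def)
  have Er: "E p p" if "p \<in> P_set" for p using that refl tup_Sub sc by (simp add: E_def)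
  have Es: "E q p" if "E p q" for p q using that eqv by (auto simp: E_def equiv_def sym_def)
  have Et: "E p r" if "E p q" "E q r" for p q r using that eqv unfolding E_def equiv_def trans_def by blast
  have Em: "E (B_meet p c) (B_meet q c)" if "E p q" "c \<in> P_set" for p q c
    using congruence_op[OF \<theta> syms_basic(1), of "[encode (tup start p), encode (tup start c)]"
        "[encode (tup start q), encode (tup start c)]"] that refl tup_Sub(1)[OF sc] P_meet
    by (simp add: E_def Q_meet[OF sc])
  have E1: "E (B_T1 p c) (B_T1 q c)" if "E p q" "c \<in> P_set" for p q c
    using congruence_op[OF \<theta> syms_basic(3), of "[encode (tup start p), encode (tup start c)]"
        "[encode (tup start q), encode (tup start c)]"] that refl tup_Sub(1)[OF sc] P_T1
    by (simp add: E_def Q_T1)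
  \<comment> \<open>\<open>OT0\<close> keeps only windows of state 0, so the pair is moved to the
    halting configuration \<open>h\<close>, treated there and moved back.\<close>
  have E0: "E (B_T0 p) (B_T0 q)" if "E p q" for p q
  proof -
    have P: "p \<in> P_set" "q \<in> P_set" using that by (auto simp: E_def)
    have "(encode (tup h p), encode (tup h q)) \<in> \<theta>"
      by (rule congruence_move[OF \<theta> sc _ P]) (use h that in \<open>auto simp: configs_def E_def\<close>)
    then have "(encode (tup h (B_T0 p)), encode (tup h (B_T0 q))) \<in> \<theta>"
      using congruence_op[OF \<theta> syms_basic(2), of "[encode (tup h p)]" "[encode (tup h q)]"]
        Q_T0[OF h P(1)] Q_T0[OF h P(2)] by simp
    then show ?thesis unfolding E_def
      using congruence_move[OF \<theta> h(1) configs_connected[OF h(1)]] P_T0 P by blast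
  qed
  obtain w p q where w: "w \<in> configs" "p \<in> P_set" "q \<in> P_set" "d = encode (tup w p)" "e = encode (tup w q)"
    using beta_cases[OF de(2,3)] by metis
  have pq: "p \<noteq> q" "E p q"
    using w de congruence_move[OF \<theta> w(1) configs_connected[OF w(1)] w(2,3)] by (auto simp: E_def)
  \<comment> \<open>Meeting the pair (\<open>P0\<close>, \<open>P1\<close>) with \<open>P0\<close>
    gives (\<open>P0\<close>, \<open>P2\<close>), and so does applying \<open>B_T0\<close> to
    (\<open>P1\<close>, \<open>P2\<close>).\<close>
  have E02: "E P0 P2"
  proof -
    have "E P0 P1 \<or> E P0 P2 \<or> E P1 P2" using pq Es w(2,3) by (auto simp: P_set_def)
    then show ?thesis using Em[of P0 P1 P0] E0[of P1 P2] by (auto simp: B_meet_eq B_T0_def)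
  qed
  \<comment> \<open>\<open>B_T1\<close> with second argument \<open>P2\<close> sends
    \<open>P0\<close> to \<open>P1\<close> and \<open>P2\<close> to itself.\<close>
  then have E12: "E P1 P2" using E1[of P0 P2 P2] by (simp add: B_T1_def doubleton_eq_iff)
  have E01: "E P0 P1" by (rule Et[OF E02 Es[OF E12]])
  have E: "E p q" if "p \<in> P_set" "q \<in> P_set" for p q
    using that Er[OF that(1)] E02 E12 E01 Es[OF E02] Es[OF E12] Es[OF E01] by (auto simp: P_set_def)
  show ?thesis
  proof
    fix x assume x: "x \<in> beta"
    show "x \<in> \<theta>"
    proof (cases "fst x = snd x")
      case True
      then show ?thesis using x refl by (cases x) (auto simp: beta_def)
    next
      case False
      then obtain w p q where w: "w \<in> configs" "p \<in> P_set" "q \<in> P_set" "fst x = encode (tup w p)" "snd x = encode (tup w q)"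
        using beta_cases x by (metis prod.collapse)
      have "mstep\<^sup>*\<^sup>* start w" using w(1) by (simp add: configs_def)
      then have "(fst x, snd x) \<in> \<theta>"
        using congruence_move[OF \<theta> sc _ w(2,3)] E[OF w(2,3)] w by (simp add: E_def)
      then show ?thesis by simp
    qed
  qed
qed

section \<open>The type of the prime quotient\<close>

lemma tup_start_ord: "ord (encode (tup start p)) (encode (tup start q)) \<longleftrightarrow> B_le p q"
  if "p \<in> P_set" "q \<in> P_set" for p q
proof -
  have N: "tup start p \<in> Ns" "tup start q \<in> Ns" using that NsI start_configs by auto
  have "proj (tup start p) = proj (tup start q)"
    using Ns_Zs N by (auto simp: proj_def)
  then show ?thesis using N Ns_Zs by (simp add: ord_def decode_Ns)
qed

lemma encode_tup_inj:
  assumes "w \<in> configs" "p \<in> P_set" "q \<in> P_set"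
  shows "encode (tup w p) = encode (tup w q) \<longleftrightarrow> p = q"
proof
  assume "encode (tup w p) = encode (tup w q)"
  then have "tup w q = tup w p"
    using assms encode_eq[of "tup w p" "tup w q"] tup_Sub Ns_Zs NsI by blast
  then show "p = q" using tup_simps(1) by metis
qed simp

lemma Q_type4:
  assumes h: "h \<in> configs" "\<And>k. k \<in> win \<Longrightarrow> h k \<in> V0_set"
  shows "prime_quotient Q (Id_on (univ Q)) beta \<and> has_tct_type Q (Id_on (univ Q)) beta Type4"
proof -
  note sc = start_configs
  define c where "c p = encode (tup start p)" for p
  have cS: "c p \<in> encode ` Sub" if "p \<in> P_set" for p using that tup_Sub sc by (simp add: c_def)
  have cinj: "c p = c q \<longleftrightarrow> p = q" if "p \<in> P_set" "q \<in> P_set" for p q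
    using that encode_tup_inj[OF sc] by (simp add: c_def)
  have c0: "c p \<noteq> 0" if "p \<in> P_set" for p
    using that Ns_Zs[OF NsI(2)[OF sc]] by (simp add: c_def encode_def)
  have Qm: "oper Q OMeet [c p, c q] = c (B_meet p q)" if "p \<in> P_set" "q \<in> P_set" for p q
    using Q_meet[OF sc that] by (simp add: c_def)
  obtain G where G: "\<And>n t. t \<in> poly_terms Q n \<Longrightarrow> G t \<in> poly_terms Q n"
    "\<And>t xs p. p \<in> P_set \<Longrightarrow> poly_eval Q t xs = encode (tup start p) \<Longrightarrow> poly_eval Q (G t) xs = encode (tup h p)"
    using run_poly[of start h] h(1) sc by (metis configs_def mem_Collect_eq)
  obtain G' where G': "\<And>n t. t \<in> poly_terms Q n \<Longrightarrow> G' t \<in> poly_terms Q n"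
    "\<And>t xs p. p \<in> P_set \<Longrightarrow> poly_eval Q t xs = encode (tup h p) \<Longrightarrow> poly_eval Q (G' t) xs = encode (tup start p)"
    using run_poly[OF configs_connected[OF h(1)] h(1)] by metis
  \<comment> \<open>Meeting with the start configuration at \<open>P0\<close> collapses everything
    but that configuration, on which only the values \<open>P2\<close> and \<open>P0\<close>
    remain.\<close>
  define pe where "pe = App OMeet [Var (Inr 0), Var (Inl (c P0)) :: (B_sym, nat + nat) uterm]"
  define pm where "pm = App OMeet [Var (Inr 0), Var (Inr 1) :: (B_sym, nat + nat) uterm]"
  define j1 where "j1 = App OT1 [Var (Inr 0), Var (Inr 1) :: (B_sym, nat + nat) uterm]"
  \<comment> \<open>With \<open>P2\<close> as bottom and \<open>P0\<close> as top,
    \<open>B_T1\<close> gives \<open>P1\<close> if some argument is \<open>P0\<close> and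
    \<open>P2\<close> otherwise; after the run to \<open>h\<close>, \<open>B_T0\<close> turns
    \<open>P1\<close> into \<open>P0\<close> and keeps \<open>P2\<close>, and \<open>G'\<close> runs
    back.\<close>
  define pj where "pj = G' (App OT0 [G j1])"
  have pj: "poly_eval Q pj [c p, c q] = c (B_T0 (B_T1 p q))" if "p \<in> P_set" "q \<in> P_set" for p q
  proof -
    have "poly_eval Q j1 [c p, c q] = encode (tup start (B_T1 p q))"
      using Q_T1[OF that] by (simp add: j1_def poly_eval_def c_def)
    from G(2)[OF P_T1[OF that] this]
    have "poly_eval Q (App OT0 [G j1]) [c p, c q] = encode (tup h (B_T0 (B_T1 p q)))"
      using Q_T0[OF h P_T1[OF that]] by (simp add: poly_eval_def)
    from G'(2)[OF P_T0[OF P_T1[OF that]] this] show ?thesis by (simp add: pj_def c_def)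
  qed
  have j1: "j1 \<in> poly_terms Q 2" by (auto simp: j1_def poly_terms_def syms_basic)
  show ?thesis
  proof (rule atom_type4[where z = 0 and a = "c P2" and b = "c P0" and R = ord])
    show "is_ualg Q" by (rule Q_ualg)
    show "0 \<in> univ Q" using zero_Zs by (auto simp: Sub_def encode_def image_iff)
    show "oper Q f xs = 0" if "f \<in> syms Q" "xs \<in> tuples (arity Q f) (univ Q)" "0 \<in> set xs" for f xs
      using Q_absorb that by simp
    show "congruence Q beta" by (rule beta_congruence)
    have N: "tup start p \<in> Ns" if "p \<in> P_set" for p using that NsI sc by blast
    have "proj (tup start P2) = proj (tup start P0)"
      using Ns_Zs N by (auto simp: proj_def)
    then show "(c P2, c P0) \<in> beta"
      using cS N by (simp add: beta_def decode_Ns c_def)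
    show "x = 0" if b0: "(0, x) \<in> beta" for x
    proof (rule ccontr)
      assume "x \<noteq> 0"
      then obtain w p where "w \<in> configs" "p \<in> P_set" "0 = encode (tup w p)"
        using beta_cases[OF b0] by metis
      then show False using Ns_Zs[OF NsI(2)] by (simp add: encode_def)
    qed
    show "beta \<subseteq> \<theta>" if "congruence Q \<theta>" "(x, y) \<in> \<theta>" "(x, y) \<in> beta" "x \<noteq> y" for \<theta> x y
      using beta_atom[OF h that] .
    show "compatible Q ord" by (rule ord_compatible)
    show "ord (c P2) (c P0)" "\<not> ord (c P0) (c P2)"
      by (simp_all add: c_def tup_start_ord B_le_def)
    show "pe \<in> poly_terms Q 1" using cS[of P0] by (auto simp add: pe_def poly_terms_def syms_basic)
    show "poly_eval Q pe [x] \<in> {0, c P2, c P0}" if xQ: "x \<in> univ Q" for x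
    proof -
      obtain y where y: "y \<in> Sub" "x = encode y" using xQ by auto
      have t: "[y, tup start P0] \<in> tuples (B_arity OMeet) Sub"
        using y tup_Sub sc by (simp add: tuples_def)
      have "poly_eval Q pe [x] = encode (oper Pw OMeet [y, tup start P0])"
        using Q_oper[OF syms_basic(1) t] by (simp add: pe_def poly_eval_def y c_def)
      moreover have "oper Pw OMeet [y, tup start P0] \<in> {tup start P2, tup start P0}"
        if nz: "oper Pw OMeet [y, tup start P0] \<notin> Zs"
      proof -
        let ?r = "oper Pw OMeet [y, tup start P0]"
        have r: "y \<in> Ns" "?r \<in> Ns" using op_result[OF syms_basic(1) t nz] by auto
        \<comment> \<open>Window entries lie outside \<open>P_set\<close>, so a nonzero meet forces
          them to agree with \<open>start\<close>.\<close>
        have "B_meet (y (Some k)) (start k) = start k" if "k \<in> win" for k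
          using Ns_win[OF r(2) that] Ns_win[OF r(1) that] that
          by (auto simp: Pw_oper Some_idx B_meet_eq split: if_splits)
        then have "?r = tup start (B_meet (y None) P0)"
          by (intro tup_eqI[OF Pw_oper_ext]) (simp_all add: Pw_oper None_idx Some_idx)
        moreover have "y None \<in> P_set" using op_result[OF syms_basic(1) t nz] by auto
        then have "B_meet (y None) P0 \<in> {P2, P0}" by (auto simp: B_meet_eq split: if_splits)
        ultimately show ?thesis by auto
      qed
      ultimately show ?thesis by (cases "oper Pw OMeet [y, tup start P0] \<in> Zs") (auto simp: encode_def c_def)
    qed
    show "poly_eval Q pe [c P2] = c P2" "poly_eval Q pe [c P0] = c P0"
      using Qm by (simp_all add: pe_def poly_eval_def B_meet_eq)
    show "pm \<in> poly_terms Q 2" by (auto simp: pm_def poly_terms_def syms_basic)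
    show "pj \<in> poly_terms Q 2"
      unfolding pj_def by (rule G'(1)) (use G(1)[OF j1] in \<open>auto simp: poly_terms_def syms_basic\<close>)
    show "poly_eval Q pm [x, y] = two_oper (c P2) (c P0) MeetS [x, y]"
      if "x \<in> {c P2, c P0}" "y \<in> {c P2, c P0}" for x y
      using that Qm cinj by (auto simp: pm_def poly_eval_def B_meet_eq)
    show "poly_eval Q pj [x, y] = two_oper (c P2) (c P0) JoinS [x, y]"
      if "x \<in> {c P2, c P0}" "y \<in> {c P2, c P0}" for x y
      using that pj cinj by (auto simp: B_T0_def B_T1_def doubleton_eq_iff)
  qed
qed

lemma type4_if_halting_config:
  assumes "h \<in> configs" "\<And>k. k \<in> win \<Longrightarrow> h k \<in> V0_set"
  shows "Type4 \<in> typ_set (variety_generated (B_alg \<T>) :: (B_sym, nat) ualg set)"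
proof -
  have "finite Zs" by (rule finite_subset[of _ "idx \<rightarrow>\<^sub>E B_univ \<T>"])
      (auto simp: Zs_def idx_def win_def finite_B_univ intro!: finite_PiE)
  then have "finite (univ Q)" using finite_Ns by (simp add: Sub_def)
  then show ?thesis using Q_variety Q_type4[OF assms] unfolding typ_set_def by blast
qed

end

theorem theorem4p1:
  fixes \<T> :: tm
  assumes "turing_machine \<T>" and "halts \<T>"
  shows "Type4 \<in> typ_set (variety_generated (B_alg \<T>) :: (B_sym, nat) ualg set)"
proof -
  obtain q \<tau> where "(tm_step \<T>)\<^sup>*\<^sup>* (1, 0, \<lambda>_. False) (0, q, \<tau>)"
    using assms(2) by (auto simp: halts_def)
  \<comment> \<open>The window is taken so large that the whole halting run keeps its head strictly
    inside.\<close>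
  then obtain m where bd: "1 \<le> m" "(\<lambda>c c'. tm_step \<T> c c' \<and> \<bar>fst (snd c)\<bar> < m \<and> \<bar>fst (snd c')\<bar> < m)\<^sup>*\<^sup>*
      (1, 0, \<lambda>_. False) (0, q, \<tau>)"
    using run_bounded by blast
  interpret tape_window \<T> m
    by unfold_locales (use assms bd in auto)
  show ?thesis
  proof (rule type4_if_halting_config)
    show "config_vec (0, q, \<tau>) \<in> configs"
      using config_vec_run[OF bd(2)] by (simp add: configs_def start_def)
    show "config_vec (0, q, \<tau>) k \<in> V0_set" if "k \<in> win" for k
      using that by (auto simp: config_vec_def V0_set_def)
  qed
qed

end
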